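(* Let $d\ge1$ and $\alpha,\beta\in\mathbb{R}^d$ with $\alpha_j,\beta_j\ge-1/2$. Let $\mathcal{L}:[0,\infty)\to[1,\infty)$ be monotone increasing with $\mathcal{L}(0)=1$ and $M:=1+\int_0^\infty\frac{dt}{(t+1)\mathcal{L}(t)}<\infty$, and let $\gamma,\tilde\gamma>0$. Let $\hat A$ be an admissible cutoff function of second kind which belongs to $\mathcal{S}(d,\mathcal{L};\gamma,\tilde\gamma M)$. Then the kernels $$\Lambda_n(x,y)=\sum_{\nu\in\mathbb{N}_0^d}\hat A\Big(\frac{\nu}{n}\Big)\tilde P_\nu^{(\alpha,\beta)}(x)\tilde P_\nu^{(\alpha,\beta)}(y),\quad n\ge1,$$ satisfy $$|\Lambda_n(x,y)|\le\frac{c\,n^d}{\sqrt{W_{\alpha,\beta}(n;x)}\sqrt{W_{\alpha,\beta}(n;y)}}\exp\Big\{-\frac{\tilde c\,n\rho(x,y)}{\mathcal{L}(n\rho(x,y))}\Big\},\quad x,y\in[-1,1]^d.$$ Here $\tilde c=c'/(\tilde\gamma M)$ with $c'>0$ an absolute constant, and the constant $c>0$ depends on $d,M,\alpha,\beta,\gamma$ and $\tilde\gamma$, but not on $x,y$ and $n$.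
   Context: For scalars $a,b\ge-1/2$, $\tilde P_n^{(a,b)}$ is the $n$th degree Jacobi polynomial normalized in $L^2([-1,1],(1-t)^a(1+t)^b)$, and $\tilde P_\nu^{(\alpha,\beta)}(x)=\prod_{j=1}^d\tilde P_{\nu_j}^{(\alpha_j,\beta_j)}(x_j)$. For $n\ge1$, $W_{\alpha,\beta}(n;x)=\prod_{j=1}^d(1-x_j+n^{-2})^{\alpha_j+1/2}(1+x_j+n^{-2})^{\beta_j+1/2}$. The distance is $\rho(x,y)=\max_{1\le j\le d}|\arccos x_j-\arccos y_j|$. For $\gamma,\bar\gamma>0$, $\mathcal{S}(d,\mathcal{L};\gamma,\bar\gamma)$ is the set of all $\hat A\in C^\infty[0,\infty)^d$ with $\|\hat A\|_\infty\le\gamma$ and $\frac1{k!}\|D_j^k\hat A\|_\infty\le\gamma(\bar\gamma\mathcal{L}(k-1))^k$ for all $k\in\mathbb{N}$, $1\le j\le d$, where $D_j^k=\partial^k/\partial t_j^k$. Let $\operatorname{proj}_k t$ denote $t\in\mathbb{R}^d$ with its $k$th coordinate replaced by $0$ (the paper's notation $\operatorname{proj}_k$). A function $\hat A\in C^\infty[0,\infty)^d$ is an admissible cutoff function of second kind if $\operatorname{supp}\hat A\subset[0,2]^d$, $\hat A(t)=\hat A(\operatorname{proj}_k t)$ for every $t\in[0,\infty)^d$ and every $k$ such that $t_k\le\frac12\|t\|_\infty$, and $\hat A$ is of one of the types: (a) $\hat A(t)=1$ for $t\in\mathcal{B}_1$; (b) $\hat A(t)=0$ for $t\in\frac12\mathcal{B}_1$;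 (c) $\hat A$ is of type (b) and $\sum_{j=0}^\infty|\hat A(2^{-j}t)|^2=1$ for $t\in[0,\infty)^d\setminus[0,1)^d$. Here $\mathcal{B}_1=\{t\in[0,\infty)^d:\|t\|_1\le1\}$. *)

theory Defs
  imports "HOL-Analysis.Analysis"
begin

text \<open>
  The dimension \<open>d\<close> has to be quantified inside the theorem, because one constant is uniform in
  \<open>d\<close>. Hence \<open>\<real>\<^sup>d\<close> is not a type here: a vector is a function \<open>nat \<Rightarrow> real\<close> whose entries with index
  below \<open>d\<close> are its coordinates (numbered from 0). Domains of functions consist of vectors
  whose entries at indices \<open>\<ge> d\<close> are 0; on such sets the product topology of \<open>nat \<Rightarrow> real\<close> is the
  usual topology of \<open>\<real>\<^sup>d\<close>.
\<close>

definition orthant :: "nat \<Rightarrow> (nat \<Rightarrow> real) set" where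
  "orthant d = {t. (\<forall>i<d. 0 \<le> t i) \<and> (\<forall>i\<ge>d. t i = 0)}"

definition multi_indices :: "nat \<Rightarrow> (nat \<Rightarrow> nat) set" where
  "multi_indices d = {\<nu>. \<forall>i\<ge>d. \<nu> i = 0}"

definition norm_1 :: "nat \<Rightarrow> (nat \<Rightarrow> real) \<Rightarrow> real" where
  "norm_1 d t = (\<Sum>i<d. \<bar>t i\<bar>)"

definition norm_inf :: "nat \<Rightarrow> (nat \<Rightarrow> real) \<Rightarrow> real" where
  "norm_inf d t = Max ((\<lambda>i. \<bar>t i\<bar>) ` {..<d})"


subsection \<open>Jacobi polynomials\<close>

text \<open>
  The classical explicit formula, i.e. the standardization \<open>P\<^sub>n(1) = (n + a) gchoose n\<close>.
\<close>

definition jacobi :: "nat \<Rightarrow> real \<Rightarrow> real \<Rightarrow> real \<Rightarrow> real" where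
  "jacobi n a b x =
     (\<Sum>k\<le>n. ((real n + a) gchoose (n - k)) * ((real n + b) gchoose k)
              * ((x - 1) / 2) ^ k * ((x + 1) / 2) ^ (n - k))"

definition jacobi_L2_norm :: "nat \<Rightarrow> real \<Rightarrow> real \<Rightarrow> real" where
  "jacobi_L2_norm n a b =
     sqrt (LINT t:{-1..1}|lborel. (jacobi n a b t)\<^sup>2 * ((1 - t) powr a * (1 + t) powr b))"

definition jacobi_normalized :: "nat \<Rightarrow> real \<Rightarrow> real \<Rightarrow> real \<Rightarrow> real" where
  "jacobi_normalized n a b x = jacobi n a b x / jacobi_L2_norm n a b"

definition jacobi_product ::
    "nat \<Rightarrow> (nat \<Rightarrow> real) \<Rightarrow> (nat \<Rightarrow> real) \<Rightarrow> (nat \<Rightarrow> nat) \<Rightarrow> (nat \<Rightarrow> real) \<Rightarrow> real" where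
  "jacobi_product d \<alpha> \<beta> \<nu> x = (\<Prod>j<d. jacobi_normalized (\<nu> j) (\<alpha> j) (\<beta> j) (x j))"

definition W :: "nat \<Rightarrow> (nat \<Rightarrow> real) \<Rightarrow> (nat \<Rightarrow> real) \<Rightarrow> nat \<Rightarrow> (nat \<Rightarrow> real) \<Rightarrow> real" where
  "W d \<alpha> \<beta> n x =
     (\<Prod>j<d. (1 - x j + 1 / (real n)\<^sup>2) powr (\<alpha> j + 1/2)
            * (1 + x j + 1 / (real n)\<^sup>2) powr (\<beta> j + 1/2))"

definition rho :: "nat \<Rightarrow> (nat \<Rightarrow> real) \<Rightarrow> (nat \<Rightarrow> real) \<Rightarrow> real" where
  "rho d x y = Max ((\<lambda>j. \<bar>arccos (x j) - arccos (y j)\<bar>) ` {..<d})"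


subsection \<open>Smooth functions on the closed orthant\<close>

text \<open>Partial derivatives are one-sided on the faces of the orthant.\<close>

definition partial_deriv ::
    "nat \<Rightarrow> ((nat \<Rightarrow> real) \<Rightarrow> complex) \<Rightarrow> (nat \<Rightarrow> real) \<Rightarrow> complex" where
  "partial_deriv j f t = vector_derivative (\<lambda>s. f (t(j := s))) (at (t j) within {0..})"

text \<open>All iterated partial derivatives exist and are continuous up to the boundary.\<close>

definition smooth_on_orthant :: "nat \<Rightarrow> ((nat \<Rightarrow> real) \<Rightarrow> complex) \<Rightarrow> bool" where
  "smooth_on_orthant d f \<longleftrightarrow>
     (\<forall>js. set js \<subseteq> {..<d} \<longrightarrow>
        continuous_on (orthant d) (foldr partial_deriv js f) \<and>
        (\<forall>j<d. \<forall>t\<in>orthant d.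
           (\<lambda>s. foldr partial_deriv js f (t(j := s))) differentiable (at (t j) within {0..})))"

definition class_S ::
    "nat \<Rightarrow> (real \<Rightarrow> real) \<Rightarrow> real \<Rightarrow> real \<Rightarrow> ((nat \<Rightarrow> real) \<Rightarrow> complex) set" where
  "class_S d L \<gamma> \<gamma>' =
     {A. smooth_on_orthant d A \<and>
         (\<forall>t\<in>orthant d. norm (A t) \<le> \<gamma>) \<and>
         (\<forall>k\<ge>1. \<forall>j<d. \<forall>t\<in>orthant d.
            1 / fact k * norm ((partial_deriv j ^^ k) A t) \<le> \<gamma> * (\<gamma>' * L (real k - 1)) ^ k)}"


subsection \<open>Admissible cutoff functions of second kind\<close>

definition B1 :: "nat \<Rightarrow> (nat \<Rightarrow> real) set" where
  "B1 d = {t \<in> orthant d. norm_1 d t \<le> 1}"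

definition cutoff_a :: "nat \<Rightarrow> ((nat \<Rightarrow> real) \<Rightarrow> complex) \<Rightarrow> bool" where
  "cutoff_a d A \<longleftrightarrow> (\<forall>t\<in>B1 d. A t = 1)"

definition cutoff_b :: "nat \<Rightarrow> ((nat \<Rightarrow> real) \<Rightarrow> complex) \<Rightarrow> bool" where
  "cutoff_b d A \<longleftrightarrow> (\<forall>t \<in> (\<lambda>t i. t i / 2) ` B1 d. A t = 0)"

definition cutoff_c :: "nat \<Rightarrow> ((nat \<Rightarrow> real) \<Rightarrow> complex) \<Rightarrow> bool" where
  "cutoff_c d A \<longleftrightarrow> cutoff_b d A \<and>
     (\<forall>t \<in> orthant d - {t \<in> orthant d. \<forall>i<d. t i < 1}.
        (\<lambda>j. (norm (A (\<lambda>i. t i / 2 ^ j)))\<^sup>2) sums 1)"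

definition admissible_cutoff_second_kind :: "nat \<Rightarrow> ((nat \<Rightarrow> real) \<Rightarrow> complex) \<Rightarrow> bool" where
  "admissible_cutoff_second_kind d A \<longleftrightarrow>
     smooth_on_orthant d A \<and>
     closure {t \<in> orthant d. A t \<noteq> 0} \<subseteq> {t \<in> orthant d. \<forall>i<d. t i \<le> 2} \<and>
     (\<forall>t\<in>orthant d. \<forall>k<d. t k \<le> 1/2 * norm_inf d t \<longrightarrow> A t = A (t(k := 0))) \<and>
     (cutoff_a d A \<or> cutoff_b d A \<or> cutoff_c d A)"


subsection \<open>The kernels\<close>

text \<open>For a cutoff function supported in \<open>[0,2]\<^sup>d\<close> only finitely many terms are nonzero.\<close>

definition cutoff_kernel ::
    "nat \<Rightarrow> (nat \<Rightarrow> real) \<Rightarrow> (nat \<Rightarrow> real) \<Rightarrow> ((nat \<Rightarrow> real) \<Rightarrow> complex) \<Rightarrow> nat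
      \<Rightarrow> (nat \<Rightarrow> real) \<Rightarrow> (nat \<Rightarrow> real) \<Rightarrow> complex" where
  "cutoff_kernel d \<alpha> \<beta> A n x y =
     (\<Sum>\<^sub>\<infinity>\<nu>\<in>multi_indices d. A (\<lambda>i. real (\<nu> i) / real n)
        * of_real (jacobi_product d \<alpha> \<beta> \<nu> x) * of_real (jacobi_product d \<alpha> \<beta> \<nu> y))"

end

theory Submission
  imports Defs "HOL-Computational_Algebra.Polynomial" "HOL-Probability.Sinc_Integral"
begin

text \<open>
  In the variable \<open>\<theta> = arccos x\<close> the normalized Jacobi polynomials \<open>e\<^sub>k\<close> are eigenfunctions of a Sturm-Liouville
  operator with weight \<open>w\<close>, and \<open>\<Sum> c\<^sub>k cos(t (k + h)) e\<^sub>k\<close> with \<open>h = (a + b + 1)/2\<close> solves a wave equation of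
  propagation speed 1. Hence the kernel \<open>\<Sum> g(k + h) e\<^sub>k(\<theta>) e\<^sub>k(\<phi>)\<close> vanishes for \<open>\<bar>\<theta> - \<phi>\<bar> > R\<close> if \<open>g\<close> is even
  with Fourier transform supported in \<open>[-R, R]\<close>.

  Let \<open>j\<close> be the coordinate in which \<open>x\<close> and \<open>y\<close> are farthest apart. A cutoff function of second kind does not
  depend on \<open>t\<^sub>j\<close> near \<open>t\<^sub>j = 0\<close>, so its restriction to that coordinate, shifted by \<open>h/n\<close>, has a smooth even
  extension. Subtracting a bandlimited approximation of order \<open>K\<close>, obtained by iterating \<open>f - k * f\<close> with a kernel
  \<open>k\<close> of Jackson type, does not change the kernel at \<open>(x\<^sub>j, y\<^sub>j)\<close> and leaves an error of order
  \<open>(c / (n \<rho>))\<^sup>K K! (\<gamma>' M L(K - 1))\<^sup>K\<close>; take \<open>K\<close> proportional to \<open>n \<rho> / (\<gamma>' M L(n \<rho>))\<close>. Integrability of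
  \<open>1 / ((t + 1) L(t))\<close> forces \<open>\<gamma>' M L(n \<rho>) \<ge> 1\<close> for large \<open>n \<rho>\<close>, which guarantees \<open>K - 1 \<le> n \<rho>\<close>. The remaining
  sums are controlled by the pointwise bound \<open>e\<^sub>k\<^sup>2 \<le> C / W(k; x)\<close>, which follows from an almost conserved energy
  of the differential equation.
\<close>

subsection \<open>The Jacobi differential equation\<close>

text \<open>The rate \<open>c'\<close> has to be absolute, while the decay order \<open>N\<close>
  needed to sum the series depends on the Jacobi parameters. This shapes the convolution kernel: its
  weighted first moment is at most \<open>C1 / B\<close> with \<open>C1\<close> chosen before
  \<open>N\<close>, and the dependence on \<open>N\<close> is confined to a threshold for
  \<open>B\<close>, hence to \<open>c\<close>. Likewise \<open>c\<close> has to serve every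
  \<open>L\<close> with the given \<open>M\<close>, so the size of \<open>n \<rho>\<close> beyond
  which approximation is used may depend on \<open>L\<close> through \<open>M\<close> only.
  Propagation is proved without a Fourier transform. The shift \<open>h\<close> turns the
  eigenvalues into squares, \<open>k (k + 2 h) + h^2 = (k + h)^2\<close>, so a wave is a finite sum
  of cosines in time and its local energy a finite quadratic form. Point evaluation is not
  continuous in the energy norm; one of the two points is therefore replaced by polynomial
  approximate identities, the other by averages over small intervals, and exact vanishing appears in
  the limit.\<close>

definition jacobi_coeff :: "nat \<Rightarrow> real \<Rightarrow> real \<Rightarrow> nat \<Rightarrow> real" where
  "jacobi_coeff n a b k = ((real n + a) gchoose (n - k)) * ((real n + b) gchoose k)"

text \<open>Derivative of the summand with exponents \<open>k\<close> and \<open>j\<close>. The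
  truncated exponents \<open>k - 1\<close> and \<open>j - 1\<close> are harmless: at
  \<open>k = 0\<close> or \<open>j = 0\<close> the factor in front vanishes.\<close>

definition jacobi_term1 :: "nat \<Rightarrow> nat \<Rightarrow> real \<Rightarrow> real" where
  "jacobi_term1 k j x = (real k * ((x - 1) / 2) ^ (k - 1) * ((x + 1) / 2) ^ j
     + real j * ((x - 1) / 2) ^ k * ((x + 1) / 2) ^ (j - 1)) / 2"

definition jacobi_term2 :: "nat \<Rightarrow> nat \<Rightarrow> real \<Rightarrow> real" where
  "jacobi_term2 k j x = (real k * jacobi_term1 (k - 1) j x + real j * jacobi_term1 k (j - 1) x) / 2"

definition jacobi' :: "nat \<Rightarrow> real \<Rightarrow> real \<Rightarrow> real \<Rightarrow> real" where
  "jacobi' n a b x = (\<Sum>k\<le>n. jacobi_coeff n a b k * jacobi_term1 k (n - k) x)"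

definition jacobi'' :: "nat \<Rightarrow> real \<Rightarrow> real \<Rightarrow> real \<Rightarrow> real" where
  "jacobi'' n a b x = (\<Sum>k\<le>n. jacobi_coeff n a b k * jacobi_term2 k (n - k) x)"

lemma has_real_derivative_jacobi_term:
  "((\<lambda>x. ((x - 1) / 2) ^ k * ((x + 1) / 2) ^ j) has_real_derivative jacobi_term1 k j x) (at x)"
proof -
  have 1: "((\<lambda>x. ((x - 1) / 2) ^ k) has_real_derivative real k * ((x - 1) / 2) ^ (k - 1) * (1 / 2)) (at x)"
    by (auto intro!: derivative_eq_intros simp del: power_divide)
  have 2: "((\<lambda>x. ((x + 1) / 2) ^ j) has_real_derivative real j * ((x + 1) / 2) ^ (j - 1) * (1 / 2)) (at x)"
    by (auto intro!: derivative_eq_intros simp del: power_divide)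
  show ?thesis
    unfolding jacobi_term1_def
    by (rule DERIV_cong[OF DERIV_mult[OF 1 2]]) (simp add: field_simps del: power_divide)
qed

lemma has_real_derivative_jacobi_term1:
  "(jacobi_term1 k j has_real_derivative jacobi_term2 k j x) (at x)"
proof -
  have eq: "jacobi_term1 k j = (\<lambda>x. (real k * (((x - 1) / 2) ^ (k - 1) * ((x + 1) / 2) ^ j)
      + real j * (((x - 1) / 2) ^ k * ((x + 1) / 2) ^ (j - 1))) / 2)"
    by (simp add: fun_eq_iff jacobi_term1_def mult.assoc)
  show ?thesis
    unfolding eq jacobi_term2_def
    by (intro DERIV_cdivide DERIV_add DERIV_cmult has_real_derivative_jacobi_term)
qed

lemma jacobi_altdef:
  "jacobi n a b x = (\<Sum>k\<le>n. jacobi_coeff n a b k * (((x - 1) / 2) ^ k * ((x + 1) / 2) ^ (n - k)))"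
  by (simp add: jacobi_def jacobi_coeff_def mult.assoc)

lemma has_real_derivative_jacobi:
  "(jacobi n a b has_real_derivative jacobi' n a b x) (at x)"
proof -
  have "jacobi n a b = (\<lambda>x. \<Sum>k\<le>n. jacobi_coeff n a b k * (((x - 1) / 2) ^ k * ((x + 1) / 2) ^ (n - k)))"
    by (simp add: fun_eq_iff jacobi_altdef)
  then show ?thesis
    unfolding jacobi'_def
    by (auto intro!: DERIV_sum DERIV_cmult has_real_derivative_jacobi_term)
qed

lemma has_real_derivative_jacobi':
  "(jacobi' n a b has_real_derivative jacobi'' n a b x) (at x)"
proof -
  have "jacobi' n a b = (\<lambda>x. \<Sum>k\<le>n. jacobi_coeff n a b k * jacobi_term1 k (n - k) x)"
    by (simp add: fun_eq_iff jacobi'_def)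
  then show ?thesis
    unfolding jacobi''_def
    by (auto intro!: DERIV_sum DERIV_cmult has_real_derivative_jacobi_term1)
qed

text \<open>The Jacobi operator, with the eigenvalue added, maps a single product
  \<open>s^k r^j\<close> to just two products of one degree less. These have the shape of what the
  neighbouring summands leave behind, so the sum over \<open>k\<close> can telescope.\<close>

lemma jacobi_term_ode:
  fixes a b x :: real and k j :: nat
  defines "s \<equiv> (x - 1) / 2" and "r \<equiv> (x + 1) / 2" and "n \<equiv> real k + real j"
  shows "(1 - x\<^sup>2) * jacobi_term2 k j x + (b - a - (a + b + 2) * x) * jacobi_term1 k j x
      + n * (n + a + b + 1) * (s ^ k * r ^ j)
    = (real j + b) * real j * (s ^ k * r ^ (j - 1)) - (real k + a) * real k * (s ^ (k - 1) * r ^ j)"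
proof -
  define S1 S2 R1 R2 where "S1 = real k * s ^ (k - 1)" and "S2 = real k * real (k - 1) * s ^ (k - 1 - 1)"
    and "R1 = real j * r ^ (j - 1)" and "R2 = real j * real (j - 1) * r ^ (j - 1 - 1)"
  have S: "s * S1 = real k * s ^ k" "s * S2 = (real k - 1) * S1"
    unfolding S1_def S2_def by (cases k; cases "k - 1"; simp)+
  have R: "r * R1 = real j * r ^ j" "r * R2 = (real j - 1) * R1"
    unfolding R1_def R2_def by (cases j; cases "j - 1"; simp)+
  have t1: "jacobi_term1 k j x = (S1 * r ^ j + s ^ k * R1) / 2"
    unfolding jacobi_term1_def S1_def R1_def s_def r_def by (simp add: algebra_simps)
  have t2: "jacobi_term2 k j x = (S2 * r ^ j + 2 * S1 * R1 + s ^ k * R2) / 4"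
    unfolding jacobi_term2_def jacobi_term1_def S1_def S2_def R1_def R2_def s_def[symmetric] r_def[symmetric]
    by (simp add: field_simps)
  have x: "x = 2 * s + 1" and r: "r = s + 1" by (auto simp: s_def r_def field_simps)
  \<comment> \<open>Using \<open>r = s + 1\<close> and \<open>x = 2 * s + 1\<close>, everything
    reduces to an identity in \<open>X\<close>, \<open>Y\<close>, \<open>Z\<close> with coefficients
    built from \<open>k\<close>, \<open>j\<close>, \<open>a\<close>, \<open>b\<close>.\<close>
  define X Y Z where "X = S1 * r ^ j" and "Y = s ^ k * R1" and "Z = s ^ k * r ^ j"
  have X: "s * X = real k * Z" "r * X = real k * Z + X"
    using S(1) unfolding X_def Z_def r by (simp_all add: algebra_simps)
  have "r * Y = s ^ k * (r * R1)" by (simp add: Y_def)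
  then have Y: "r * Y = real j * Z" using R(1) by (simp add: Z_def)
  then have Y': "s * Y = real j * Z - Y" by (simp add: r algebra_simps)
  have "r * (s * (S2 * r ^ j + 2 * S1 * R1 + s ^ k * R2))
      = r * r ^ j * (s * S2) + r * R1 * (s * S1) + (s * S1) * (r * R1) + s * s ^ k * (r * R2)"
    by (simp add: algebra_simps)
  also have "\<dots> = (real k - 1) * (r * X) + 2 * real j * real k * Z + (real j - 1) * (s * Y)"
    unfolding S R X_def Y_def Z_def by (simp add: algebra_simps)
  finally have 1: "r * (s * (S2 * r ^ j + 2 * S1 * R1 + s ^ k * R2))
      = (real k - 1) * (real k * Z + X) + 2 * real j * real k * Z + (real j - 1) * (real j * Z - Y)"
    unfolding X Y' by (simp add: algebra_simps)
  have 2: "(b - a - (a + b + 2) * x) * (2 * (X + Y))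
      = 2 * (b - a) * (X + Y) - 2 * (a + b + 2) * (2 * (s * X) + 2 * (s * Y) + X + Y)"
    unfolding x by (simp add: algebra_simps)
  have 3: "1 - x\<^sup>2 = - 4 * r * s" unfolding x r by (simp add: power2_eq_square algebra_simps)
  have "(1 - x\<^sup>2) * (S2 * r ^ j + 2 * S1 * R1 + s ^ k * R2) + (b - a - (a + b + 2) * x) * (2 * (X + Y))
      + 4 * n * (n + a + b + 1) * Z
    = - 4 * (r * (s * (S2 * r ^ j + 2 * S1 * R1 + s ^ k * R2)))
      + (b - a - (a + b + 2) * x) * (2 * (X + Y)) + 4 * n * (n + a + b + 1) * Z"
    unfolding 3 by (simp add: algebra_simps)
  also have "\<dots> = 4 * (real j + b) * Y - 4 * (real k + a) * X"
    unfolding 1 2 X(1) Y' n_def by (simp add: algebra_simps)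
  finally have *: "(1 - x\<^sup>2) * (S2 * r ^ j + 2 * S1 * R1 + s ^ k * R2) + (b - a - (a + b + 2) * x) * (2 * (X + Y))
      + 4 * n * (n + a + b + 1) * Z = 4 * (real j + b) * Y - 4 * (real k + a) * X" .
  have aux: "p * (q / 4) + g * (w / 2) + m * l * z = u - v"
    if "p * q + g * (2 * w) + 4 * m * l * z = 4 * u - 4 * v" for p q g w m l z u v :: real
    using that by (simp add: field_simps)
  have "(1 - x\<^sup>2) * ((S2 * r ^ j + 2 * S1 * R1 + s ^ k * R2) / 4)
      + (b - a - (a + b + 2) * x) * ((X + Y) / 2) + n * (n + a + b + 1) * Z
    = (real j + b) * Y - (real k + a) * X"
    by (rule aux) (use * in \<open>simp only: mult.assoc\<close>)
  then show ?thesis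
    unfolding t1 t2 S1_def R1_def X_def Y_def Z_def by (simp add: mult_ac)
qed

text \<open>Both generalized binomial coefficients shift by one index, and each shift is an
  absorption identity. This is the relation that makes the leftover products of neighbouring
  summands cancel.\<close>

lemma jacobi_coeff_Suc:
  assumes "k < n"
  shows "jacobi_coeff n a b (Suc k) * ((real (Suc k) + a) * real (Suc k))
       = jacobi_coeff n a b k * ((real (n - k) + b) * real (n - k))"
proof -
  obtain j where j: "n = Suc (k + j)" using assms by (metis less_iff_Suc_add)
  have 1: "real (Suc k) * ((real n + b) gchoose Suc k) = (real n + b - real k) * ((real n + b) gchoose k)"
    using gbinomial_mult_1[of "real n + b" k] by (simp add: algebra_simps)
  have 2: "real (Suc j) * ((real n + a) gchoose Suc j) = (real n + a - real j) * ((real n + a) gchoose j)"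
    using gbinomial_mult_1[of "real n + a" j] by (simp add: algebra_simps)
  have nk: "n - k = Suc j" "n - Suc k = j" "real n = real k + real (Suc j)" using j by auto
  have "jacobi_coeff n a b (Suc k) * ((real (Suc k) + a) * real (Suc k))
      = ((real n + a) gchoose j) * (real (Suc k) + a) * (real (Suc k) * ((real n + b) gchoose Suc k))"
    by (simp add: jacobi_coeff_def nk(2))
  also have "\<dots> = (real (Suc k) + a) * ((real n + a) gchoose j) * ((real n + b - real k) * ((real n + b) gchoose k))"
    unfolding 1 by simp
  also have "(real (Suc k) + a) * ((real n + a) gchoose j) = real (Suc j) * ((real n + a) gchoose Suc j)"
    unfolding 2 by (simp add: nk(3))
  also have "real n + b - real k = real (Suc j) + b" by (simp add: nk(3))
  finally show ?thesis
    unfolding jacobi_coeff_def nk(1) by simp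
qed

lemma jacobi_ode:
  "(1 - x\<^sup>2) * jacobi'' n a b x + (b - a - (a + b + 2) * x) * jacobi' n a b x
      + real n * (real n + a + b + 1) * jacobi n a b x = 0"
proof -
  define s r where "s = (x - 1) / 2" and "r = (x + 1) / 2"
  define U where "U k = jacobi_coeff n a b k * ((real k + a) * real k * (s ^ (k - 1) * r ^ (n - k)))" for k
  define V where "V k = jacobi_coeff n a b k * ((real (n - k) + b) * real (n - k) * (s ^ k * r ^ (n - k - 1)))" for k
  have "(1 - x\<^sup>2) * jacobi'' n a b x + (b - a - (a + b + 2) * x) * jacobi' n a b x
      + real n * (real n + a + b + 1) * jacobi n a b x
    = (\<Sum>k\<le>n. jacobi_coeff n a b k * ((1 - x\<^sup>2) * jacobi_term2 k (n - k) x
        + (b - a - (a + b + 2) * x) * jacobi_term1 k (n - k) x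
        + real n * (real n + a + b + 1) * (s ^ k * r ^ (n - k))))"
    unfolding jacobi''_def jacobi'_def jacobi_altdef s_def[symmetric] r_def[symmetric]
    unfolding sum_distrib_left sum.distrib[symmetric]
    by (intro sum.cong refl) (simp only: distrib_left mult.left_commute)
  also have "\<dots> = (\<Sum>k\<le>n. V k - U k)"
  proof (rule sum.cong)
    fix k assume "k \<in> {..n}"
    then obtain j where j: "n = k + j" by (metis atMost_iff le_iff_add)
    show "jacobi_coeff n a b k * ((1 - x\<^sup>2) * jacobi_term2 k (n - k) x
        + (b - a - (a + b + 2) * x) * jacobi_term1 k (n - k) x
        + real n * (real n + a + b + 1) * (s ^ k * r ^ (n - k))) = V k - U k"
      using arg_cong[OF jacobi_term_ode[of x k j b a], of "\<lambda>z. jacobi_coeff n a b k * z"]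
      unfolding U_def V_def s_def r_def j
      by (simp add: right_diff_distrib)
  qed simp
  also have "\<dots> = (\<Sum>k\<le>n. V k) - (\<Sum>k\<le>n. U k)"
    by (rule sum_subtractf)
  also have "(\<Sum>k\<le>n. U k) = (\<Sum>k<n. U (Suc k))"
    by (subst sum.atMost_shift) (simp add: U_def)
  \<comment> \<open>\<open>U\<close> at \<open>k + 1\<close> and \<open>V\<close> at
    \<open>k\<close> carry the same product of powers, and the coefficient recursion identifies
    them. What survives is \<open>V n\<close>, which is 0 because of its factor
    \<open>n - n\<close>.\<close>
  also have "(\<Sum>k<n. U (Suc k)) = (\<Sum>k<n. V k)"
  proof (rule sum.cong)
    fix k assume "k \<in> {..<n}"
    then show "U (Suc k) = V k"
      using arg_cong[OF jacobi_coeff_Suc[of k n a b], of "\<lambda>z. z * (s ^ k * r ^ (n - Suc k))"]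
      unfolding U_def V_def by (simp del: of_nat_Suc add: mult.assoc)
  qed simp
  also have "(\<Sum>k\<le>n. V k) - (\<Sum>k<n. V k) = 0"
    by (simp add: lessThan_Suc_atMost[symmetric] V_def)
  finally show ?thesis .
qed

lemma gbinomial_pos:
  fixes x :: real
  assumes "x > real k - 1"
  shows "x gchoose k > 0"
  unfolding gbinomial_prod_rev using assms
  by (intro divide_pos_pos prod_pos) auto

lemma jacobi_coeff_pos:
  assumes "a > -1" "b > -1" "k \<le> n"
  shows "jacobi_coeff n a b k > 0"
  unfolding jacobi_coeff_def using assms
  by (intro mult_pos_pos gbinomial_pos) auto

text \<open>At \<open>x = 1\<close> only the summand \<open>k = 0\<close> survives. The value serves
  to exclude that a Jacobi polynomial vanishes identically.\<close>

lemma jacobi_at_1_pos: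
  assumes "a > -1" "b > -1"
  shows "jacobi n a b 1 > 0"
proof -
  have "jacobi n a b 1 = jacobi_coeff n a b 0"
    unfolding jacobi_altdef by (subst sum.atMost_shift) simp
  then show ?thesis using jacobi_coeff_pos[OF assms] by simp
qed

section \<open>Expansion of polynomials in Jacobi polynomials\<close>

definition jacobi_poly :: "nat \<Rightarrow> real \<Rightarrow> real \<Rightarrow> real poly" where
  "jacobi_poly n a b = (\<Sum>k\<le>n. smult (jacobi_coeff n a b k) ([:- (1/2), 1/2:] ^ k * [:1/2, 1/2:] ^ (n - k)))"

lemma poly_jacobi_poly: "poly (jacobi_poly n a b) x = jacobi n a b x"
proof -
  have "x * (1/2) - 1/2 = (x - 1) / 2" "1/2 + x * (1/2) = (x + 1) / 2"
    by (simp_all add: field_simps)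
  then show ?thesis
    unfolding jacobi_poly_def jacobi_altdef poly_sum
    by (intro sum.cong) (simp_all add: field_simps)
qed

lemma jacobi_poly_term:
  fixes k j :: nat
  shows "degree ([:- (1/2), 1/2:] ^ k * [:1/2, 1/2:] ^ j :: real poly) = k + j"
    and "coeff ([:- (1/2), 1/2:] ^ k * [:1/2, 1/2:] ^ j :: real poly) (k + j) = (1/2) ^ (k + j)"
proof -
  show "degree ([:- (1/2), 1/2:] ^ k * [:1/2, 1/2:] ^ j :: real poly) = k + j"
    by (subst degree_mult_eq) (auto simp: degree_power_eq)
  then show "coeff ([:- (1/2), 1/2:] ^ k * [:1/2, 1/2:] ^ j :: real poly) (k + j) = (1/2) ^ (k + j)"
    using lead_coeff_mult[of "[:- (1/2), 1/2:] ^ k :: real poly" "[:1/2, 1/2:] ^ j"]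
    by (simp add: lead_coeff_power power_add)
qed

lemma degree_jacobi_poly_le: "degree (jacobi_poly n a b) \<le> n"
  unfolding jacobi_poly_def
  by (rule degree_sum_le) (auto intro: order.trans[OF degree_smult_le] simp: jacobi_poly_term(1))

text \<open>Every summand contributes a positive multiple of \<open>(1/2)^n\<close> to the
  coefficient of degree \<open>n\<close>, so no cancellation can occur.\<close>

lemma coeff_jacobi_poly_pos:
  assumes "a > -1" "b > -1"
  shows "coeff (jacobi_poly n a b) n > 0"
proof -
  have "coeff (jacobi_poly n a b) n = (\<Sum>k\<le>n. jacobi_coeff n a b k * (1/2) ^ n)"
    unfolding jacobi_poly_def coeff_sum coeff_smult
  proof (rule sum.cong)
    fix k assume "k \<in> {..n}"
    then show "jacobi_coeff n a b k * coeff ([:- (1/2), 1/2:] ^ k * [:1 / 2, 1 / 2:] ^ (n - k)) n =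
         jacobi_coeff n a b k * (1 / 2) ^ n"
      using jacobi_poly_term(2)[of k "n - k"] by simp
  qed simp
  also have "\<dots> > 0"
    using jacobi_coeff_pos[OF assms] by (intro sum_pos) auto
  finally show ?thesis .
qed

text \<open>Subtracting the right multiple of the Jacobi polynomial of degree \<open>m\<close>
  removes the coefficient of degree \<open>m\<close>. With the strict bound
  \<open>degree q < m\<close> the number of summands is the induction variable and the base case is
  void.\<close>

lemma poly_eq_sum_jacobi:
  assumes "a > -1" "b > -1" "degree q < m"
  shows "\<exists>c. \<forall>x. poly q x = (\<Sum>k<m. c k * jacobi k a b x)"
  using assms(3)
proof (induction m arbitrary: q)
  case (Suc m)
  let ?J = "jacobi_poly m a b"
  define l where "l = coeff q m / coeff ?J m"
  define q' where "q' = q - smult l ?J"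
  have q: "poly q x = poly q' x + l * jacobi m a b x" for x
    by (simp add: q'_def poly_jacobi_poly)
  have 0: "coeff q' m = 0"
    using coeff_jacobi_poly_pos[OF assms(1,2), of m] by (simp add: q'_def l_def)
  have "degree q' \<le> m"
    unfolding q'_def using Suc.prems degree_jacobi_poly_le[of m a b]
    by (intro degree_diff_le) (auto intro: order.trans[OF degree_smult_le])
  show ?case
  proof (cases "degree q' < m")
    case True
    then obtain c where "\<forall>x. poly q' x = (\<Sum>k<m. c k * jacobi k a b x)"
      using Suc.IH by blast
    then have "\<forall>x. poly q x = (\<Sum>k<Suc m. (c(m := l)) k * jacobi k a b x)"
      by (simp add: q)
    then show ?thesis by blast
  next
    case False
    \<comment> \<open>A polynomial of degree \<open>m\<close> whose coefficient at \<open>m\<close>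
      is 0 is the zero polynomial; this occurs only for \<open>m = 0\<close>.\<close>
    then have "q' = 0" using \<open>degree q' \<le> m\<close> 0
      by (metis le_antisym leading_coeff_0_iff not_le)
    then show ?thesis
      by (intro exI[of _ "\<lambda>k. if k = m then l else 0"]) (simp add: q)
  qed
qed simp

text \<open>In contrast to \<open>powr\<close>, which has \<open>0 powr 0 = 0\<close>, this is continuous at \<open>0\<close> also for the exponent \<open>0\<close>.\<close>

definition cpowr :: "real \<Rightarrow> real \<Rightarrow> real" where
  "cpowr x A = (if A = 0 then 1 else x powr A)"

section \<open>The Sturm-Liouville equation in the angle\<close>

definition jacobi_weight :: "real \<Rightarrow> real \<Rightarrow> real \<Rightarrow> real" where
  "jacobi_weight A B \<theta> = cpowr (1 - cos \<theta>) A * cpowr (1 + cos \<theta>) B"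

text \<open>Half the logarithmic derivative of the weight.\<close>

definition jacobi_drift :: "real \<Rightarrow> real \<Rightarrow> real \<Rightarrow> real" where
  "jacobi_drift A B \<theta> = (A * sin \<theta> / (1 - cos \<theta>) - B * sin \<theta> / (1 + cos \<theta>)) / 2"

text \<open>The equation is required only on the open interval because the drift can be singular at
  the endpoints; there the Neumann conditions \<open>p' 0 = 0\<close> and \<open>p' pi = 0\<close>
  take its place. As a predicate on \<open>p\<close> and \<open>p'\<close> it covers Jacobi
  polynomials, their multiples and their reflections alike.\<close>

definition jacobi_solution ::
    "real \<Rightarrow> real \<Rightarrow> real \<Rightarrow> (real \<Rightarrow> real) \<Rightarrow> (real \<Rightarrow> real) \<Rightarrow> bool" where
  "jacobi_solution A B l p p' \<longleftrightarrow>
     (\<forall>\<theta>. (p has_real_derivative p' \<theta>) (at \<theta>)) \<and> continuous_on UNIV p' \<and> p' 0 = 0 \<and> p' pi = 0 \<and>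
     (\<forall>\<theta>. 0 < \<theta> \<and> \<theta> < pi \<longrightarrow>
        (p' has_real_derivative - 2 * jacobi_drift A B \<theta> * p' \<theta> - l * p \<theta>) (at \<theta>))"

lemma cpowr_pos_eq: "x > 0 \<Longrightarrow> cpowr x A = x powr A"
  by (simp add: cpowr_def)

lemma cpowr_nonneg [simp]: "cpowr x A \<ge> 0"
  by (simp add: cpowr_def)

lemma cpowr_pos: "x > 0 \<Longrightarrow> cpowr x A > 0"
  by (simp add: cpowr_def)

lemma cpowr_mono: "0 \<le> x \<Longrightarrow> x \<le> y \<Longrightarrow> A \<ge> 0 \<Longrightarrow> cpowr x A \<le> cpowr y A"
  by (auto simp: cpowr_def intro: powr_mono2)

lemma continuous_on_cpowr:
  assumes "continuous_on S f" "\<And>x. x \<in> S \<Longrightarrow> f x \<ge> 0" "A \<ge> 0"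
  shows "continuous_on S (\<lambda>x. cpowr (f x) A)"
proof (cases "A = 0")
  case True
  then show ?thesis by (simp add: cpowr_def)
next
  case False
  then show ?thesis
    using assms by (auto simp: cpowr_def intro!: continuous_on_powr')
qed

lemma cos_bounds_interior:
  assumes "0 < \<theta>" "\<theta> < pi"
  shows "1 - cos \<theta> > 0" "1 + cos \<theta> > 0" "sin \<theta> > 0"
proof -
  show "1 - cos \<theta> > 0" using cos_monotone_0_pi[of 0 \<theta>] assms by simp
  show "1 + cos \<theta> > 0" using cos_monotone_0_pi[of \<theta> pi] assms by simp
  show "sin \<theta> > 0" using assms by (simp add: sin_gt_zero)
qed

lemma jacobi_weight_nonneg [simp]: "jacobi_weight A B \<theta> \<ge> 0"
  by (simp add: jacobi_weight_def)

lemma jacobi_weight_pos: "0 < \<theta> \<Longrightarrow> \<theta> < pi \<Longrightarrow> jacobi_weight A B \<theta> > 0"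
  using cos_bounds_interior[of \<theta>] by (simp add: jacobi_weight_def cpowr_pos)

lemma one_plus_cos_nonneg: "0 \<le> 1 + cos (\<theta> :: real)"
  using cos_ge_minus_one[of \<theta>] by linarith

lemma continuous_on_jacobi_weight [continuous_intros]:
  "A \<ge> 0 \<Longrightarrow> B \<ge> 0 \<Longrightarrow> continuous_on S (jacobi_weight A B)"
  unfolding jacobi_weight_def
  by (intro continuous_on_mult continuous_on_cpowr continuous_intros) (auto simp: one_plus_cos_nonneg)

lemma has_real_derivative_jacobi_weight:
  assumes "0 < \<theta>" "\<theta> < pi"
  shows "(jacobi_weight A B has_real_derivative 2 * jacobi_drift A B \<theta> * jacobi_weight A B \<theta>) (at \<theta>)"
proof -
  note pos = cos_bounds_interior[OF assms]
  have 1: "((\<lambda>\<theta>. (1 - cos \<theta>) powr A) has_real_derivative A * (1 - cos \<theta>) powr (A - 1) * sin \<theta>) (at \<theta>)"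
    by (rule DERIV_chain2[where f = "\<lambda>z. z powr A" and g = "\<lambda>\<theta>. 1 - cos \<theta>", OF has_real_derivative_powr[OF pos(1)]]) (auto intro!: derivative_eq_intros)
  have 2: "((\<lambda>\<theta>. (1 + cos \<theta>) powr B) has_real_derivative B * (1 + cos \<theta>) powr (B - 1) * (- sin \<theta>)) (at \<theta>)"
    by (rule DERIV_chain2[where f = "\<lambda>z. z powr B" and g = "\<lambda>\<theta>. 1 + cos \<theta>", OF has_real_derivative_powr[OF pos(2)]]) (auto intro!: derivative_eq_intros)
  have P: "(1 - cos \<theta>) powr (A - 1) = (1 - cos \<theta>) powr A / (1 - cos \<theta>)"
    and Q: "(1 + cos \<theta>) powr (B - 1) = (1 + cos \<theta>) powr B / (1 + cos \<theta>)"
    using pos by (simp_all add: powr_diff)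
  have aux: "A * (p / u) * s * q + B * (q / v) * (- s) * p = 2 * ((A * s / u - B * s / v) / 2) * (p * q)"
    if "u \<noteq> 0" "v \<noteq> 0" for p q s u v :: real
    using that by (simp add: field_simps)
  have D: "((\<lambda>\<theta>. (1 - cos \<theta>) powr A * (1 + cos \<theta>) powr B) has_real_derivative
      2 * jacobi_drift A B \<theta> * jacobi_weight A B \<theta>) (at \<theta>)"
  proof (rule DERIV_cong[OF DERIV_mult[OF 1 2]])
    show "A * (1 - cos \<theta>) powr (A - 1) * sin \<theta> * (1 + cos \<theta>) powr B
        + B * (1 + cos \<theta>) powr (B - 1) * (- sin \<theta>) * (1 - cos \<theta>) powr A
      = 2 * jacobi_drift A B \<theta> * jacobi_weight A B \<theta>"
      unfolding jacobi_drift_def jacobi_weight_def cpowr_pos_eq[OF pos(1)] cpowr_pos_eq[OF pos(2)] P Q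
      by (rule aux) (use pos in auto)
  qed
  show ?thesis
  proof (rule has_field_derivative_transform_within_open[OF D, of "{0<..<pi}"])
    fix x :: real assume "x \<in> {0<..<pi}"
    then show "(1 - cos x) powr A * (1 + cos x) powr B = jacobi_weight A B x"
      using cos_bounds_interior[of x] by (simp add: jacobi_weight_def cpowr_pos_eq)
  qed (use assms in auto)
qed

lemma jacobi_solutionD:
  assumes "jacobi_solution A B l p p'"
  shows "(p has_real_derivative p' \<theta>) (at \<theta>)" "continuous_on S p'" "continuous_on S p"
    "p' 0 = 0" "p' pi = 0"
    "0 < \<theta> \<Longrightarrow> \<theta> < pi \<Longrightarrow> (p' has_real_derivative - 2 * jacobi_drift A B \<theta> * p' \<theta> - l * p \<theta>) (at \<theta>)"
proof -
  show D: "(p has_real_derivative p' \<theta>) (at \<theta>)" for \<theta>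
    using assms unfolding jacobi_solution_def by blast
  show "continuous_on S p"
    by (rule DERIV_continuous_on[OF DERIV_subset[OF D]]) simp
  show "continuous_on S p'"
    using assms unfolding jacobi_solution_def by (blast intro: continuous_on_subset)
qed (use assms in \<open>simp_all add: jacobi_solution_def\<close>)

lemma jacobi_solution_flux:
  assumes "jacobi_solution A B l p p'" "0 < \<theta>" "\<theta> < pi"
  shows "((\<lambda>\<theta>. jacobi_weight A B \<theta> * p' \<theta>) has_real_derivative - l * jacobi_weight A B \<theta> * p \<theta>) (at \<theta>)"
  by (rule DERIV_cong[OF DERIV_mult[OF has_real_derivative_jacobi_weight jacobi_solutionD(6)[OF assms(1)]]])
     (use assms in \<open>auto simp: algebra_simps\<close>)

text \<open>Integration by parts in the self-adjoint form \<open>(w p')' = - l w p\<close>. The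
  boundary term at 0 drops out because \<open>p' 0 = 0\<close>, the one at \<open>z\<close> is kept:
  \<open>z = pi\<close> yields orthogonality, general \<open>z\<close> the boundary flux in the
  energy of the wave equation.\<close>

lemma jacobi_solution_integral_deriv:
  assumes "A \<ge> 0" "B \<ge> 0" "jacobi_solution A B l p p'" "jacobi_solution A B m q q'" "0 \<le> z" "z \<le> pi"
  shows "integral {0..z} (\<lambda>\<theta>. jacobi_weight A B \<theta> * p' \<theta> * q' \<theta>)
      = jacobi_weight A B z * p' z * q z + l * integral {0..z} (\<lambda>\<theta>. jacobi_weight A B \<theta> * p \<theta> * q \<theta>)"
proof -
  let ?w = "jacobi_weight A B"
  note cont = jacobi_solutionD(2,3)[OF assms(3)] jacobi_solutionD(2,3)[OF assms(4)]
    continuous_on_jacobi_weight[OF assms(1,2)]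
  have "((\<lambda>\<theta>. ?w \<theta> * p' \<theta> * q' \<theta> - l * (?w \<theta> * p \<theta> * q \<theta>)) has_integral
      (?w z * p' z * q z - ?w 0 * p' 0 * q 0)) {0..z}"
  proof (rule fundamental_theorem_of_calculus_interior)
    show "continuous_on {0..z} (\<lambda>\<theta>. ?w \<theta> * p' \<theta> * q \<theta>)"
      by (intro continuous_intros cont)
    fix x assume "x \<in> {0<..<z}"
    then have x: "0 < x" "x < pi" using assms by auto
    show "((\<lambda>\<theta>. ?w \<theta> * p' \<theta> * q \<theta>) has_vector_derivative ?w x * p' x * q' x - l * (?w x * p x * q x)) (at x)"
      unfolding has_real_derivative_iff_has_vector_derivative[symmetric]
      by (rule DERIV_cong[OF DERIV_mult[OF jacobi_solution_flux[OF assms(3) x] jacobi_solutionD(1)[OF assms(4)]]])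
         (simp add: algebra_simps)
  qed (use assms in auto)
  then have "integral {0..z} (\<lambda>\<theta>. ?w \<theta> * p' \<theta> * q' \<theta> - l * (?w \<theta> * p \<theta> * q \<theta>)) = ?w z * p' z * q z"
    using jacobi_solutionD(4)[OF assms(3)] by (simp add: integral_unique)
  moreover have "integral {0..z} (\<lambda>\<theta>. ?w \<theta> * p' \<theta> * q' \<theta> - l * (?w \<theta> * p \<theta> * q \<theta>))
      = integral {0..z} (\<lambda>\<theta>. ?w \<theta> * p' \<theta> * q' \<theta>) - integral {0..z} (\<lambda>\<theta>. l * (?w \<theta> * p \<theta> * q \<theta>))"
    by (intro integral_diff integrable_continuous_real continuous_intros cont)
  ultimately show ?thesis by simp
qed

lemma jacobi_solution_orthogonal:
  assumes "A \<ge> 0" "B \<ge> 0" "jacobi_solution A B l p p'" "jacobi_solution A B m q q'" "l \<noteq> m"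
  shows "integral {0..pi} (\<lambda>\<theta>. jacobi_weight A B \<theta> * p \<theta> * q \<theta>) = 0"
proof -
  let ?w = "jacobi_weight A B"
  have "(\<lambda>\<theta>. ?w \<theta> * q \<theta> * p \<theta>) = (\<lambda>\<theta>. ?w \<theta> * p \<theta> * q \<theta>)"
    "(\<lambda>\<theta>. ?w \<theta> * q' \<theta> * p' \<theta>) = (\<lambda>\<theta>. ?w \<theta> * p' \<theta> * q' \<theta>)"
    by (simp_all add: fun_eq_iff mult_ac)
  then have "l * integral {0..pi} (\<lambda>\<theta>. ?w \<theta> * p \<theta> * q \<theta>) = m * integral {0..pi} (\<lambda>\<theta>. ?w \<theta> * p \<theta> * q \<theta>)"
    using jacobi_solution_integral_deriv[OF assms(1-4), of pi] jacobi_solution_integral_deriv[OF assms(1,2,4,3), of pi]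
    by (simp add: jacobi_solutionD(5)[OF assms(3)] jacobi_solutionD(5)[OF assms(4)])
  then show ?thesis using assms(5) by simp
qed

text \<open>The chain rule adds \<open>- cos \<theta>\<close> times the first derivative, which
  raises both exponents by 1/2: \<open>(a + 1/2) (1 + c) - (b + 1/2) (1 - c) = a - b + (a + b + 1)
  c\<close> for \<open>c = cos \<theta>\<close>.\<close>

lemma jacobi_solution_jacobi:
  "jacobi_solution (a + 1/2) (b + 1/2) (real n * (real n + a + b + 1))
     (\<lambda>\<theta>. jacobi n a b (cos \<theta>)) (\<lambda>\<theta>. - sin \<theta> * jacobi' n a b (cos \<theta>))"
  unfolding jacobi_solution_def
proof (intro conjI allI impI)
  fix \<theta> :: real
  show "((\<lambda>\<theta>. jacobi n a b (cos \<theta>)) has_real_derivative - sin \<theta> * jacobi' n a b (cos \<theta>)) (at \<theta>)"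
    by (rule DERIV_cong[OF DERIV_chain2[OF has_real_derivative_jacobi DERIV_cos]]) simp
  show "continuous_on UNIV (\<lambda>\<theta>. - sin \<theta> * jacobi' n a b (cos \<theta>))"
    unfolding jacobi'_def jacobi_term1_def by (intro continuous_intros) auto
  assume "0 < \<theta> \<and> \<theta> < pi"
  then have pos: "1 - cos \<theta> > 0" "1 + cos \<theta> > 0" using cos_bounds_interior[of \<theta>] by auto
  let ?c = "cos \<theta>" and ?s = "sin \<theta>"
  have s2: "?s * ?s = (1 - ?c) * (1 + ?c)" "?s * ?s = 1 - ?c\<^sup>2"
    using sin_squared_eq[of \<theta>] by (auto simp: power2_eq_square algebra_simps)
  have drift: "2 * jacobi_drift (a + 1/2) (b + 1/2) \<theta> * ?s = (a + 1/2) * (1 + ?c) - (b + 1/2) * (1 - ?c)"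
  proof -
    have "?s / (1 - ?c) * ?s = 1 + ?c" "?s / (1 + ?c) * ?s = 1 - ?c"
      using pos s2 by (simp_all add: field_simps)
    moreover have "2 * ((A * ?s / u - B * ?s / v) / 2) * ?s = A * (?s / u * ?s) - B * (?s / v * ?s)"
      for A B u v :: real
      by (simp add: left_diff_distrib right_diff_distrib mult_ac)
    ultimately show ?thesis
      unfolding jacobi_drift_def by (simp only:)
  qed
  have "((\<lambda>\<theta>. - sin \<theta> * jacobi' n a b (cos \<theta>)) has_real_derivative
      - ?c * jacobi' n a b ?c + (jacobi'' n a b ?c * - ?s) * - ?s) (at \<theta>)"
    by (intro DERIV_mult DERIV_minus DERIV_sin DERIV_chain2[OF has_real_derivative_jacobi' DERIV_cos])
  then show "((\<lambda>\<theta>. - sin \<theta> * jacobi' n a b (cos \<theta>)) has_real_derivative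
      - 2 * jacobi_drift (a + 1/2) (b + 1/2) \<theta> * (- ?s * jacobi' n a b ?c)
      - real n * (real n + a + b + 1) * jacobi n a b ?c) (at \<theta>)"
  proof (rule DERIV_cong)
    let ?N = "real n * (real n + a + b + 1)"
    have 1: "- 2 * jacobi_drift (a + 1/2) (b + 1/2) \<theta> * (- ?s * jacobi' n a b ?c)
        = ((a + 1/2) * (1 + ?c) - (b + 1/2) * (1 - ?c)) * jacobi' n a b ?c"
      unfolding drift[symmetric] by simp
    have 2: "(jacobi'' n a b ?c * - ?s) * - ?s = (1 - ?c\<^sup>2) * jacobi'' n a b ?c"
      unfolding s2(2)[symmetric] by simp
    have 3: "- c * J1 + X = ((a + 1/2) * (1 + c) - (b + 1/2) * (1 - c)) * J1 - Y"
      if "X + (b - a - (a + b + 2) * c) * J1 + Y = 0" for c J1 X Y :: real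
      using that by (simp add: field_simps)
    show "- ?c * jacobi' n a b ?c + (jacobi'' n a b ?c * - ?s) * - ?s
      = - 2 * jacobi_drift (a + 1/2) (b + 1/2) \<theta> * (- ?s * jacobi' n a b ?c) - ?N * jacobi n a b ?c"
      unfolding 1 2 by (rule 3[OF jacobi_ode])
  qed
qed auto

text \<open>The Jacobian \<open>sin \<theta>\<close> is
  \<open>(1 - cos \<theta>)^(1/2) (1 + cos \<theta>)^(1/2)\<close>, hence the exponents
  \<open>a + 1/2\<close> and \<open>b + 1/2\<close> on the right. The weight on the left may be
  unbounded at the endpoints, so the substitution is made for nonnegative integrals, where
  integrability need not be known beforehand.\<close>

lemma jacobi_L2_norm_eq:
  assumes "a \<ge> -1/2" "b \<ge> -1/2"
  shows "jacobi_L2_norm n a b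
    = sqrt (integral {0..pi} (\<lambda>\<theta>. jacobi_weight (a + 1/2) (b + 1/2) \<theta> * (jacobi n a b (cos \<theta>))\<^sup>2))"
proof -
  let ?f = "\<lambda>t. (jacobi n a b t)\<^sup>2 * ((1 - t) powr a * (1 + t) powr b)"
  let ?g = "\<lambda>\<theta>. jacobi_weight (a + 1/2) (b + 1/2) \<theta> * (jacobi n a b (cos \<theta>))\<^sup>2"
  have cont: "continuous_on S (jacobi n a b)" for S
    by (rule DERIV_continuous_on[OF DERIV_subset[OF has_real_derivative_jacobi]]) auto
  have cont_g: "continuous_on S ?g" for S
    using assms by (intro continuous_intros continuous_on_compose2[OF cont[of UNIV]]) auto
  have [measurable]: "jacobi n a b \<in> borel_measurable borel"
    by (rule borel_measurable_continuous_onI[OF cont])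
  have meas_f: "?f \<in> borel_measurable borel"
    by measurable
  \<comment> \<open>The substitution rule wants an increasing map; \<open>cos\<close> is increasing
    on \<open>[-pi, 0]\<close>, and a reflection leads to \<open>[0, pi]\<close> afterwards.\<close>
  have subst: "(\<integral>\<^sup>+x. ennreal (?f x * indicator {cos (-pi)..cos 0} x) \<partial>lborel)
      = (\<integral>\<^sup>+x. ennreal (?f (cos x) * (- sin x) * indicator {-pi..0} x) \<partial>lborel)"
  proof (rule nn_integral_substitution[where f = ?f and g = cos and g' = "\<lambda>x. - sin x" and a = "-pi" and b = 0])
    show "set_borel_measurable borel {cos (- pi)..cos 0} ?f"
      unfolding set_borel_measurable_def using meas_f by (intro borel_measurable_scaleR) auto
    show "- sin x \<ge> 0" if "x \<in> {-pi..0}" for x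
      using that sin_ge_zero[of "-x"] by simp
  qed (auto intro!: derivative_eq_intros continuous_intros)
  have eq: "?f (cos x) * (- sin x) = ?g x" if "x \<in> {-pi<..<0}" for x
  proof -
    have pos: "1 - cos x > 0" "1 + cos x > 0" "- sin x > 0"
      using that cos_bounds_interior[of "-x"] by auto
    have "- sin x = sqrt ((1 - cos x) * (1 + cos x))"
    proof (rule real_sqrt_unique[symmetric])
      show "(- sin x)\<^sup>2 = (1 - cos x) * (1 + cos x)"
        using sin_squared_eq[of x] by (simp add: power2_eq_square algebra_simps)
    qed (use pos in auto)
    also have "\<dots> = (1 - cos x) powr (1/2) * (1 + cos x) powr (1/2)"
      using pos by (simp add: real_sqrt_mult powr_half_sqrt)
    finally show ?thesis
      using pos by (simp add: jacobi_weight_def cpowr_pos_eq powr_add)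
  qed
  have "(\<integral>\<^sup>+x. ennreal (?f (cos x) * (- sin x) * indicator {-pi..0} x) \<partial>lborel)
      = (\<integral>\<^sup>+x. ennreal (?g x * indicator {-pi..0} x) \<partial>lborel)"
  proof (rule nn_integral_cong_AE)
    have "AE x in lborel. x \<noteq> -pi" "AE x in lborel. x \<noteq> (0::real)"
      by (auto intro: AE_lborel_singleton)
    then show "AE x in lborel. ennreal (?f (cos x) * (- sin x) * indicator {-pi..0} x)
        = ennreal (?g x * indicator {-pi..0} x)"
    proof eventually_elim
      case (elim x)
      then show ?case using eq[of x] by (cases "x \<in> {-pi..0}") (auto simp: order.strict_iff_order)
    qed
  qed
  also have "\<dots> = ennreal (LINT x:{-pi..0}|lborel. ?g x)"
    unfolding set_lebesgue_integral_def
    using borel_integrable_atLeastAtMost'[OF cont_g, of "-pi" 0]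
    by (subst nn_integral_eq_integral) (auto simp: set_integrable_def mult.commute)
  also have "(LINT x:{-pi..0}|lborel. ?g x) = integral {-pi..0} ?g"
    by (intro set_borel_integral_eq_integral(2) borel_integrable_atLeastAtMost' cont_g)
  also have "\<dots> = integral {0..pi} ?g"
    using Henstock_Kurzweil_Integration.integral_reflect_real[of pi 0 ?g] by (simp add: jacobi_weight_def)
  finally have nn: "(\<integral>\<^sup>+x. ennreal (?f x * indicator {-1..1} x) \<partial>lborel) = ennreal (integral {0..pi} ?g)"
    using subst by simp
  have "(LINT t:{-1..1}|lborel. ?f t) = enn2real (\<integral>\<^sup>+x. ennreal (indicator {-1..1} x *\<^sub>R ?f x) \<partial>lborel)"
    unfolding set_lebesgue_integral_def
    by (intro integral_eq_nn_integral borel_measurable_scaleR) (use meas_f in auto)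
  also have "(\<integral>\<^sup>+x. ennreal (indicator {-1..1} x *\<^sub>R ?f x) \<partial>lborel) = (\<integral>\<^sup>+x. ennreal (?f x * indicator {-1..1} x) \<partial>lborel)"
    by (intro nn_integral_cong) (auto simp: indicator_def)
  also have "enn2real \<dots> = integral {0..pi} ?g"
    unfolding nn by (intro enn2real_ennreal integral_nonneg integrable_continuous_real cont_g) auto
  finally show ?thesis by (simp add: jacobi_L2_norm_def)
qed

lemma integral_weight_square_zero:
  assumes "A \<ge> 0" "B \<ge> 0" "continuous_on {0..pi} p"
    and "integral {0..pi} (\<lambda>\<theta>. jacobi_weight A B \<theta> * (p \<theta>)\<^sup>2) = 0" "0 < \<theta>" "\<theta> < pi"
  shows "p \<theta> = 0"
proof -
  have "continuous_on (cbox 0 pi) (\<lambda>\<theta>. jacobi_weight A B \<theta> * (p \<theta>)\<^sup>2)"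
    using assms by (intro continuous_intros) auto
  then have "jacobi_weight A B \<theta> * (p \<theta>)\<^sup>2 = 0"
    using assms by (intro has_integral_0_cbox_imp_0[of 0 pi "\<lambda>\<theta>. jacobi_weight A B \<theta> * (p \<theta>)\<^sup>2" \<theta>])
      (auto intro!: integrable_integral[THEN has_integral_eq_rhs] integrable_continuous_real)
  then show ?thesis using jacobi_weight_pos[of \<theta> A B] assms by simp
qed

text \<open>A vanishing norm would make the polynomial zero on the open interval and, by continuity,
  at \<open>\<theta> = 0\<close>, against positivity at \<open>x = 1\<close>. Division by the norm
  is thus a genuine normalization.\<close>

lemma jacobi_L2_norm_pos:
  assumes "a \<ge> -1/2" "b \<ge> -1/2"
  shows "jacobi_L2_norm n a b > 0"
proof (rule ccontr)
  let ?p = "\<lambda>\<theta>. jacobi n a b (cos \<theta>)"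
  have cont: "continuous_on S ?p" for S
    by (rule jacobi_solutionD(3)[OF jacobi_solution_jacobi])
  have nn: "integral {0..pi} (\<lambda>\<theta>. jacobi_weight (a + 1/2) (b + 1/2) \<theta> * (?p \<theta>)\<^sup>2) \<ge> 0"
    using assms by (intro integral_nonneg integrable_continuous_real continuous_intros cont) auto
  assume "\<not> ?thesis"
  then have "integral {0..pi} (\<lambda>\<theta>. jacobi_weight (a + 1/2) (b + 1/2) \<theta> * (?p \<theta>)\<^sup>2) = 0"
    using nn unfolding jacobi_L2_norm_eq[OF assms] by simp
  then have "?p \<theta> = 0" if "\<theta> \<in> {0<..<pi}" for \<theta>
    using integral_weight_square_zero[of "a + 1/2" "b + 1/2", OF _ _ cont] that assms by simp
  then have "?p 0 = 0"
    using continuous_constant_on_closure[OF cont, of "{0<..<pi}" 0 0] by simp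
  moreover have "?p 0 > 0" using jacobi_at_1_pos[of a b n] assms by simp
  ultimately show False by simp
qed

section \<open>The orthonormal system in the angle\<close>

locale jacobi_system =
  fixes a b :: real
  assumes a: "a \<ge> -1/2" and b: "b \<ge> -1/2"
begin

text \<open>Half of \<open>a + b + 1\<close> completes the square of the eigenvalue:
  \<open>k (k + 2 h) + h^2 = (k + h)^2\<close>.\<close>

definition h :: real where "h = (a + b + 1) / 2"

definition w :: "real \<Rightarrow> real" where "w = jacobi_weight (a + 1/2) (b + 1/2)"

definition e :: "nat \<Rightarrow> real \<Rightarrow> real" where "e k \<theta> = jacobi_normalized k a b (cos \<theta>)"

definition e' :: "nat \<Rightarrow> real \<Rightarrow> real" where
  "e' k \<theta> = - sin \<theta> * jacobi' k a b (cos \<theta>) / jacobi_L2_norm k a b"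

lemma h_nonneg: "h \<ge> 0"
  using a b by (simp add: h_def)

lemma jacobi_solution_scale:
  assumes "jacobi_solution A B l p p'"
  shows "jacobi_solution A B l (\<lambda>\<theta>. p \<theta> / c) (\<lambda>\<theta>. p' \<theta> / c)"
  using assms unfolding jacobi_solution_def divide_inverse
  by (auto intro!: continuous_intros derivative_eq_intros simp: algebra_simps)

lemma solution_e: "jacobi_solution (a + 1/2) (b + 1/2) (real k * (real k + 2 * h)) (e k) (e' k)"
proof -
  have "2 * h = a + b + 1" by (simp add: h_def)
  then show ?thesis
    using jacobi_solution_scale[OF jacobi_solution_jacobi[of a b k], of "jacobi_L2_norm k a b"]
    by (simp add: e_def[abs_def] e'_def[abs_def] jacobi_normalized_def add.assoc)
qed

lemma continuous_e [continuous_intros]: "continuous_on S (e k)"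
  by (rule jacobi_solutionD(3)[OF solution_e])

lemma continuous_e' [continuous_intros]: "continuous_on S (e' k)"
  by (rule jacobi_solutionD(2)[OF solution_e])

lemma continuous_w [continuous_intros]: "continuous_on S w"
  unfolding w_def using a b by (intro continuous_on_jacobi_weight) auto

lemma w_nonneg [simp]: "w \<theta> \<ge> 0"
  by (simp add: w_def)

lemma w_pos: "0 < \<theta> \<Longrightarrow> \<theta> < pi \<Longrightarrow> w \<theta> > 0"
  by (simp add: w_def jacobi_weight_pos)

lemma orthonormal: "integral {0..pi} (\<lambda>\<theta>. w \<theta> * e k \<theta> * e l \<theta>) = (if k = l then 1 else 0)"
proof (cases "k = l")
  case True
  let ?N = "jacobi_L2_norm k a b"
  let ?I = "integral {0..pi} (\<lambda>\<theta>. w \<theta> * (jacobi k a b (cos \<theta>))\<^sup>2)"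
  have N: "?N > 0" "?N = sqrt ?I"
    using jacobi_L2_norm_pos[OF a b] jacobi_L2_norm_eq[OF a b] by (auto simp: w_def)
  then have "?I = ?N\<^sup>2" by (metis less_eq_real_def real_sqrt_ge_0_iff real_sqrt_pow2)
  have "integral {0..pi} (\<lambda>\<theta>. w \<theta> * e k \<theta> * e k \<theta>) = integral {0..pi} (\<lambda>\<theta>. (w \<theta> * (jacobi k a b (cos \<theta>))\<^sup>2) / ?N\<^sup>2)"
    by (intro arg_cong[of _ _ "integral {0..pi}"])
       (simp add: fun_eq_iff e_def jacobi_normalized_def power2_eq_square)
  also have "\<dots> = 1"
    using \<open>?I = ?N\<^sup>2\<close> N(1) by (subst integral_divide) simp
  finally show ?thesis using True by simp
next
  case False
  have "real k * (real k + 2 * h) \<noteq> real l * (real l + 2 * h)"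
  proof (cases "k < l")
    case True
    then show ?thesis using h_nonneg
      by (intro less_imp_neq mult_strict_mono) (auto simp: add_strict_right_mono)
  next
    case False
    then have "l < k" using \<open>k \<noteq> l\<close> by simp
    then show ?thesis using h_nonneg
      by (intro less_imp_neq[THEN not_sym] mult_strict_mono) (auto simp: add_strict_right_mono)
  qed
  then show ?thesis
    using jacobi_solution_orthogonal[OF _ _ solution_e[of k] solution_e[of l]] a b False
    by (simp add: w_def)
qed

lemma poly_cos_expansion:
  assumes "degree q < m"
  shows "\<exists>c. \<forall>\<theta>. poly q (cos \<theta>) = (\<Sum>k<m. c k * e k \<theta>)"
proof -
  obtain c where c: "\<And>x. poly q x = (\<Sum>k<m. c k * jacobi k a b x)"
    using poly_eq_sum_jacobi[of a b q m] a b assms by auto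
  have "poly q (cos \<theta>) = (\<Sum>k<m. (c k * jacobi_L2_norm k a b) * e k \<theta>)" for \<theta>
    unfolding c e_def jacobi_normalized_def
    using jacobi_L2_norm_pos[OF a b] by (intro sum.cong) (auto simp: less_imp_neq[THEN not_sym])
  then show ?thesis by (intro exI[of _ "\<lambda>k. c k * jacobi_L2_norm k a b"]) auto
qed

end

subsection \<open>Pointwise bounds\<close>

lemma sin_ge_half:
  fixes t :: real
  assumes "0 \<le> t" "t \<le> 1"
  shows "t / 2 \<le> sin t"
proof -
  have "sin 0 - 0 / 2 \<le> sin t - t / 2"
  proof (rule DERIV_nonneg_imp_nondecreasing[OF assms(1)])
    fix x :: real assume x: "0 \<le> x" "x \<le> t"
    have "cos (pi / 3) \<le> cos x"
      using x assms pi_gt3 by (intro cos_monotone_0_pi_le) auto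
    then have "cos x - 1/2 \<ge> 0" by (simp add: cos_60)
    moreover have "((\<lambda>x. sin x - x / 2) has_real_derivative cos x - 1/2) (at x)"
      by (auto intro!: derivative_eq_intros)
    ultimately show "\<exists>y. ((\<lambda>x. sin x - x / 2) has_real_derivative y) (at x) \<and> 0 \<le> y" by blast
  qed
  then show ?thesis by simp
qed

lemma one_minus_cos_ge:
  fixes t :: real
  assumes "0 \<le> t" "t \<le> 1"
  shows "t\<^sup>2 / 8 \<le> 1 - cos t"
proof -
  have "(t / 4)\<^sup>2 \<le> (sin (t / 2))\<^sup>2"
    using sin_ge_half[of "t / 2"] assms by (intro power_mono) auto
  moreover have "1 - cos t = 2 * (sin (t / 2))\<^sup>2"
    using cos_double_sin[of "t / 2"] by simp
  ultimately show ?thesis by (simp add: power_divide)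
qed

section \<open>Energy of the Liouville normal form\<close>

locale jacobi_energy =
  fixes A B l \<mu> :: real and p p' :: "real \<Rightarrow> real"
  assumes A: "A \<ge> 0" and B: "B \<ge> 0" and sol: "jacobi_solution A B l p p'"
    and \<mu>: "\<mu> > 0" "\<mu>\<^sup>2 = l + ((A + B) / 2)\<^sup>2"
begin

abbreviation "w \<equiv> jacobi_weight A B"
abbreviation "\<eta> \<equiv> jacobi_drift A B"

definition \<eta>' :: "real \<Rightarrow> real" where
  "\<eta>' \<theta> = - (A / (1 - cos \<theta>) + B / (1 + cos \<theta>)) / 2"

text \<open>Potential of the Liouville normal form: \<open>u = sqrt w * p\<close> satisfies
  \<open>u'' = (Q - \<mu>^2) u\<close>. The constant \<open>((A + B) / 2)^2\<close> comes from
  writing \<open>\<mu>^2\<close> instead of \<open>l\<close>.\<close>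

definition Q :: "real \<Rightarrow> real" where
  "Q \<theta> = ((A + B) / 2)\<^sup>2 + (\<eta> \<theta>)\<^sup>2 + \<eta>' \<theta>"

definition y :: "real \<Rightarrow> real" where "y \<theta> = p' \<theta> + \<eta> \<theta> * p \<theta>"

text \<open>With \<open>u = sqrt w * p\<close> one has \<open>u' = sqrt w * y\<close>, so this is
  \<open>u'^2 + \<mu>^2 u^2\<close>, the energy of a harmonic oscillator; it would be constant if
  \<open>Q\<close> were 0.\<close>

definition E :: "real \<Rightarrow> real" where "E \<theta> = w \<theta> * ((y \<theta>)\<^sup>2 + \<mu>\<^sup>2 * (p \<theta>)\<^sup>2)"

definition CQ :: real where "CQ = 2 * (A + B)\<^sup>2 + (A + B)"

lemma CQ_nonneg: "CQ \<ge> 0"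
  using A B by (simp add: CQ_def)

lemma has_real_derivative_drift:
  assumes "0 < \<theta>" "\<theta> < pi"
  shows "(\<eta> has_real_derivative \<eta>' \<theta>) (at \<theta>)"
proof -
  note pos = cos_bounds_interior[OF assms]
  let ?c = "cos \<theta>" and ?s = "sin \<theta>"
  have s2: "?s * ?s = (1 - ?c) * (1 + ?c)"
    using sin_squared_eq[of \<theta>] by (auto simp: power2_eq_square algebra_simps)
  have 1: "((\<lambda>\<theta>. sin \<theta> / (1 - cos \<theta>)) has_real_derivative - 1 / (1 - ?c)) (at \<theta>)"
  proof (rule DERIV_cong)
    show "((\<lambda>\<theta>. sin \<theta> / (1 - cos \<theta>)) has_real_derivative
        (?c * (1 - ?c) - ?s * ?s) / ((1 - ?c) * (1 - ?c))) (at \<theta>)"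
      using pos by (auto intro!: derivative_eq_intros)
    have "?c * (1 - ?c) - ?s * ?s = - 1 * (1 - ?c)" unfolding s2 by (simp add: algebra_simps)
    moreover have "- 1 * u / (u * u) = - 1 / u" for u :: real by simp
    ultimately show "(?c * (1 - ?c) - ?s * ?s) / ((1 - ?c) * (1 - ?c)) = - 1 / (1 - ?c)"
      by (simp only:)
  qed
  have 2: "((\<lambda>\<theta>. sin \<theta> / (1 + cos \<theta>)) has_real_derivative 1 / (1 + ?c)) (at \<theta>)"
  proof (rule DERIV_cong)
    show "((\<lambda>\<theta>. sin \<theta> / (1 + cos \<theta>)) has_real_derivative
        (?c * (1 + ?c) - ?s * (- ?s)) / ((1 + ?c) * (1 + ?c))) (at \<theta>)"
      using pos by (auto intro!: derivative_eq_intros)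
    have "?c * (1 + ?c) - ?s * (- ?s) = 1 * (1 + ?c)" using s2 by (simp add: algebra_simps)
    moreover have "1 * u / (u * u) = 1 / u" for u :: real by simp
    ultimately show "(?c * (1 + ?c) - ?s * (- ?s)) / ((1 + ?c) * (1 + ?c)) = 1 / (1 + ?c)"
      by (simp only:)
  qed
  have "((\<lambda>\<theta>. (A * (sin \<theta> / (1 - cos \<theta>)) - B * (sin \<theta> / (1 + cos \<theta>))) / 2) has_real_derivative
      (A * (- 1 / (1 - ?c)) - B * (1 / (1 + ?c))) / 2) (at \<theta>)"
    by (intro DERIV_cdivide DERIV_diff DERIV_cmult 1 2)
  moreover have "\<eta> = (\<lambda>\<theta>. (A * (sin \<theta> / (1 - cos \<theta>)) - B * (sin \<theta> / (1 + cos \<theta>))) / 2)"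
    by (simp add: fun_eq_iff jacobi_drift_def)
  moreover have "(A * (- 1 / (1 - ?c)) - B * (1 / (1 + ?c))) / 2 = \<eta>' \<theta>"
    by (simp add: \<eta>'_def)
  ultimately show ?thesis by simp
qed

text \<open>Each endpoint contributes a singularity of order \<open>1 / sin^2\<close>, since
  \<open>sin \<theta> / (1 - cos \<theta>) = (1 + cos \<theta>) / sin \<theta> \<le> 2 / sin
  \<theta>\<close> and correspondingly with \<open>1 + cos \<theta>\<close>.\<close>

lemma Q_bound:
  assumes "0 < \<theta>" "\<theta> < pi"
  shows "\<bar>Q \<theta>\<bar> \<le> CQ / (sin \<theta>)\<^sup>2"
proof -
  note pos = cos_bounds_interior[OF assms]
  let ?c = "cos \<theta>" and ?s = "sin \<theta>"
  have s2: "?s * ?s = (1 - ?c) * (1 + ?c)"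
    using sin_squared_eq[of \<theta>] by (auto simp: power2_eq_square algebra_simps)
  have "?s / (1 - ?c) = (1 + ?c) / ?s" "?s / (1 + ?c) = (1 - ?c) / ?s"
    using pos s2 by (simp_all add: field_simps)
  moreover have "(1 + ?c) / ?s \<le> 2 / ?s" "(1 - ?c) / ?s \<le> 2 / ?s"
    using pos by (intro divide_right_mono; simp add: algebra_simps)+
  ultimately have r: "0 \<le> ?s / (1 - ?c)" "?s / (1 - ?c) \<le> 2 / ?s" "0 \<le> ?s / (1 + ?c)" "?s / (1 + ?c) \<le> 2 / ?s"
    using pos by auto
  have "\<bar>\<eta> \<theta>\<bar> \<le> (A * (?s / (1 - ?c)) + B * (?s / (1 + ?c))) / 2"
    unfolding jacobi_drift_def using r A B
    by (auto simp: abs_le_iff mult_nonneg_nonneg simp flip: times_divide_eq_right)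
  also have "\<dots> \<le> (A * (2 / ?s) + B * (2 / ?s)) / 2"
    using r A B by (intro divide_right_mono add_mono mult_left_mono) auto
  also have "\<dots> = (A + B) / ?s" by (simp add: add_divide_distrib)
  finally have "\<bar>\<eta> \<theta>\<bar>\<^sup>2 \<le> ((A + B) / ?s)\<^sup>2" by (intro power_mono) auto
  then have 1: "(\<eta> \<theta>)\<^sup>2 \<le> (A + B)\<^sup>2 / ?s\<^sup>2" by (simp add: power_divide)
  have "1 / (1 - ?c) = (1 + ?c) / ?s\<^sup>2" "1 / (1 + ?c) = (1 - ?c) / ?s\<^sup>2"
    using pos s2 by (simp_all add: power2_eq_square)
  moreover have "(1 + ?c) / ?s\<^sup>2 \<le> 2 / ?s\<^sup>2" "(1 - ?c) / ?s\<^sup>2 \<le> 2 / ?s\<^sup>2"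
    using pos by (intro divide_right_mono; simp add: algebra_simps)+
  ultimately have q: "1 / (1 - ?c) \<le> 2 / ?s\<^sup>2" "1 / (1 + ?c) \<le> 2 / ?s\<^sup>2" by auto
  have "\<bar>\<eta>' \<theta>\<bar> = (A * (1 / (1 - ?c)) + B * (1 / (1 + ?c))) / 2"
  proof -
    have "0 \<le> (A * (1 / (1 - ?c)) + B * (1 / (1 + ?c))) / 2" using pos A B by auto
    moreover have "\<eta>' \<theta> = - ((A * (1 / (1 - ?c)) + B * (1 / (1 + ?c))) / 2)"
      by (simp only: \<eta>'_def mult_1_right times_divide_eq_right minus_divide_left)
    ultimately show ?thesis by (simp only: abs_minus_cancel abs_of_nonneg)
  qed
  also have "\<dots> \<le> (A * (2 / ?s\<^sup>2) + B * (2 / ?s\<^sup>2)) / 2"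
    using q A B by (intro divide_right_mono add_mono mult_left_mono) auto
  also have "\<dots> = (A + B) / ?s\<^sup>2" by (simp add: add_divide_distrib)
  finally have 2: "\<bar>\<eta>' \<theta>\<bar> \<le> (A + B) / ?s\<^sup>2" .
  have "?s\<^sup>2 \<le> 1" using sin_squared_eq[of \<theta>] by simp
  then have "((A + B) / 2)\<^sup>2 * 1 \<le> (A + B)\<^sup>2 * (1 / ?s\<^sup>2)"
    using pos by (intro mult_mono) (auto simp: power_divide)
  then have 3: "((A + B) / 2)\<^sup>2 \<le> (A + B)\<^sup>2 / ?s\<^sup>2" by simp
  have "\<bar>Q \<theta>\<bar> \<le> ((A + B) / 2)\<^sup>2 + (\<eta> \<theta>)\<^sup>2 + \<bar>\<eta>' \<theta>\<bar>"
    unfolding Q_def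
    by (rule abs_leI; use zero_le_power2[of "\<eta> \<theta>"] zero_le_power2[of "(A + B) / 2"]
        abs_ge_self[of "\<eta>' \<theta>"] abs_ge_minus_self[of "\<eta>' \<theta>"] in linarith)
  also have "\<dots> \<le> (A + B)\<^sup>2 / ?s\<^sup>2 + (A + B)\<^sup>2 / ?s\<^sup>2 + (A + B) / ?s\<^sup>2"
    by (intro add_mono 1 2 3)
  also have "\<dots> = CQ / ?s\<^sup>2" by (simp add: CQ_def add_divide_distrib)
  finally show ?thesis .
qed

lemma has_real_derivative_y:
  assumes "0 < \<theta>" "\<theta> < pi"
  shows "(y has_real_derivative (Q \<theta> - \<mu>\<^sup>2) * p \<theta> - \<eta> \<theta> * y \<theta>) (at \<theta>)"
proof -
  have "(y has_real_derivative (- 2 * \<eta> \<theta> * p' \<theta> - l * p \<theta>) + (\<eta>' \<theta> * p \<theta> + p' \<theta> * \<eta> \<theta>)) (at \<theta>)"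
    unfolding y_def[abs_def]
    by (intro DERIV_add DERIV_mult has_real_derivative_drift jacobi_solutionD[OF sol] assms)
  moreover have Q: "Q \<theta> - \<mu>\<^sup>2 = (\<eta> \<theta>)\<^sup>2 + \<eta>' \<theta> - l" by (simp add: Q_def \<mu>(2))
  ultimately show ?thesis
    by (elim DERIV_cong) (unfold Q y_def, simp add: algebra_simps power2_eq_square)
qed

lemma p'_eq: "p' \<theta> = y \<theta> - \<eta> \<theta> * p \<theta>"
  by (simp add: y_def)

lemma has_real_derivative_E:
  assumes "0 < \<theta>" "\<theta> < pi"
  shows "(E has_real_derivative 2 * w \<theta> * Q \<theta> * p \<theta> * y \<theta>) (at \<theta>)"
proof -
  let ?y' = "(Q \<theta> - \<mu>\<^sup>2) * p \<theta> - \<eta> \<theta> * y \<theta>"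
  have "((\<lambda>\<theta>. w \<theta> * (y \<theta> * y \<theta> + \<mu>\<^sup>2 * (p \<theta> * p \<theta>))) has_real_derivative
      2 * \<eta> \<theta> * w \<theta> * (y \<theta> * y \<theta> + \<mu>\<^sup>2 * (p \<theta> * p \<theta>))
      + ((?y' * y \<theta> + ?y' * y \<theta>) + \<mu>\<^sup>2 * (p' \<theta> * p \<theta> + p' \<theta> * p \<theta>)) * w \<theta>) (at \<theta>)"
    by (intro DERIV_mult DERIV_add DERIV_cmult has_real_derivative_jacobi_weight has_real_derivative_y
        jacobi_solutionD(1)[OF sol] assms)
  then have "((\<lambda>\<theta>. w \<theta> * (y \<theta> * y \<theta> + \<mu>\<^sup>2 * (p \<theta> * p \<theta>))) has_real_derivative 2 * w \<theta> * Q \<theta> * p \<theta> * y \<theta>) (at \<theta>)"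
    by (rule DERIV_cong) (simp add: p'_eq algebra_simps)
  then show ?thesis by (simp add: E_def[abs_def] power2_eq_square)
qed

lemma E_nonneg: "E \<theta> \<ge> 0"
  by (simp add: E_def)

lemma two_prod_le_E: "2 * (w \<theta> * (\<bar>p \<theta>\<bar> * \<bar>y \<theta>\<bar>)) \<le> E \<theta> / \<mu>"
proof -
  have "0 \<le> (\<bar>y \<theta>\<bar> - \<mu> * \<bar>p \<theta>\<bar>)\<^sup>2" by simp
  then have "2 * (\<mu> * (\<bar>p \<theta>\<bar> * \<bar>y \<theta>\<bar>)) \<le> (y \<theta>)\<^sup>2 + \<mu>\<^sup>2 * (p \<theta>)\<^sup>2"
    unfolding power2_diff power_mult_distrib power2_abs by (simp add: mult_ac)
  then have "w \<theta> * (2 * (\<mu> * (\<bar>p \<theta>\<bar> * \<bar>y \<theta>\<bar>))) \<le> E \<theta>"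
    unfolding E_def by (rule mult_left_mono) simp
  then show ?thesis using \<mu>(1) by (simp add: pos_le_divide_eq mult_ac)
qed

lemma E_deriv_bound:
  assumes "0 < \<theta>" "\<theta> < pi"
  shows "\<bar>2 * w \<theta> * Q \<theta> * p \<theta> * y \<theta>\<bar> \<le> CQ / \<mu> * inverse ((sin \<theta>)\<^sup>2) * E \<theta>"
proof -
  have "\<bar>2 * w \<theta> * Q \<theta> * p \<theta> * y \<theta>\<bar> = \<bar>Q \<theta>\<bar> * (2 * (w \<theta> * (\<bar>p \<theta>\<bar> * \<bar>y \<theta>\<bar>)))"
    by (simp add: abs_mult mult_ac)
  also have "\<dots> \<le> (CQ / (sin \<theta>)\<^sup>2) * (E \<theta> / \<mu>)"
    using CQ_nonneg by (intro mult_mono Q_bound two_prod_le_E assms) (auto intro!: mult_nonneg_nonneg)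
  finally show ?thesis by (simp add: divide_inverse mult_ac)
qed

text \<open>A Gronwall argument. The derivative of \<open>E\<close> is at most
  \<open>CQ / \<mu>\<close> times \<open>E / sin^2\<close>, and \<open>- 1 / sin^2\<close> is the
  derivative of \<open>cot\<close>, so \<open>E\<close> times the exponential of
  \<open>\<plusminus> CQ / \<mu> * cot\<close> is monotone. At distance of order
  \<open>1 / \<mu>\<close> from an endpoint \<open>cot\<close> has size \<open>\<mu>\<close>, so the
  loss stays bounded up to there.\<close>

lemma E_compare:
  assumes "0 < s" "s < pi" "0 < t" "t < pi"
  shows "E s \<le> E t * exp (CQ / \<mu> * (\<bar>cot s\<bar> + \<bar>cot t\<bar>))"
proof -
  define \<kappa> where "\<kappa> = CQ / \<mu>"
  have \<kappa>: "\<kappa> \<ge> 0" using CQ_nonneg \<mu> by (simp add: \<kappa>_def)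
  have der: "((\<lambda>x. E x * exp (q * cot x)) has_real_derivative
      (2 * w x * Q x * p x * y x - q * inverse ((sin x)\<^sup>2) * E x) * exp (q * cot x)) (at x)"
    if "0 < x" "x < pi" for x q
  proof (rule DERIV_cong)
    have "sin x \<noteq> 0" using cos_bounds_interior[OF that] by simp
    then have "((\<lambda>x. exp (q * cot x)) has_real_derivative exp (q * cot x) * (q * - inverse ((sin x)\<^sup>2))) (at x)"
      by (intro DERIV_fun_exp DERIV_cmult DERIV_cot)
    then show "((\<lambda>x. E x * exp (q * cot x)) has_real_derivative
       (2 * w x * Q x * p x * y x) * exp (q * cot x) + (exp (q * cot x) * (q * - inverse ((sin x)\<^sup>2))) * E x) (at x)"
      by (intro DERIV_mult has_real_derivative_E that)
  qed (simp add: algebra_simps)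
  have mult: "E s \<le> E t * exp (q * cot t - q * cot s)"
    if "E s * exp (q * cot s) \<le> E t * exp (q * cot t)" for q
  proof -
    have "E s = E s * exp (q * cot s) * exp (- (q * cot s))"
      by (simp add: mult.assoc flip: exp_add)
    also have "\<dots> \<le> E t * exp (q * cot t) * exp (- (q * cot s))"
      using that by (intro mult_right_mono) auto
    also have "\<dots> = E t * exp (q * cot t - q * cot s)"
      by (simp add: mult.assoc flip: exp_add)
    finally show ?thesis .
  qed
  have abs: "q * cot t - q * cot s \<le> \<kappa> * (\<bar>cot s\<bar> + \<bar>cot t\<bar>)" if "\<bar>q\<bar> = \<kappa>" for q
  proof -
    have "q * cot t - q * cot s \<le> \<bar>q\<bar> * \<bar>cot t\<bar> + \<bar>q\<bar> * \<bar>cot s\<bar>"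
      using abs_ge_self[of "q * cot t"] abs_ge_minus_self[of "q * cot s"] by (simp add: abs_mult)
    then show ?thesis by (simp add: that algebra_simps)
  qed
  have "\<exists>q. \<bar>q\<bar> = \<kappa> \<and> E s * exp (q * cot s) \<le> E t * exp (q * cot t)"
  proof (cases "s \<le> t")
    case True
    have "E s * exp (- \<kappa> * cot s) \<le> E t * exp (- \<kappa> * cot t)"
    proof (rule DERIV_nonneg_imp_nondecreasing[OF True])
      fix x assume "s \<le> x" "x \<le> t"
      then have x: "0 < x" "x < pi" using assms by auto
      have "2 * w x * Q x * p x * y x - (- \<kappa>) * inverse ((sin x)\<^sup>2) * E x \<ge> 0"
        using E_deriv_bound[OF x] unfolding \<kappa>_def[symmetric] by (simp add: abs_le_iff)
      then show "\<exists>z. ((\<lambda>x. E x * exp (- \<kappa> * cot x)) has_real_derivative z) (at x) \<and> 0 \<le> z"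
        using der[OF x, of "- \<kappa>"] by (intro exI conjI) (assumption, simp)
    qed
    then show ?thesis using \<kappa> by (intro exI[of _ "- \<kappa>"]) auto
  next
    case False
    then have ts: "t \<le> s" by simp
    have "E t * exp (\<kappa> * cot t) \<ge> E s * exp (\<kappa> * cot s)"
    proof (rule DERIV_nonpos_imp_nonincreasing[OF ts])
      fix x assume "t \<le> x" "x \<le> s"
      then have x: "0 < x" "x < pi" using assms by auto
      have "2 * w x * Q x * p x * y x - \<kappa> * inverse ((sin x)\<^sup>2) * E x \<le> 0"
        using E_deriv_bound[OF x] unfolding \<kappa>_def[symmetric] by (simp add: abs_le_iff)
      then have "(2 * w x * Q x * p x * y x - \<kappa> * inverse ((sin x)\<^sup>2) * E x) * exp (\<kappa> * cot x) \<le> 0"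
        by (rule mult_nonpos_nonneg) simp
      then show "\<exists>z. ((\<lambda>x. E x * exp (\<kappa> * cot x)) has_real_derivative z) (at x) \<and> z \<le> 0"
        using der[OF x, of \<kappa>] by blast
    qed
    then show ?thesis using \<kappa> by (intro exI[of _ \<kappa>]) auto
  qed
  then obtain q where q: "\<bar>q\<bar> = \<kappa>" "E s * exp (q * cot s) \<le> E t * exp (q * cot t)" by blast
  have "E s \<le> E t * exp (q * cot t - q * cot s)" by (rule mult[OF q(2)])
  also have "\<dots> \<le> E t * exp (\<kappa> * (\<bar>cot s\<bar> + \<bar>cot t\<bar>))"
    using abs[OF q(1)] E_nonneg by (intro mult_left_mono) auto
  finally show ?thesis by (simp add: \<kappa>_def)
qed

text \<open>The normalization controls \<open>p\<close> in mean square, but not \<open>y\<close>.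
  The product \<open>w p y\<close> has derivative \<open>w (y^2 - \<mu>^2 p^2 + Q p^2)\<close>;
  integrating it over the middle half of the interval trades \<open>y^2\<close> for
  \<open>\<mu>^2 p^2\<close>. Since \<open>E\<close> is nearly constant there, its mean bounds
  \<open>E (pi / 2)\<close>.\<close>

lemma E_midpoint:
  assumes norm: "integral {0..pi} (\<lambda>\<theta>. w \<theta> * (p \<theta>)\<^sup>2) = 1"
    and large: "\<mu> \<ge> 4" "\<mu> \<ge> 4 * CQ"
  shows "E (pi / 2) \<le> 16 * \<mu>\<^sup>2"
proof -
  define \<kappa> where "\<kappa> = CQ / \<mu>"
  have \<kappa>: "0 \<le> \<kappa>" "\<kappa> \<le> 1/4" using CQ_nonneg \<mu> large by (auto simp: \<kappa>_def field_simps)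
  have J: "0 < x" "x < pi" if "x \<in> {pi/4..3*pi/4}" for x :: real
  proof -
    have "pi/4 \<le> x" "x \<le> 3*pi/4" using that by auto
    then show "0 < x" "x < pi" using pi_gt_zero by linarith+
  qed
  have sinJ: "1/2 \<le> (sin x)\<^sup>2" and cotJ: "\<bar>cot x\<bar> \<le> 1" if "x \<in> {pi/4..3*pi/4}" for x :: real
  proof -
    have c: "cos (2 * x) \<le> 0"
    proof -
      have "cos (2 * x) = - cos (2 * x - pi)" by simp
      moreover have "cos (2 * x - pi) \<ge> 0" using that by (intro cos_ge_zero) auto
      ultimately show ?thesis by linarith
    qed
    then show s: "1/2 \<le> (sin x)\<^sup>2" using cos_double_sin[of x] by simp
    have "(cos x)\<^sup>2 \<le> 1/2" using c cos_double_cos[of x] by simp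
    then have "\<bar>cos x\<bar> \<le> \<bar>sin x\<bar>" using s by (simp add: abs_le_square_iff)
    moreover have "sin x \<noteq> 0" using s by auto
    ultimately show "\<bar>cot x\<bar> \<le> 1" by (simp add: cot_def abs_divide)
  qed
  have cot0: "cot (pi / 2) = 0" by (simp add: cot_def)
  have pi2: "0 < pi / 2" "pi / 2 < pi" by auto
  have lower: "E (pi/2) * exp (- \<kappa>) \<le> E x" if "x \<in> {pi/4..3*pi/4}" for x
  proof -
    have "E (pi/2) \<le> E x * exp (\<kappa> * (\<bar>cot (pi/2)\<bar> + \<bar>cot x\<bar>))"
      using E_compare[OF pi2 J[OF that]] by (simp add: \<kappa>_def)
    also have "\<dots> \<le> E x * exp (\<kappa> * 1)"
      unfolding cot0 using cotJ[OF that] \<kappa> E_nonneg by (intro mult_left_mono) (auto intro: mult_left_le)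
    finally show ?thesis by (simp add: exp_minus field_simps)
  qed
  have upper: "E x \<le> E (pi/2) * exp \<kappa>" if "x \<in> {pi/4..3*pi/4}" for x
  proof -
    have "E x \<le> E (pi/2) * exp (\<kappa> * (\<bar>cot x\<bar> + \<bar>cot (pi/2)\<bar>))"
      using E_compare[OF J[OF that] pi2] by (simp add: \<kappa>_def)
    also have "\<dots> \<le> E (pi/2) * exp (\<kappa> * 1)"
      unfolding cot0 using cotJ[OF that] \<kappa> E_nonneg by (intro mult_left_mono) (auto intro: mult_left_le)
    finally show ?thesis by simp
  qed
  let ?H = "\<lambda>\<theta>. w \<theta> * (p \<theta> * y \<theta>)"
  define f where "f \<theta> = w \<theta> * ((y \<theta>)\<^sup>2 - \<mu>\<^sup>2 * (p \<theta>)\<^sup>2 + Q \<theta> * (p \<theta>)\<^sup>2)" for \<theta>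
  have H: "(?H has_real_derivative f \<theta>) (at \<theta>)" if "0 < \<theta>" "\<theta> < pi" for \<theta>
  proof -
    have "(?H has_real_derivative 2 * \<eta> \<theta> * w \<theta> * (p \<theta> * y \<theta>)
        + (p' \<theta> * y \<theta> + ((Q \<theta> - \<mu>\<^sup>2) * p \<theta> - \<eta> \<theta> * y \<theta>) * p \<theta>) * w \<theta>) (at \<theta>)"
      by (intro DERIV_mult has_real_derivative_jacobi_weight has_real_derivative_y jacobi_solutionD(1)[OF sol] that)
    then show ?thesis
      by (rule DERIV_cong) (simp add: f_def p'_eq algebra_simps power2_eq_square)
  qed
  have f_int: "(f has_integral (?H (3*pi/4) - ?H (pi/4))) {pi/4..3*pi/4}"
    using J by (intro fundamental_theorem_of_calculus)
      (auto simp flip: has_real_derivative_iff_has_vector_derivative intro!: DERIV_subset[OF H])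
  have cont: "continuous_on S (\<lambda>\<theta>. w \<theta> * (p \<theta>)\<^sup>2)" for S
    using A B by (intro continuous_intros jacobi_solutionD[OF sol]) auto
  define I where "I = integral {pi/4..3*pi/4} (\<lambda>\<theta>. w \<theta> * (p \<theta>)\<^sup>2)"
  have I_int: "((\<lambda>\<theta>. w \<theta> * (p \<theta>)\<^sup>2) has_integral I) {pi/4..3*pi/4}"
    unfolding I_def by (intro integrable_integral integrable_continuous_real cont)
  have I_le: "I \<le> 1"
    unfolding I_def norm[symmetric]
    by (intro integral_subset_le integrable_continuous_real cont) auto
  have H_bound: "\<bar>?H x\<bar> \<le> E (pi/2) * exp \<kappa> / (2 * \<mu>)" if "x \<in> {pi/4..3*pi/4}" for x
  proof -
    have "\<bar>?H x\<bar> = w x * (\<bar>p x\<bar> * \<bar>y x\<bar>)" by (simp add: abs_mult)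
    also have "\<dots> \<le> E x / (2 * \<mu>)" using two_prod_le_E[of x] by simp
    also have "\<dots> \<le> E (pi/2) * exp \<kappa> / (2 * \<mu>)"
      using upper[OF that] \<mu> by (intro divide_right_mono) auto
    finally show ?thesis .
  qed
  have F1: "((\<lambda>\<theta>. f \<theta> + (2 * \<mu>\<^sup>2 + 2 * CQ) * (w \<theta> * (p \<theta>)\<^sup>2)) has_integral
      ((?H (3*pi/4) - ?H (pi/4)) + (2 * \<mu>\<^sup>2 + 2 * CQ) * I)) {pi/4..3*pi/4}"
    by (intro has_integral_add has_integral_mult_right f_int I_int)
  have F2: "((\<lambda>\<theta>. E (pi/2) * exp (- \<kappa>)) has_integral (3*pi/4 - pi/4) *\<^sub>R (E (pi/2) * exp (- \<kappa>))) {pi/4..3*pi/4}"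
    using has_integral_const_real[of "E (pi/2) * exp (- \<kappa>)" "pi/4" "3*pi/4"] by simp
  \<comment> \<open>On the middle half \<open>sin^2 \<ge> 1/2\<close>, hence
    \<open>\<bar>Q\<bar> \<le> 2 * CQ\<close>; the added multiple of \<open>w p^2\<close> therefore
    lifts \<open>f\<close> to at least \<open>E\<close>.\<close>
  have F3: "E (pi/2) * exp (- \<kappa>) \<le> f x + (2 * \<mu>\<^sup>2 + 2 * CQ) * (w x * (p x)\<^sup>2)"
    if x: "x \<in> {pi/4..3*pi/4}" for x
  proof -
    have "\<bar>Q x\<bar> \<le> CQ * (1 / (sin x)\<^sup>2)" using Q_bound[OF J[OF x]] by simp
    also have "\<dots> \<le> CQ * 2"
    proof (rule mult_left_mono[OF _ CQ_nonneg])
      have "0 < (sin x)\<^sup>2" using sinJ[OF x] by linarith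
      then show "1 / (sin x)\<^sup>2 \<le> 2" using sinJ[OF x] by (simp add: pos_divide_le_eq)
    qed
    finally have "0 \<le> (2 * CQ + Q x) * (w x * (p x)\<^sup>2)" by (intro mult_nonneg_nonneg) auto
    moreover have "f x + (2 * \<mu>\<^sup>2 + 2 * CQ) * (w x * (p x)\<^sup>2) = E x + (2 * CQ + Q x) * (w x * (p x)\<^sup>2)"
      by (simp add: f_def E_def algebra_simps)
    ultimately show ?thesis using lower[OF x] by linarith
  qed
  have "(3*pi/4 - pi/4) *\<^sub>R (E (pi/2) * exp (- \<kappa>)) \<le> (?H (3*pi/4) - ?H (pi/4)) + (2 * \<mu>\<^sup>2 + 2 * CQ) * I"
    by (rule has_integral_le[OF F2 F1 F3])
  also have "\<dots> \<le> E (pi/2) * exp \<kappa> / \<mu> + (2 * \<mu>\<^sup>2 + 2 * CQ)"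
  proof (rule add_mono)
    show "?H (3*pi/4) - ?H (pi/4) \<le> E (pi/2) * exp \<kappa> / \<mu>"
      using H_bound[of "3*pi/4"] H_bound[of "pi/4"] by (auto simp: abs_le_iff)
    have "0 \<le> 2 * \<mu>\<^sup>2 + 2 * CQ" using CQ_nonneg by simp
    then show "(2 * \<mu>\<^sup>2 + 2 * CQ) * I \<le> 2 * \<mu>\<^sup>2 + 2 * CQ"
      using mult_left_mono[OF I_le, of "2 * \<mu>\<^sup>2 + 2 * CQ"] by simp
  qed
  finally have *: "(3*pi/4 - pi/4) * (E (pi/2) * exp (- \<kappa>)) \<le> E (pi/2) * exp \<kappa> / \<mu> + (2 * \<mu>\<^sup>2 + 2 * CQ)"
    by simp
  \<comment> \<open>Largeness of \<open>\<mu>\<close> gave \<open>\<kappa> \<le> 1/4\<close>. The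
    factors 3/4 and 4/3 obtained here leave \<open>3/4 - 1/3 > 0\<close> in front of
    \<open>E (pi / 2)\<close> once the boundary term has been absorbed.\<close>
  have ek: "exp (- \<kappa>) \<ge> 3/4" using exp_ge_add_one_self[of "- \<kappa>"] \<kappa> by linarith
  have ek': "exp \<kappa> \<le> 4/3"
  proof -
    have "exp \<kappa> * (3/4) \<le> exp \<kappa> * exp (- \<kappa>)" using ek by (intro mult_left_mono) auto
    then show ?thesis by (simp flip: exp_add)
  qed
  have "E (pi/2) * (3/4) \<le> E (pi/2) * exp (- \<kappa>)" using ek E_nonneg by (intro mult_left_mono) auto
  also have "\<dots> \<le> (3*pi/4 - pi/4) * (E (pi/2) * exp (- \<kappa>))"
  proof -
    have "1 \<le> 3*pi/4 - pi/4" using pi_gt3 by simp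
    from mult_right_mono[OF this, of "E (pi/2) * exp (- \<kappa>)"] show ?thesis using E_nonneg by simp
  qed
  also note *
  also have "E (pi/2) * exp \<kappa> / \<mu> \<le> E (pi/2) * (4/3) / 4"
    using ek' E_nonneg large \<mu> by (intro frac_le mult_left_mono mult_nonneg_nonneg) auto
  finally have "E (pi/2) * (3/4) \<le> E (pi/2) * (1/3) + (2 * \<mu>\<^sup>2 + 2 * CQ)" by simp
  moreover have "CQ \<le> \<mu>\<^sup>2"
  proof -
    have "\<mu> * 1 \<le> \<mu> * \<mu>" using large by (intro mult_left_mono) auto
    then show ?thesis using large CQ_nonneg unfolding power2_eq_square by linarith
  qed
  ultimately show ?thesis using zero_le_power2[of \<mu>] by linarith
qed

text \<open>In the limit \<open>\<theta> \<rightarrow> 0\<close> the flux identity bounds the derivative, so that \<open>p\<close> varies little at scale \<open>1/\<mu>\<close>.\<close>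

lemma endpoint_bound:
  assumes t: "0 < t" "t \<le> 1" and l: "0 \<le> l" "l * 2 powr B * t\<^sup>2 \<le> 1/2" and \<theta>: "0 \<le> \<theta>" "\<theta> \<le> t"
  shows "\<bar>p \<theta>\<bar> \<le> 2 * \<bar>p t\<bar>"
proof -
  have cont: "continuous_on S (\<lambda>x. \<bar>p x\<bar>)" for S
    by (intro continuous_intros jacobi_solutionD[OF sol])
  obtain m where m: "m \<in> {0..t}" "\<And>x. x \<in> {0..t} \<Longrightarrow> \<bar>p x\<bar> \<le> \<bar>p m\<bar>"
    using continuous_attains_sup[of "{0..t}" "\<lambda>x. \<bar>p x\<bar>"] cont t by auto
  define S where "S = \<bar>p m\<bar>"
  have tpi: "t < pi / 2" using t pi_gt3 by linarith
  have p'_bound: "\<bar>p' x\<bar> \<le> l * 2 powr B * t * S" if x: "0 < x" "x < t" for x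
  proof -
    have xpi: "0 < x" "x < pi" using x tpi by auto
    let ?f = "\<lambda>x. w x * p x"
    have "((\<lambda>z. - l * w z * p z) has_integral (w x * p' x - w 0 * p' 0)) {0..x}"
    proof (rule fundamental_theorem_of_calculus_interior)
      show "continuous_on {0..x} (\<lambda>z. w z * p' z)"
        using A B by (intro continuous_intros jacobi_solutionD[OF sol]) auto
      show "((\<lambda>z. w z * p' z) has_vector_derivative - l * w z * p z) (at z)" if "z \<in> {0<..<x}" for z
        using jacobi_solution_flux[OF sol, of z] that xpi
        by (simp add: has_real_derivative_iff_has_vector_derivative)
    qed (use x in auto)
    then have I: "((\<lambda>z. - l * w z * p z) has_integral w x * p' x) {0..x}"
      using jacobi_solutionD(4)[OF sol] by simp
    have "norm (w x * p' x) \<le> (l * (2 powr B * w x) * S) * measure lborel (cbox 0 x)"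
    proof (rule has_integral_bound)
      show "0 \<le> l * (2 powr B * w x) * S" using l by (simp add: S_def)
      show "((\<lambda>z. - l * w z * p z) has_integral w x * p' x) (cbox 0 x)" using I by simp
      fix z assume "z \<in> cbox 0 x"
      then have z: "0 \<le> z" "z \<le> x" by auto
      \<comment> \<open>Up to the factor \<open>2 powr B\<close> the weight increases on
        \<open>[0, x]\<close>: the part with \<open>1 - cos\<close> does, and \<open>1 + cos\<close>
        varies by a factor of at most 2 because \<open>x < pi / 2\<close>.\<close>
      have "cos x \<le> cos z" using z xpi by (intro cos_monotone_0_pi_le) auto
      moreover have "0 \<le> cos x" using xpi tpi x by (intro cos_ge_zero) auto
      moreover have "1 + cos z \<le> 2 * (1 + cos x)"
      proof -
        have "1 + cos z \<le> 2" by simp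
        also have "\<dots> \<le> 2 * (1 + cos x)" using \<open>0 \<le> cos x\<close> by simp
        finally show ?thesis .
      qed
      ultimately have "cpowr (1 - cos z) A \<le> cpowr (1 - cos x) A"
        "cpowr (1 + cos z) B \<le> cpowr (2 * (1 + cos x)) B"
        using A B by (auto intro!: cpowr_mono simp: one_plus_cos_nonneg)
      moreover have "cpowr (2 * (1 + cos x)) B = 2 powr B * cpowr (1 + cos x) B"
      proof -
        have "0 < 1 + cos x" "0 < 2 * (1 + cos x)" using cos_bounds_interior(2)[OF xpi] by auto
        then show ?thesis unfolding cpowr_pos_eq[OF \<open>0 < 1 + cos x\<close>] cpowr_pos_eq[OF \<open>0 < 2 * (1 + cos x)\<close>]
          by (subst powr_mult) (use \<open>0 < 1 + cos x\<close> in auto)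
      qed
      ultimately have "w z \<le> cpowr (1 - cos x) A * (2 powr B * cpowr (1 + cos x) B)"
        unfolding jacobi_weight_def by (intro mult_mono) auto
      then have "w z \<le> 2 powr B * w x" by (simp add: jacobi_weight_def mult_ac)
      moreover have "\<bar>p z\<bar> \<le> S" using m(2)[of z] z x by (simp add: S_def)
      ultimately have "l * w z * \<bar>p z\<bar> \<le> l * (2 powr B * w x) * S"
        using l by (intro mult_mono) auto
      then show "norm (- l * w z * p z) \<le> l * (2 powr B * w x) * S"
        using l by (simp add: abs_mult)
    qed
    then have "w x * \<bar>p' x\<bar> \<le> w x * (l * 2 powr B * x * S)"
      using x by (simp add: abs_mult mult_ac)
    then have "\<bar>p' x\<bar> \<le> l * 2 powr B * x * S"
      using jacobi_weight_pos[OF xpi, of A B] by (simp add: mult_le_cancel_left_pos)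
    also have "\<dots> \<le> l * 2 powr B * t * S"
      using x l by (intro mult_right_mono mult_left_mono) (auto simp: S_def)
    finally show ?thesis .
  qed
  \<comment> \<open>\<open>m\<close> is a maximum point of \<open>\<bar>p\<bar>\<close> on
    \<open>[0, t]\<close>. If \<open>p\<close> changes by at most half of its maximum between
    \<open>m\<close> and \<open>t\<close>, this maximum is at most
    \<open>2 * \<bar>p t\<bar>\<close>.\<close>
  have "\<bar>p t - p m\<bar> \<le> S / 2"
  proof (cases "m = t")
    case False
    then have "m < t" using m by simp
    then obtain z where z: "m < z" "z < t" "p t - p m = (t - m) * p' z"
      using MVT2[of m t p p'] jacobi_solutionD(1)[OF sol] by blast
    have "\<bar>p t - p m\<bar> = (t - m) * \<bar>p' z\<bar>" using z \<open>m < t\<close> by (simp add: abs_mult)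
    also have "\<dots> \<le> t * (l * 2 powr B * t * S)"
      using p'_bound[of z] z m t by (intro mult_mono) auto
    also have "\<dots> = (l * 2 powr B * t\<^sup>2) * S" by (simp add: power2_eq_square mult_ac)
    also have "\<dots> \<le> 1/2 * S" using l by (intro mult_right_mono) (auto simp: S_def)
    finally show ?thesis by simp
  qed (simp add: S_def)
  then have "S \<le> 2 * \<bar>p t\<bar>" unfolding S_def by linarith
  then show ?thesis using m(2)[of \<theta>] \<theta> by (simp add: S_def)
qed

end

section \<open>Bounds uniform in the degree\<close>

definition shifted_weight :: "real \<Rightarrow> real \<Rightarrow> real \<Rightarrow> real \<Rightarrow> real" where
  "shifted_weight A B r x = (1 - x + r) powr A * (1 + x + r) powr B"

lemma powr_le_mult:
  fixes c u v A :: real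
  assumes "0 < u" "u \<le> c * v" "A \<ge> 0" "c > 0" "v > 0"
  shows "u powr A \<le> c powr A * v powr A"
proof -
  have "u powr A \<le> (c * v) powr A" using assms by (intro powr_mono2) auto
  then show ?thesis using assms by (simp add: powr_mult)
qed

text \<open>At distance at least \<open>t = \<delta> / k\<close> from 0 the energy comparison with
  the midpoint loses only a constant factor; closer to 0 the value is controlled by the one at
  \<open>t\<close>. Constant and threshold precede \<open>k\<close> and \<open>p\<close>, so that
  they serve all normalized solutions of large degree at once.\<close>

lemma jacobi_solution_half_bound:
  assumes A: "A \<ge> 0" and B: "B \<ge> 0"
  shows "\<exists>C\<ge>0. \<exists>k0. \<forall>k\<ge>k0. \<forall>p p'. jacobi_solution A B (real k * (real k + (A + B))) p p' \<and>
     integral {0..pi} (\<lambda>\<theta>. jacobi_weight A B \<theta> * (p \<theta>)\<^sup>2) = 1 \<longrightarrow>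
     (\<forall>\<theta>\<in>{0..pi/2}. (p \<theta>)\<^sup>2 * shifted_weight A B (1 / (real k)\<^sup>2) (cos \<theta>) \<le> C)"
proof -
  define cq where "cq = 2 * (A + B)\<^sup>2 + (A + B)"
  have cq: "cq \<ge> 0" using A B by (simp add: cq_def)
  \<comment> \<open>\<open>q\<close> and \<open>\<delta>\<close> satisfy
    \<open>q * \<delta>^2 = 1/2\<close>, which yields \<open>l * 2 powr B * t^2 \<le> 1/2\<close> at
    \<open>t = \<delta> / k\<close>.\<close>
  define q where "q = (1 + (A + B)) * 2 powr B"
  have q: "q \<ge> 1"
  proof -
    have "1 * 1 \<le> (1 + (A + B)) * 2 powr B" using A B by (intro mult_mono ge_one_powr_ge_zero) auto
    then show ?thesis by (simp add: q_def)
  qed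
  define \<delta> where "\<delta> = 1 / sqrt (2 * q)"
  have \<delta>2: "\<delta>\<^sup>2 = 1 / (2 * q)" using q by (simp add: \<delta>_def power_divide)
  have \<delta>: "0 < \<delta>" "\<delta> \<le> 1" using q by (auto simp: \<delta>_def)
  \<comment> \<open>For \<open>t \<le> x \<le> pi / 2\<close> one has
    \<open>1 / k^2 = t^2 / \<delta>^2\<close> and \<open>t^2 \<le> 8 * (1 - cos x)\<close>, so the
    shift enlarges \<open>1 - cos x\<close> by at most the factor \<open>D\<close>.\<close>
  define D where "D = 1 + 8 / \<delta>\<^sup>2"
  have D: "D \<ge> 1" by (simp add: D_def)
  define C1 where "C1 = 16 * exp (cq * 2 / \<delta>)"
  define C where "C = 4 * C1 * (D powr A * (3 * D) powr B)"
  have C1: "C1 \<ge> 0" by (simp add: C1_def)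
  have C: "C \<ge> 0" using C1 by (simp add: C_def)
  \<comment> \<open>Ensures \<open>\<mu> \<ge> 4\<close> and \<open>\<mu> \<ge> 4 * CQ\<close>, as
    the midpoint estimate requires.\<close>
  define k0 where "k0 = nat \<lceil>4 * cq + 4\<rceil>"
  show ?thesis
  proof (intro exI[of _ C] exI[of _ k0] conjI allI impI ballI C)
    fix k p p' \<theta>
    assume k: "k \<ge> k0" and "jacobi_solution A B (real k * (real k + (A + B))) p p' \<and>
       integral {0..pi} (\<lambda>\<theta>. jacobi_weight A B \<theta> * (p \<theta>)\<^sup>2) = 1" and \<theta>: "\<theta> \<in> {0..pi/2}"
    then have sol: "jacobi_solution A B (real k * (real k + (A + B))) p p'"
      and norm: "integral {0..pi} (\<lambda>\<theta>. jacobi_weight A B \<theta> * (p \<theta>)\<^sup>2) = 1" by auto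
    define \<mu> where "\<mu> = real k + (A + B) / 2"
    let ?l = "real k * (real k + (A + B))"
    let ?w = "jacobi_weight A B"
    have kr: "real k \<ge> 4 * cq + 4" using k by (simp add: k0_def) linarith
    have k1: "real k \<ge> 1" using kr cq by linarith
    have \<mu>k: "\<mu> \<ge> real k" using A B by (simp add: \<mu>_def)
    interpret jacobi_energy A B ?l \<mu> p p'
    proof
      show "\<mu>\<^sup>2 = ?l + ((A + B) / 2)\<^sup>2"
        by (simp add: \<mu>_def power2_eq_square field_simps)
      show "\<mu> > 0" using \<mu>k k1 by linarith
    qed (fact A B sol)+
    have CQ_eq: "CQ = cq" by (simp add: CQ_def cq_def)
    have mid: "E (pi/2) \<le> 16 * \<mu>\<^sup>2"
      using kr \<mu>k cq by (intro E_midpoint norm) (auto simp: CQ_eq)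
    define t where "t = \<delta> / real k"
    have t: "0 < t" "t \<le> 1" "t \<le> \<delta>"
      using \<delta> k1 by (auto simp: t_def divide_le_eq intro: order.trans[of \<delta> 1] mult_left_le)
    have tpi: "t < pi/2" using t pi_gt3 by linarith
    have pw: "?w x * (p x)\<^sup>2 \<le> C1" if x: "t \<le> x" "x \<le> pi/2" for x
    proof -
      have x0: "0 < x" "x < pi" using x t pi_gt_zero by linarith+
      have "sin t \<le> sin x" using x t tpi by (intro sin_monotone_2pi_le) auto
      then have s: "t / 2 \<le> sin x" using sin_ge_half[of t] t by simp
      have "\<bar>cot x\<bar> = \<bar>cos x\<bar> / sin x" using s t by (simp add: cot_def)
      also have "\<dots> \<le> 1 / (t / 2)" using s t by (intro frac_le) auto
      finally have cot: "\<bar>cot x\<bar> \<le> 2 / t" by simp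
      have "cq / \<mu> * (\<bar>cot x\<bar> + \<bar>cot (pi/2)\<bar>) \<le> cq / real k * (2 / t)"
        using cot cq \<mu>k k1 by (intro mult_mono divide_left_mono) (auto simp: cot_def)
      also have "\<dots> = cq * 2 / \<delta>" using k1 \<delta> by (simp add: t_def)
      finally have ex: "cq / \<mu> * (\<bar>cot x\<bar> + \<bar>cot (pi/2)\<bar>) \<le> cq * 2 / \<delta>" .
      have "\<mu>\<^sup>2 * (?w x * (p x)\<^sup>2) \<le> E x"
        by (simp add: E_def algebra_simps)
      also have "\<dots> \<le> E (pi/2) * exp (cq / \<mu> * (\<bar>cot x\<bar> + \<bar>cot (pi/2)\<bar>))"
        using E_compare[OF x0, of "pi/2"] by (simp add: CQ_eq)
      also have "\<dots> \<le> (16 * \<mu>\<^sup>2) * exp (cq * 2 / \<delta>)"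
        using mid ex by (intro mult_mono) auto
      finally have "\<mu>\<^sup>2 * (?w x * (p x)\<^sup>2) \<le> \<mu>\<^sup>2 * C1" by (simp add: C1_def mult_ac)
      then show ?thesis using \<mu>k k1 by (simp add: mult_le_cancel_left)
    qed
    have kt: "1 / (real k)\<^sup>2 = t\<^sup>2 / \<delta>\<^sup>2" using \<delta> k1 by (simp add: t_def power_divide)
    have shift: "1 - cos x + 1 / (real k)\<^sup>2 \<le> D * (1 - cos x)" if x: "t \<le> x" "x \<le> pi/2" for x
    proof -
      have "cos x \<le> cos t" using x t pi_gt_zero by (intro cos_monotone_0_pi_le) linarith+
      then have "t\<^sup>2 \<le> 8 * (1 - cos x)" using one_minus_cos_ge[of t] t by simp
      then have "t\<^sup>2 / \<delta>\<^sup>2 \<le> 8 * (1 - cos x) / \<delta>\<^sup>2" by (intro divide_right_mono) auto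
      then show ?thesis unfolding kt D_def by (simp add: algebra_simps)
    qed
    have sw: "shifted_weight A B (1 / (real k)\<^sup>2) (cos z) \<le> D powr A * (3 * D) powr B * ?w x"
      if x: "t \<le> x" "x \<le> pi/2" and z: "1 - cos z \<le> 1 - cos x" for x z
    proof -
      have x0: "0 < x" "x < pi" using x t pi_gt_zero by linarith+
      note pos = cos_bounds_interior[OF x0]
      have cx: "0 \<le> cos x" using x x0 by (intro cos_ge_zero) auto
      have r: "0 < 1 / (real k)\<^sup>2" "1 / (real k)\<^sup>2 \<le> 1" using k1 by auto
      have 1: "(1 - cos z + 1 / (real k)\<^sup>2) powr A \<le> D powr A * (1 - cos x) powr A"
      proof (rule powr_le_mult)
        show "0 < 1 - cos z + 1 / (real k)\<^sup>2" using r cos_le_one[of z] by linarith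
        show "1 - cos z + 1 / (real k)\<^sup>2 \<le> D * (1 - cos x)" using shift[OF x] z by linarith
      qed (use A D pos in auto)
      have 2: "(1 + cos z + 1 / (real k)\<^sup>2) powr B \<le> (3 * D) powr B * (1 + cos x) powr B"
      proof (rule powr_le_mult)
        show "0 < 1 + cos z + 1 / (real k)\<^sup>2" using r one_plus_cos_nonneg[of z] by linarith
        have "1 + cos z + 1 / (real k)\<^sup>2 \<le> 3" using r cos_le_one[of z] by linarith
        also have "3 * (1 * 1) \<le> 3 * (D * (1 + cos x))"
          using D cx by (intro mult_left_mono mult_mono) auto
        finally show "1 + cos z + 1 / (real k)\<^sup>2 \<le> 3 * D * (1 + cos x)" by simp
      qed (use B D pos in auto)
      have "shifted_weight A B (1 / (real k)\<^sup>2) (cos z)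
          \<le> (D powr A * (1 - cos x) powr A) * ((3 * D) powr B * (1 + cos x) powr B)"
        unfolding shifted_weight_def by (intro mult_mono 1 2) auto
      then show ?thesis
        using pos by (simp add: jacobi_weight_def cpowr_pos_eq mult_ac)
    qed
    have sw0: "shifted_weight A B (1 / (real k)\<^sup>2) (cos \<theta>) \<ge> 0" by (simp add: shifted_weight_def)
    \<comment> \<open>The comparison point is \<open>\<theta>\<close> itself or, too close to the
      endpoint, \<open>t\<close>. In both cases \<open>1 - cos \<theta> \<le> 1 - cos x\<close>, the
      direction in which the shifted weight was estimated.\<close>
    have "\<exists>x. t \<le> x \<and> x \<le> pi/2 \<and> cos x \<le> cos \<theta> \<and> \<bar>p \<theta>\<bar> \<le> 2 * \<bar>p x\<bar>"
    proof (cases "t \<le> \<theta>")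
      case True
      then show ?thesis using \<theta> by (intro exI[of _ \<theta>]) auto
    next
      case False
      have l: "?l \<ge> 0" using A B by simp
      have "?l * 2 powr B * t\<^sup>2 \<le> 1/2"
      proof -
        have "real k * (A + B) \<le> real k * (real k * (A + B))"
          using A B k1 by (intro mult_left_mono) (auto intro: mult_right_mono[of 1 "real k", simplified])
        then have "?l \<le> (real k)\<^sup>2 * (1 + (A + B))" by (simp add: power2_eq_square algebra_simps)
        then have "?l * (2 powr B * t\<^sup>2) \<le> (real k)\<^sup>2 * (1 + (A + B)) * (2 powr B * t\<^sup>2)"
          by (intro mult_right_mono) auto
        also have "\<dots> = q * ((real k)\<^sup>2 * t\<^sup>2)" by (simp add: q_def mult_ac)
        also have "(real k)\<^sup>2 * t\<^sup>2 = \<delta>\<^sup>2" using k1 by (simp add: t_def power_divide)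
        also have "q * \<delta>\<^sup>2 = 1/2" using q by (simp add: \<delta>2)
        finally show ?thesis by (simp add: mult.assoc)
      qed
      then have "\<bar>p \<theta>\<bar> \<le> 2 * \<bar>p t\<bar>"
        using \<theta> False t l by (intro endpoint_bound) auto
      moreover have "cos t \<le> cos \<theta>"
        using \<theta> False t tpi by (intro cos_monotone_0_pi_le) auto
      ultimately show ?thesis using tpi by (intro exI[of _ t]) auto
    qed
    then obtain x where x: "t \<le> x" "x \<le> pi/2" "cos x \<le> cos \<theta>" "\<bar>p \<theta>\<bar> \<le> 2 * \<bar>p x\<bar>" by blast
    have "(p \<theta>)\<^sup>2 \<le> (2 * \<bar>p x\<bar>)\<^sup>2" using power_mono[OF x(4), of 2] by simp
    then have p2: "(p \<theta>)\<^sup>2 \<le> 4 * (p x)\<^sup>2" by (simp add: power_mult_distrib)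
    have "(p \<theta>)\<^sup>2 * shifted_weight A B (1 / (real k)\<^sup>2) (cos \<theta>)
        \<le> (4 * (p x)\<^sup>2) * (D powr A * (3 * D) powr B * ?w x)"
      using x by (intro mult_mono p2 sw sw0) auto
    also have "\<dots> = 4 * (?w x * (p x)\<^sup>2) * (D powr A * (3 * D) powr B)" by (simp add: mult_ac)
    also have "\<dots> \<le> 4 * C1 * (D powr A * (3 * D) powr B)"
      using pw[OF x(1,2)] by (intro mult_right_mono mult_left_mono) auto
    finally show "(p \<theta>)\<^sup>2 * shifted_weight A B (1 / (real k)\<^sup>2) (cos \<theta>) \<le> C" by (simp add: C_def)
  qed
qed

text \<open>Reflection changes the sign of the drift and exchanges \<open>A\<close> and
  \<open>B\<close>. This reduces the half interval near \<open>pi\<close> to the one near 0.\<close>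

lemma jacobi_solution_reflect:
  assumes "jacobi_solution A B l p p'"
  shows "jacobi_solution B A l (\<lambda>\<theta>. p (pi - \<theta>)) (\<lambda>\<theta>. - p' (pi - \<theta>))"
  unfolding jacobi_solution_def
proof (intro conjI allI impI)
  fix \<theta> :: real
  have r: "((\<lambda>\<theta>. pi - \<theta>) has_real_derivative - 1) (at \<theta>)"
    by (auto intro!: derivative_eq_intros)
  show "((\<lambda>\<theta>. p (pi - \<theta>)) has_real_derivative - p' (pi - \<theta>)) (at \<theta>)"
    using DERIV_chain2[where f = p and g = "\<lambda>\<theta>. pi - \<theta>", OF jacobi_solutionD(1)[OF assms] r] by simp
  show "continuous_on UNIV (\<lambda>\<theta>. - p' (pi - \<theta>))"
    by (intro continuous_intros continuous_on_compose2[OF jacobi_solutionD(2)[OF assms, of UNIV]]) auto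
  assume "0 < \<theta> \<and> \<theta> < pi"
  then have 1: "0 < pi - \<theta>" "pi - \<theta> < pi" by auto
  have "jacobi_drift B A \<theta> = - jacobi_drift A B (pi - \<theta>)"
  proof -
    have "(u - v) / 2 = - ((v - u) / 2)" for u v :: real by (simp add: diff_divide_distrib)
    then show ?thesis
      unfolding jacobi_drift_def cos_pi_minus sin_pi_minus diff_minus_eq_add add_uminus_conv_diff .
  qed
  then show "((\<lambda>\<theta>. - p' (pi - \<theta>)) has_real_derivative
      - 2 * jacobi_drift B A \<theta> * (- p' (pi - \<theta>)) - l * p (pi - \<theta>)) (at \<theta>)"
    by (intro DERIV_cong[OF DERIV_minus[OF DERIV_chain2[where f = p' and g = "\<lambda>\<theta>. pi - \<theta>",
          OF jacobi_solutionD(6)[OF assms 1] r]]]) simp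
qed (use jacobi_solutionD[OF assms] in auto)

lemma integral_reflect_0_pi: "integral {0..pi} (\<lambda>x. f (pi - x)) = integral {0..pi} f" for f :: "real \<Rightarrow> real"
proof -
  have "integral {0..pi} (\<lambda>x. f (pi - x)) = integral {-pi..-0} (\<lambda>x. f (pi - - x))"
    using Henstock_Kurzweil_Integration.integral_reflect_real[of pi 0 "\<lambda>x. f (pi - x)"] by simp
  also have "\<dots> = integral {-pi..0} (f \<circ> (+) pi)" by (simp add: comp_def)
  also have "\<dots> = integral {0..pi} f" using integral_shift_Icc_real[of "-pi" 0 f pi] by simp
  finally show ?thesis .
qed

lemma jacobi_solution_bound:
  assumes A: "A \<ge> 0" and B: "B \<ge> 0"
  shows "\<exists>C\<ge>0. \<exists>k0. \<forall>k\<ge>k0. \<forall>p p'. jacobi_solution A B (real k * (real k + (A + B))) p p' \<and>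
     integral {0..pi} (\<lambda>\<theta>. jacobi_weight A B \<theta> * (p \<theta>)\<^sup>2) = 1 \<longrightarrow>
     (\<forall>\<theta>\<in>{0..pi}. (p \<theta>)\<^sup>2 * shifted_weight A B (1 / (real k)\<^sup>2) (cos \<theta>) \<le> C)"
proof -
  obtain C1 k1 where 1: "C1 \<ge> 0" "\<forall>k\<ge>k1. \<forall>p p'. jacobi_solution A B (real k * (real k + (A + B))) p p' \<and>
     integral {0..pi} (\<lambda>\<theta>. jacobi_weight A B \<theta> * (p \<theta>)\<^sup>2) = 1 \<longrightarrow>
     (\<forall>\<theta>\<in>{0..pi/2}. (p \<theta>)\<^sup>2 * shifted_weight A B (1 / (real k)\<^sup>2) (cos \<theta>) \<le> C1)"
    using jacobi_solution_half_bound[OF A B] by (elim exE conjE)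
  obtain C2 k2 where 2: "C2 \<ge> 0" "\<forall>k\<ge>k2. \<forall>p p'. jacobi_solution B A (real k * (real k + (B + A))) p p' \<and>
     integral {0..pi} (\<lambda>\<theta>. jacobi_weight B A \<theta> * (p \<theta>)\<^sup>2) = 1 \<longrightarrow>
     (\<forall>\<theta>\<in>{0..pi/2}. (p \<theta>)\<^sup>2 * shifted_weight B A (1 / (real k)\<^sup>2) (cos \<theta>) \<le> C2)"
    using jacobi_solution_half_bound[OF B A] by (elim exE conjE)
  show ?thesis
  proof (intro exI[of _ "max C1 C2"] exI[of _ "max k1 k2"] conjI allI impI ballI)
    fix k p p' \<theta>
    assume k: "k \<ge> max k1 k2" and "jacobi_solution A B (real k * (real k + (A + B))) p p' \<and>
       integral {0..pi} (\<lambda>\<theta>. jacobi_weight A B \<theta> * (p \<theta>)\<^sup>2) = 1" and \<theta>: "\<theta> \<in> {0..pi}"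
    then have sol: "jacobi_solution A B (real k * (real k + (A + B))) p p'"
      and norm: "integral {0..pi} (\<lambda>\<theta>. jacobi_weight A B \<theta> * (p \<theta>)\<^sup>2) = 1" by auto
    show "(p \<theta>)\<^sup>2 * shifted_weight A B (1 / (real k)\<^sup>2) (cos \<theta>) \<le> max C1 C2"
    proof (cases "\<theta> \<le> pi/2")
      case True
      then show ?thesis using 1(2)[rule_format, of k p p' \<theta>] sol norm k \<theta> by auto
    next
      case False
      let ?p = "\<lambda>\<theta>. p (pi - \<theta>)"
      have "jacobi_weight B A x = jacobi_weight A B (pi - x)" for x
        by (simp add: jacobi_weight_def mult.commute)
      then have "integral {0..pi} (\<lambda>\<theta>. jacobi_weight B A \<theta> * (?p \<theta>)\<^sup>2) = 1"
        using integral_reflect_0_pi[of "\<lambda>\<theta>. jacobi_weight A B \<theta> * (p \<theta>)\<^sup>2"] norm by simp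
      moreover have "jacobi_solution B A (real k * (real k + (B + A))) ?p (\<lambda>\<theta>. - p' (pi - \<theta>))"
        using jacobi_solution_reflect[OF sol] by (simp add: add.commute[of B A])
      moreover have "pi - \<theta> \<in> {0..pi/2}" using False \<theta> by auto
      ultimately have "(?p (pi - \<theta>))\<^sup>2 * shifted_weight B A (1 / (real k)\<^sup>2) (cos (pi - \<theta>)) \<le> C2"
        using 2(2)[rule_format, of k ?p "\<lambda>\<theta>. - p' (pi - \<theta>)" "pi - \<theta>"] k by auto
      then show ?thesis by (auto simp: shifted_weight_def mult_ac)
    qed
  qed (use 1 in auto)
qed

context jacobi_system
begin

text \<open>The energy argument covers all large degrees; each of the finitely many others is
  bounded by compactness, and \<open>K\<close> is the maximum of the constants.\<close>

lemma e_bound: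
  "\<exists>C\<ge>0. \<forall>k\<ge>1. \<forall>\<theta>\<in>{0..pi}. (e k \<theta>)\<^sup>2 * shifted_weight (a + 1/2) (b + 1/2) (1 / (real k)\<^sup>2) (cos \<theta>) \<le> C"
proof -
  have ab: "a + 1/2 \<ge> 0" "b + 1/2 \<ge> 0" using a b by auto
  obtain C k0 where C: "C \<ge> 0" "\<forall>k\<ge>k0. \<forall>p p'.
     jacobi_solution (a + 1/2) (b + 1/2) (real k * (real k + ((a + 1/2) + (b + 1/2)))) p p' \<and>
     integral {0..pi} (\<lambda>\<theta>. jacobi_weight (a + 1/2) (b + 1/2) \<theta> * (p \<theta>)\<^sup>2) = 1 \<longrightarrow>
     (\<forall>\<theta>\<in>{0..pi}. (p \<theta>)\<^sup>2 * shifted_weight (a + 1/2) (b + 1/2) (1 / (real k)\<^sup>2) (cos \<theta>) \<le> C)"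
    using jacobi_solution_bound[OF ab] by (elim exE conjE)
  let ?f = "\<lambda>k \<theta>. (e k \<theta>)\<^sup>2 * shifted_weight (a + 1/2) (b + 1/2) (1 / (real k)\<^sup>2) (cos \<theta>)"
  have "\<exists>c. \<forall>\<theta>\<in>{0..pi}. ?f k \<theta> \<le> c" if "k \<ge> 1" for k
  proof -
    have "1 - cos \<theta> + 1 / (real k)\<^sup>2 > 0" "1 + cos \<theta> + 1 / (real k)\<^sup>2 > 0" for \<theta>
      using that cos_le_one[of \<theta>] one_plus_cos_nonneg[of \<theta>] by (auto intro: add_nonneg_pos)
    then have "continuous_on {0..pi} (?f k)"
      unfolding shifted_weight_def by (intro continuous_intros) (auto simp: less_imp_neq[THEN not_sym])
    then have "bounded (?f k ` {0..pi})"
      by (intro compact_imp_bounded compact_continuous_image) auto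
    then obtain c where "\<forall>z\<in>?f k ` {0..pi}. norm z \<le> c" unfolding bounded_iff by blast
    then have "\<forall>\<theta>\<in>{0..pi}. ?f k \<theta> \<le> c" by (auto simp: abs_le_iff)
    then show ?thesis by blast
  qed
  then obtain c where c: "\<And>k \<theta>. k \<ge> 1 \<Longrightarrow> \<theta> \<in> {0..pi} \<Longrightarrow> ?f k \<theta> \<le> c k" by metis
  define K where "K = Max (insert C (c ` {..k0}))"
  have "x \<le> K" if "x \<in> insert C (c ` {..k0})" for x
    unfolding K_def by (rule Max_ge) (use that in auto)
  then have K: "C \<le> K" "\<And>k. k \<le> k0 \<Longrightarrow> c k \<le> K" by auto
  show ?thesis
  proof (intro exI[of _ K] conjI allI impI ballI)
    show "0 \<le> K" using C(1) K(1) by linarith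
    fix k :: nat and \<theta> :: real assume k: "1 \<le> k" and \<theta>: "\<theta> \<in> {0..pi}"
    show "?f k \<theta> \<le> K"
    proof (cases "k \<le> k0")
      case True
      then show ?thesis using c[OF k \<theta>] K(2) by (meson order.trans)
    next
      case False
      have "(a + 1/2) + (b + 1/2) = 2 * h" by (simp add: h_def)
      moreover have "integral {0..pi} (\<lambda>\<theta>. jacobi_weight (a + 1/2) (b + 1/2) \<theta> * (e k \<theta>)\<^sup>2) = 1"
        using orthonormal[of k k] by (simp add: w_def power2_eq_square mult.assoc)
      ultimately have "?f k \<theta> \<le> C"
        using C(2)[rule_format, of k "e k" "e' k" \<theta>] solution_e[of k] False \<theta> by (simp only:)
      then show ?thesis using K by linarith
    qed
  qed
qed

text \<open>The natural shift for \<open>e k\<close> is \<open>1 / k^2\<close>, but the weight of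
  the kernel has \<open>1 / n^2\<close>. Passing from one to the other costs a factor
  \<open>(1 + k/n)^2\<close> in each base, hence a fixed power \<open>P\<close> of
  \<open>1 + k/n\<close>, which the decay of the coefficients will absorb.\<close>

lemma e_bound_scaled:
  "\<exists>C\<ge>0. \<exists>P. \<forall>n\<ge>1. \<forall>k. \<forall>\<theta>\<in>{0..pi}.
     (e k \<theta>)\<^sup>2 * shifted_weight (a + 1/2) (b + 1/2) (1 / (real n)\<^sup>2) (cos \<theta>) \<le> C * (1 + real k / real n) ^ P"
proof -
  let ?A = "a + 1/2" and ?B = "b + 1/2"
  have ab: "?A \<ge> 0" "?B \<ge> 0" using a b by auto
  obtain C where C: "C \<ge> 0" "\<And>k \<theta>. k \<ge> 1 \<Longrightarrow> \<theta> \<in> {0..pi} \<Longrightarrow>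
      (e k \<theta>)\<^sup>2 * shifted_weight ?A ?B (1 / (real k)\<^sup>2) (cos \<theta>) \<le> C"
    using e_bound by metis
  have "bounded (e 0 ` {0..pi})"
    by (intro compact_imp_bounded compact_continuous_image continuous_e) auto
  then obtain c0 where c0: "\<And>\<theta>. \<theta> \<in> {0..pi} \<Longrightarrow> \<bar>e 0 \<theta>\<bar> \<le> c0" unfolding bounded_iff by force
  define P where "P = nat \<lceil>2 * ?A + 2 * ?B\<rceil>"
  have P: "2 * ?A + 2 * ?B \<le> real P" unfolding P_def by (rule real_nat_ceiling_ge)
  define K where "K = max C (c0\<^sup>2 * (3 powr ?A * 3 powr ?B))"
  show ?thesis
  proof (intro exI[of _ K] exI[of _ P] conjI allI impI ballI)
    show "K \<ge> 0" using C by (simp add: K_def)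
    fix n k :: nat and \<theta> :: real assume n: "1 \<le> n" and \<theta>: "\<theta> \<in> {0..pi}"
    let ?r = "1 + real k / real n"
    have r: "?r \<ge> 1" by simp
    have rP: "?r ^ P \<ge> 1" using r by (rule one_le_power)
    have cb: "0 \<le> 1 - cos \<theta>" "0 \<le> 1 + cos \<theta>" using one_plus_cos_nonneg[of \<theta>] by auto
    show "(e k \<theta>)\<^sup>2 * shifted_weight ?A ?B (1 / (real n)\<^sup>2) (cos \<theta>) \<le> K * ?r ^ P"
    proof (cases "k = 0")
      \<comment> \<open>Degree 0 is separate because the shift \<open>1 / k^2\<close> has the
        default value 0 there.\<close>
      case True
      have n1: "1 / (real n)\<^sup>2 \<le> 1" using n by simp
      have "(e 0 \<theta>)\<^sup>2 \<le> c0\<^sup>2" using c0[OF \<theta>] by (simp add: abs_le_square_iff[symmetric])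
      moreover have "shifted_weight ?A ?B (1 / (real n)\<^sup>2) (cos \<theta>) \<le> 3 powr ?A * 3 powr ?B"
      proof -
        have "cos \<theta> \<le> 1" by simp
        then have "1 - cos \<theta> + 1 / (real n)\<^sup>2 \<le> 3" "1 + cos \<theta> + 1 / (real n)\<^sup>2 \<le> 3"
          using cb n1 by linarith+
        then show ?thesis
          unfolding shifted_weight_def using ab cb by (intro mult_mono powr_mono2) auto
      qed
      ultimately have "(e 0 \<theta>)\<^sup>2 * shifted_weight ?A ?B (1 / (real n)\<^sup>2) (cos \<theta>) \<le> c0\<^sup>2 * (3 powr ?A * 3 powr ?B)"
        by (intro mult_mono) (auto simp: shifted_weight_def)
      then show ?thesis using True by (simp add: K_def)
    next
      case False
      then have k: "k \<ge> 1" by simp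
      have "1 \<le> ?r\<^sup>2" using r by (rule one_le_power)
      then have r2: "0 < ?r\<^sup>2" by linarith
      have "1 / (real n)\<^sup>2 = (real k / real n)\<^sup>2 * (1 / (real k)\<^sup>2)" using k n by (simp add: field_simps)
      also have "\<dots> \<le> ?r\<^sup>2 * (1 / (real k)\<^sup>2)"
        by (intro mult_right_mono power_mono) auto
      finally have n2: "1 / (real n)\<^sup>2 \<le> ?r\<^sup>2 * (1 / (real k)\<^sup>2)" .
      have lin: "x + 1 / (real n)\<^sup>2 \<le> ?r\<^sup>2 * (x + 1 / (real k)\<^sup>2)" if "x \<ge> 0" for x
        using mult_right_mono[OF \<open>1 \<le> ?r\<^sup>2\<close> that] n2 by (simp add: distrib_left)
      have pos: "0 < x + 1 / (real m)\<^sup>2" if "x \<ge> 0" "m \<ge> 1" for x m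
        using that by (intro add_nonneg_pos) auto
      have "shifted_weight ?A ?B (1 / (real n)\<^sup>2) (cos \<theta>)
          \<le> ((?r\<^sup>2) powr ?A * (1 - cos \<theta> + 1 / (real k)\<^sup>2) powr ?A) * ((?r\<^sup>2) powr ?B * (1 + cos \<theta> + 1 / (real k)\<^sup>2) powr ?B)"
        unfolding shifted_weight_def using cb ab n k r
        by (intro mult_mono powr_le_mult lin pos mult_nonneg_nonneg r2) auto
      also have "\<dots> = ((?r\<^sup>2) powr ?A * (?r\<^sup>2) powr ?B) * shifted_weight ?A ?B (1 / (real k)\<^sup>2) (cos \<theta>)"
        by (simp add: shifted_weight_def mult_ac)
      also have "(?r\<^sup>2) powr ?A * (?r\<^sup>2) powr ?B = ?r powr (2 * ?A + 2 * ?B)"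
      proof -
        have "?r\<^sup>2 = ?r powr 2" using r by simp
        then show ?thesis by (simp only: powr_powr powr_add[of ?r "2 * ?A" "2 * ?B"])
      qed
      finally have s: "shifted_weight ?A ?B (1 / (real n)\<^sup>2) (cos \<theta>)
          \<le> ?r powr (2 * ?A + 2 * ?B) * shifted_weight ?A ?B (1 / (real k)\<^sup>2) (cos \<theta>)" .
      have rr: "?r powr (2 * ?A + 2 * ?B) \<le> ?r ^ P"
      proof -
        have "?r powr (2 * ?A + 2 * ?B) \<le> ?r powr real P" using P r by (intro powr_mono) auto
        then show ?thesis using r by (simp add: powr_realpow)
      qed
      have "(e k \<theta>)\<^sup>2 * shifted_weight ?A ?B (1 / (real n)\<^sup>2) (cos \<theta>)
          \<le> (e k \<theta>)\<^sup>2 * (?r powr (2 * ?A + 2 * ?B) * shifted_weight ?A ?B (1 / (real k)\<^sup>2) (cos \<theta>))"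
        by (intro mult_left_mono s) auto
      also have "\<dots> = ?r powr (2 * ?A + 2 * ?B) * ((e k \<theta>)\<^sup>2 * shifted_weight ?A ?B (1 / (real k)\<^sup>2) (cos \<theta>))"
        by (simp add: mult_ac)
      also have "\<dots> \<le> ?r ^ P * K"
        using rr C(2)[OF k \<theta>] r C(1) by (intro mult_mono) (auto simp: K_def shifted_weight_def)
      finally show ?thesis by (simp add: mult.commute)
    qed
  qed
qed

end

subsection \<open>Finite speed of propagation\<close>

context jacobi_system
begin

definition \<mu> :: "nat \<Rightarrow> real" where "\<mu> k = real k + h"

definition Cs :: "nat \<Rightarrow> real \<Rightarrow> real" where "Cs k t = cos (t * \<mu> k)"

text \<open>The case \<open>\<mu> k = 0\<close>, filled with the limit \<open>t\<close>, occurs for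
  \<open>k = 0\<close> when \<open>a = b = -1/2\<close>.\<close>

definition Sn :: "nat \<Rightarrow> real \<Rightarrow> real" where
  "Sn k t = (if \<mu> k = 0 then t else sin (t * \<mu> k) / \<mu> k)"

text \<open>Partial inner products over \<open>[0, z]\<close>. The energy of a finite wave is a
  quadratic form in them, so its time derivative involves only derivatives of integrals in their
  upper limit and no differentiation under the integral sign.\<close>

definition Qi :: "nat \<Rightarrow> nat \<Rightarrow> real \<Rightarrow> real" where
  "Qi k l z = integral {0..z} (\<lambda>\<theta>. w \<theta> * e k \<theta> * e l \<theta>)"

definition Ri :: "nat \<Rightarrow> nat \<Rightarrow> real \<Rightarrow> real" where
  "Ri k l z = integral {0..z} (\<lambda>\<theta>. w \<theta> * e' k \<theta> * e' l \<theta>)"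

lemma Cs_deriv: "(Cs k has_real_derivative - (\<mu> k)\<^sup>2 * Sn k t) (at t)"
proof -
  have "((\<lambda>t. cos (t * \<mu> k)) has_real_derivative - sin (t * \<mu> k) * \<mu> k) (at t)"
    by (auto intro!: derivative_eq_intros)
  then show ?thesis
    unfolding Cs_def[abs_def] by (rule DERIV_cong) (simp add: Sn_def power2_eq_square)
qed

lemma Sn_deriv: "(Sn k has_real_derivative Cs k t) (at t)"
proof (cases "\<mu> k = 0")
  case True
  then show ?thesis by (simp add: Sn_def[abs_def] Cs_def)
next
  case False
  have "((\<lambda>t. sin (t * \<mu> k) / \<mu> k) has_real_derivative (cos (t * \<mu> k) * \<mu> k) / \<mu> k) (at t)"
    by (auto intro!: derivative_eq_intros)
  then show ?thesis using False by (simp add: Sn_def[abs_def] Cs_def)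
qed

lemma Sn_0: "Sn k 0 = 0" and Cs_0: "Cs k 0 = 1"
  by (simp_all add: Sn_def Cs_def)

lemma integral_deriv:
  assumes "continuous_on {0..pi} f" "0 < z" "z < pi"
  shows "((\<lambda>z. integral {0..z} f) has_real_derivative f z) (at z)"
  using integral_has_real_derivative[OF assms(1), of z] assms(2,3) at_within_Icc_at[of 0 z pi] by auto

lemma Qi_deriv: "0 < z \<Longrightarrow> z < pi \<Longrightarrow> (Qi k l has_real_derivative w z * e k z * e l z) (at z)"
  unfolding Qi_def[abs_def] by (rule integral_deriv) (intro continuous_intros)

lemma Ri_deriv: "0 < z \<Longrightarrow> z < pi \<Longrightarrow> (Ri k l has_real_derivative w z * e' k z * e' l z) (at z)"
  unfolding Ri_def[abs_def] by (rule integral_deriv) (intro continuous_intros)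

text \<open>Integration by parts can be performed on either factor. The term with \<open>h^2\<close>
  completes \<open>k (k + 2 h)\<close> to \<open>(\<mu> k)^2\<close>, so that just the boundary term
  remains.\<close>

lemma Ri_eq:
  assumes "0 < z" "z < pi"
  shows "Ri k l z + h\<^sup>2 * Qi k l z - (\<mu> k)\<^sup>2 * Qi k l z = w z * e' k z * e l z"
    and "Ri k l z + h\<^sup>2 * Qi k l z - (\<mu> l)\<^sup>2 * Qi k l z = w z * e k z * e' l z"
proof -
  have ab: "a + 1/2 \<ge> 0" "b + 1/2 \<ge> 0" using a b by auto
  have \<mu>2: "(\<mu> j)\<^sup>2 = real j * (real j + 2 * h) + h\<^sup>2" for j
    by (simp add: \<mu>_def power2_eq_square algebra_simps)
  have sym: "Ri k l z = Ri l k z" "Qi k l z = Qi l k z"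
    unfolding Ri_def Qi_def by (simp_all only: mult.assoc mult.commute[of "e' k _"] mult.commute[of "e k _"])
  have "Ri k l z = w z * e' k z * e l z + real k * (real k + 2 * h) * Qi k l z" for k l
    unfolding Ri_def Qi_def w_def
    using jacobi_solution_integral_deriv[OF ab solution_e solution_e, of z] assms by simp
  note R = this
  show "Ri k l z + h\<^sup>2 * Qi k l z - (\<mu> k)\<^sup>2 * Qi k l z = w z * e' k z * e l z"
    unfolding \<mu>2 using R[of k l] by (simp add: algebra_simps)
  show "Ri k l z + h\<^sup>2 * Qi k l z - (\<mu> l)\<^sup>2 * Qi k l z = w z * e k z * e' l z"
    unfolding \<mu>2 sym using R[of l k] by (simp add: algebra_simps)
qed

text \<open>The contribution of one pair of modes to the energy on \<open>[0, s - t]\<close>. By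
  \<open>Ri_eq\<close> the interior terms combine to boundary terms, so only values at the moving
  endpoint remain.\<close>

lemma pair_energy_deriv:
  assumes "0 < s - t" "s - t < pi"
  shows "((\<lambda>t. Cs k t * Cs l t * Qi k l (s - t) + Sn k t * Sn l t * (Ri k l (s - t) + h\<^sup>2 * Qi k l (s - t)))
    has_real_derivative
      w (s - t) * (Sn k t * e' k (s - t) * (Cs l t * e l (s - t)) + Cs k t * e k (s - t) * (Sn l t * e' l (s - t))
        - Cs k t * e k (s - t) * (Cs l t * e l (s - t)) - Sn k t * e' k (s - t) * (Sn l t * e' l (s - t))
        - h\<^sup>2 * (Sn k t * e k (s - t) * (Sn l t * e l (s - t))))) (at t)"
proof -
  let ?z = "s - t"
  have r: "((\<lambda>t. s - t) has_real_derivative - 1) (at t)" by (auto intro!: derivative_eq_intros)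
  have Q: "((\<lambda>t. Qi k l (s - t)) has_real_derivative (w ?z * e k ?z * e l ?z) * - 1) (at t)"
    by (rule DERIV_chain2[where f = "Qi k l" and g = "\<lambda>t. s - t", OF Qi_deriv[OF assms] r])
  have R: "((\<lambda>t. Ri k l (s - t)) has_real_derivative (w ?z * e' k ?z * e' l ?z) * - 1) (at t)"
    by (rule DERIV_chain2[where f = "Ri k l" and g = "\<lambda>t. s - t", OF Ri_deriv[OF assms] r])
  have D: "((\<lambda>t. Cs k t * Cs l t * Qi k l (s - t) + Sn k t * Sn l t * (Ri k l (s - t) + h\<^sup>2 * Qi k l (s - t)))
    has_real_derivative
      ((- (\<mu> k)\<^sup>2 * Sn k t) * Cs l t + (- (\<mu> l)\<^sup>2 * Sn l t) * Cs k t) * Qi k l ?z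
        + ((w ?z * e k ?z * e l ?z) * - 1) * (Cs k t * Cs l t)
      + ((Cs k t * Sn l t + Cs l t * Sn k t) * (Ri k l ?z + h\<^sup>2 * Qi k l ?z)
        + ((w ?z * e' k ?z * e' l ?z) * - 1 + h\<^sup>2 * ((w ?z * e k ?z * e l ?z) * - 1)) * (Sn k t * Sn l t))) (at t)"
    by (intro DERIV_add DERIV_mult DERIV_cmult Cs_deriv Sn_deriv Q R)
  have "((- (\<mu> k)\<^sup>2 * Sn k t) * Cs l t + (- (\<mu> l)\<^sup>2 * Sn l t) * Cs k t) * Qi k l ?z
      + (Cs k t * Sn l t + Cs l t * Sn k t) * (Ri k l ?z + h\<^sup>2 * Qi k l ?z)
    = Sn k t * Cs l t * (Ri k l ?z + h\<^sup>2 * Qi k l ?z - (\<mu> k)\<^sup>2 * Qi k l ?z)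
      + Cs k t * Sn l t * (Ri k l ?z + h\<^sup>2 * Qi k l ?z - (\<mu> l)\<^sup>2 * Qi k l ?z)"
    by (simp add: algebra_simps)
  note eq = this[unfolded Ri_eq[OF assms]]
  show ?thesis
    by (rule DERIV_cong[OF D]) (use eq in \<open>simp add: algebra_simps\<close>)
qed

lemma quadratic_form_integral:
  fixes m :: nat
  assumes "\<And>k. continuous_on {0..z} (f k)"
  shows "(\<Sum>k<m. \<Sum>l<m. c k * c l * integral {0..z} (\<lambda>\<theta>. w \<theta> * f k \<theta> * f l \<theta>))
    = integral {0..z} (\<lambda>\<theta>. w \<theta> * (\<Sum>k<m. c k * f k \<theta>)\<^sup>2)"
proof -
  have int: "(\<lambda>\<theta>. c k * c l * (w \<theta> * f k \<theta> * f l \<theta>)) integrable_on {0..z}" for k l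
    by (intro integrable_continuous_real continuous_intros assms)
  have "integral {0..z} (\<lambda>\<theta>. w \<theta> * (\<Sum>k<m. c k * f k \<theta>)\<^sup>2)
      = integral {0..z} (\<lambda>\<theta>. \<Sum>k<m. \<Sum>l<m. c k * c l * (w \<theta> * f k \<theta> * f l \<theta>))"
    by (intro arg_cong[of _ _ "integral {0..z}"])
       (simp add: fun_eq_iff power2_eq_square sum_product sum_distrib_left mult_ac)
  also have "\<dots> = (\<Sum>k<m. integral {0..z} (\<lambda>\<theta>. \<Sum>l<m. c k * c l * (w \<theta> * f k \<theta> * f l \<theta>)))"
    by (intro integral_sum integrable_sum int) auto
  also have "\<dots> = (\<Sum>k<m. \<Sum>l<m. integral {0..z} (\<lambda>\<theta>. c k * c l * (w \<theta> * f k \<theta> * f l \<theta>)))"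
    by (intro sum.cong refl integral_sum int) auto
  finally show ?thesis by simp
qed

text \<open>The wave \<open>V = \<Sum> c\<^sub>k sin(t \<mu>\<^sub>k)/\<mu>\<^sub>k e\<^sub>k\<close> solves \<open>V\<^sub>t\<^sub>t = w\<inverse> (w V\<^sub>\<theta>)\<^sub>\<theta> - h\<^sup>2 V\<close>, so its energy on the shrinking
  interval \<open>[0, s - t]\<close> does not increase.\<close>

lemma finite_propagation:
  assumes "0 \<le> t" "t < s" "s < pi"
  shows "integral {0..s - t} (\<lambda>\<theta>. w \<theta> * (\<Sum>k<m. c k * cos (t * \<mu> k) * e k \<theta>)\<^sup>2)
    \<le> integral {0..s} (\<lambda>\<theta>. w \<theta> * (\<Sum>k<m. c k * e k \<theta>)\<^sup>2)"
proof -
  \<comment> \<open>The integral of \<open>w (V_t^2 + V_\<theta>^2 + h^2 V^2)\<close> over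
    \<open>[0, s - t]\<close>, written as a double sum over modes.\<close>
  define En where "En t = (\<Sum>k<m. \<Sum>l<m. c k * c l * (Cs k t * Cs l t * Qi k l (s - t)
      + Sn k t * Sn l t * (Ri k l (s - t) + h\<^sup>2 * Qi k l (s - t))))" for t
  have En_eq: "En t = integral {0..s - t} (\<lambda>\<theta>. w \<theta> * (\<Sum>k<m. (c k * Cs k t) * e k \<theta>)\<^sup>2)
      + integral {0..s - t} (\<lambda>\<theta>. w \<theta> * (\<Sum>k<m. (c k * Sn k t) * e' k \<theta>)\<^sup>2)
      + h\<^sup>2 * integral {0..s - t} (\<lambda>\<theta>. w \<theta> * (\<Sum>k<m. (c k * Sn k t) * e k \<theta>)\<^sup>2)" for t
    unfolding quadratic_form_integral[symmetric, OF continuous_e] quadratic_form_integral[symmetric, OF continuous_e']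
      En_def Qi_def[symmetric] Ri_def[symmetric] sum_distrib_left sum.distrib[symmetric]
    by (intro sum.cong refl) (simp add: algebra_simps)
  have "En t \<le> En 0"
  proof (rule DERIV_nonpos_imp_nonincreasing[OF assms(1)])
    fix x assume x: "0 \<le> x" "x \<le> t"
    let ?z = "s - x"
    have z: "0 < ?z" "?z < pi" using x assms by auto
    define Vt where "Vt = (\<Sum>k<m. c k * (Cs k x * e k ?z))"
    define Vx where "Vx = (\<Sum>k<m. c k * (Sn k x * e' k ?z))"
    define V where "V = (\<Sum>k<m. c k * (Sn k x * e k ?z))"
    have sp: "(\<Sum>k<m. c k * f k) * (\<Sum>k<m. c k * g k) = (\<Sum>k<m. \<Sum>l<m. c k * c l * (f k * g l))" for f g
      by (simp add: sum_product mult_ac)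
    have "(En has_real_derivative (\<Sum>k<m. \<Sum>l<m. c k * c l *
        (w ?z * (Sn k x * e' k ?z * (Cs l x * e l ?z) + Cs k x * e k ?z * (Sn l x * e' l ?z)
        - Cs k x * e k ?z * (Cs l x * e l ?z) - Sn k x * e' k ?z * (Sn l x * e' l ?z)
        - h\<^sup>2 * (Sn k x * e k ?z * (Sn l x * e l ?z)))))) (at x)"
      unfolding En_def[abs_def] by (intro DERIV_sum DERIV_cmult pair_energy_deriv z)
    also have "(\<Sum>k<m. \<Sum>l<m. c k * c l *
        (w ?z * (Sn k x * e' k ?z * (Cs l x * e l ?z) + Cs k x * e k ?z * (Sn l x * e' l ?z)
        - Cs k x * e k ?z * (Cs l x * e l ?z) - Sn k x * e' k ?z * (Sn l x * e' l ?z)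
        - h\<^sup>2 * (Sn k x * e k ?z * (Sn l x * e l ?z)))))
      = w ?z * (Vx * Vt + Vt * Vx - Vt * Vt - Vx * Vx - h\<^sup>2 * (V * V))"
    proof -
      have p: "Vx * Vt = (\<Sum>k<m. \<Sum>l<m. c k * c l * (Sn k x * e' k ?z * (Cs l x * e l ?z)))"
        "Vt * Vx = (\<Sum>k<m. \<Sum>l<m. c k * c l * (Cs k x * e k ?z * (Sn l x * e' l ?z)))"
        "Vt * Vt = (\<Sum>k<m. \<Sum>l<m. c k * c l * (Cs k x * e k ?z * (Cs l x * e l ?z)))"
        "Vx * Vx = (\<Sum>k<m. \<Sum>l<m. c k * c l * (Sn k x * e' k ?z * (Sn l x * e' l ?z)))"
        "V * V = (\<Sum>k<m. \<Sum>l<m. c k * c l * (Sn k x * e k ?z * (Sn l x * e l ?z)))"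
        unfolding Vt_def Vx_def V_def by (rule sp)+
      show ?thesis
        unfolding p(1) unfolding p(2-5) sum_distrib_left sum.distrib[symmetric] sum_subtractf[symmetric]
        by (intro sum.cong refl) (simp add: algebra_simps)
    qed
    \<comment> \<open>Flux through the endpoint minus the energy lost by shrinking the interval;
      shrinking at the propagation speed 1 makes the total a negative sum of squares.\<close>
    also have "Vx * Vt + Vt * Vx - Vt * Vt - Vx * Vx - h\<^sup>2 * (V * V) = - ((Vx - Vt)\<^sup>2 + (h * V)\<^sup>2)"
      by (simp add: power2_eq_square algebra_simps)
    finally have "(En has_real_derivative w ?z * - ((Vx - Vt)\<^sup>2 + (h * V)\<^sup>2)) (at x)" .
    moreover have "w ?z * - ((Vx - Vt)\<^sup>2 + (h * V)\<^sup>2) \<le> 0"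
      by (intro mult_nonneg_nonpos) auto
    ultimately show "\<exists>y. (En has_real_derivative y) (at x) \<and> y \<le> 0" by blast
  qed
  \<comment> \<open>At time 0 the wave vanishes and its velocity is the given datum, so only the
    velocity part is left.\<close>
  also have "En 0 = integral {0..s} (\<lambda>\<theta>. w \<theta> * (\<Sum>k<m. c k * e k \<theta>)\<^sup>2)"
    unfolding En_eq by (simp add: Sn_0 Cs_0)
  finally have 1: "En t \<le> integral {0..s} (\<lambda>\<theta>. w \<theta> * (\<Sum>k<m. c k * e k \<theta>)\<^sup>2)" .
  have "integral {0..s - t} (\<lambda>\<theta>. w \<theta> * (\<Sum>k<m. (c k * Sn k t) * e' k \<theta>)\<^sup>2) \<ge> 0"
    "h\<^sup>2 * integral {0..s - t} (\<lambda>\<theta>. w \<theta> * (\<Sum>k<m. (c k * Sn k t) * e k \<theta>)\<^sup>2) \<ge> 0"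
    by (intro mult_nonneg_nonneg integral_nonneg integrable_continuous_real continuous_intros; simp)+
  then have "integral {0..s - t} (\<lambda>\<theta>. w \<theta> * (\<Sum>k<m. (c k * Cs k t) * e k \<theta>)\<^sup>2) \<le> En t"
    unfolding En_eq by linarith
  with 1 show ?thesis unfolding Cs_def by linarith
qed

text \<open>A datum that is small on \<open>[0, s]\<close> stays small on \<open>[0, s - R]\<close>
  for times up to \<open>R\<close>, and so does its pairing with any interval in there. In terms of
  coefficients this bounds a cosine sum for all \<open>\<bar>t\<bar> \<le> R\<close>, which is the
  input that the duality for bandlimited functions asks for.\<close>

lemma wave_test_bound:
  assumes \<theta>: "0 \<le> \<theta>1" "\<theta>1 \<le> \<theta>2" "\<theta>2 \<le> s - R" and s: "R < s" "s < pi" and t: "\<bar>t\<bar> \<le> R" and \<epsilon>: "\<epsilon> > 0"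
    and \<delta>: "integral {0..s} (\<lambda>\<theta>. w \<theta> * (\<Sum>k<m. c k * e k \<theta>)\<^sup>2) \<le> \<epsilon>\<^sup>2"
  shows "\<bar>\<Sum>k<m. c k * integral {\<theta>1..\<theta>2} (\<lambda>\<theta>. w \<theta> * e k \<theta>) * cos (t * \<mu> k)\<bar>
    \<le> \<epsilon> * (integral {0..pi} w + 1)"
proof -
  define U where "U \<theta> = (\<Sum>k<m. c k * cos (\<bar>t\<bar> * \<mu> k) * e k \<theta>)" for \<theta>
  have contU: "continuous_on S U" for S unfolding U_def[abs_def] by (intro continuous_intros)
  have cos_abs: "cos (\<bar>t\<bar> * y) = cos (t * y)" for y by (simp add: abs_if)
  have \<theta>2: "\<theta>2 \<le> pi" "\<theta>2 \<le> s - \<bar>t\<bar>" using \<theta> s t by auto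
  have "(\<Sum>k<m. c k * integral {\<theta>1..\<theta>2} (\<lambda>\<theta>. w \<theta> * e k \<theta>) * cos (t * \<mu> k))
      = (\<Sum>k<m. integral {\<theta>1..\<theta>2} (\<lambda>\<theta>. (c k * cos (t * \<mu> k)) * (w \<theta> * e k \<theta>)))"
    by (simp only: integral_mult_right) (simp add: mult_ac)
  also have "\<dots> = integral {\<theta>1..\<theta>2} (\<lambda>\<theta>. \<Sum>k<m. (c k * cos (t * \<mu> k)) * (w \<theta> * e k \<theta>))"
    by (intro integral_sum[symmetric] integrable_continuous_real continuous_intros) auto
  also have "(\<lambda>\<theta>. \<Sum>k<m. (c k * cos (t * \<mu> k)) * (w \<theta> * e k \<theta>)) = (\<lambda>\<theta>. w \<theta> * U \<theta>)"
    by (simp add: fun_eq_iff U_def cos_abs sum_distrib_left mult_ac)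
  finally have eq: "(\<Sum>k<m. c k * integral {\<theta>1..\<theta>2} (\<lambda>\<theta>. w \<theta> * e k \<theta>) * cos (t * \<mu> k))
      = integral {\<theta>1..\<theta>2} (\<lambda>\<theta>. w \<theta> * U \<theta>)" .
  \<comment> \<open>With a datum of size \<open>\<epsilon>\<close> in weighted mean square, this
    inequality replaces Cauchy-Schwarz up to a constant.\<close>
  have pt: "\<bar>u\<bar> \<le> \<epsilon> + u\<^sup>2 / \<epsilon>" for u :: real
  proof (cases "\<bar>u\<bar> \<le> \<epsilon>")
    case True
    then show ?thesis using \<epsilon> by (simp add: add_increasing2)
  next
    case False
    then have "\<bar>u\<bar> * \<epsilon> \<le> \<bar>u\<bar> * \<bar>u\<bar>" by (intro mult_left_mono) auto
    then have "\<bar>u\<bar> \<le> u\<^sup>2 / \<epsilon>" using \<epsilon> by (simp add: pos_le_divide_eq power2_eq_square)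
    then show ?thesis using \<epsilon> by linarith
  qed
  have cont: "continuous_on S (\<lambda>\<theta>. w \<theta> * (U \<theta>)\<^sup>2)" "continuous_on S (\<lambda>\<theta>. \<epsilon> * w \<theta> + w \<theta> * (U \<theta>)\<^sup>2 / \<epsilon>)" for S
    using \<epsilon> by (intro continuous_intros contU; simp)+
  have "\<bar>integral {\<theta>1..\<theta>2} (\<lambda>\<theta>. w \<theta> * U \<theta>)\<bar> \<le> integral {\<theta>1..\<theta>2} (\<lambda>\<theta>. \<epsilon> * w \<theta> + w \<theta> * (U \<theta>)\<^sup>2 / \<epsilon>)"
    unfolding real_norm_def[symmetric]
  proof (rule integral_norm_bound_integral)
    fix x
    have "norm (w x * U x) = w x * \<bar>U x\<bar>" by (simp add: abs_mult)
    also have "\<dots> \<le> w x * (\<epsilon> + (U x)\<^sup>2 / \<epsilon>)" by (intro mult_left_mono pt) simp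
    finally show "norm (w x * U x) \<le> \<epsilon> * w x + w x * (U x)\<^sup>2 / \<epsilon>" by (simp add: algebra_simps)
  qed (intro integrable_continuous_real cont continuous_intros contU)+
  also have "\<dots> = integral {\<theta>1..\<theta>2} (\<lambda>\<theta>. \<epsilon> * w \<theta>) + integral {\<theta>1..\<theta>2} (\<lambda>\<theta>. w \<theta> * (U \<theta>)\<^sup>2 / \<epsilon>)"
    using \<epsilon> by (intro integral_add integrable_continuous_real continuous_intros contU) auto
  also have "\<dots> = \<epsilon> * integral {\<theta>1..\<theta>2} w + integral {\<theta>1..\<theta>2} (\<lambda>\<theta>. w \<theta> * (U \<theta>)\<^sup>2) / \<epsilon>"
    by simp
  also have "\<dots> \<le> \<epsilon> * integral {0..pi} w + \<epsilon>\<^sup>2 / \<epsilon>"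
  proof (intro add_mono mult_left_mono divide_right_mono)
    show "integral {\<theta>1..\<theta>2} w \<le> integral {0..pi} w"
      using \<theta> \<theta>2 by (intro integral_subset_le integrable_continuous_real continuous_w) auto
    have "integral {\<theta>1..\<theta>2} (\<lambda>\<theta>. w \<theta> * (U \<theta>)\<^sup>2) \<le> integral {0..s - \<bar>t\<bar>} (\<lambda>\<theta>. w \<theta> * (U \<theta>)\<^sup>2)"
      using \<theta> \<theta>2 by (intro integral_subset_le integrable_continuous_real cont) auto
    also have "\<dots> \<le> integral {0..s} (\<lambda>\<theta>. w \<theta> * (\<Sum>k<m. c k * e k \<theta>)\<^sup>2)"
      unfolding U_def using t s by (intro finite_propagation) auto
    finally show "integral {\<theta>1..\<theta>2} (\<lambda>\<theta>. w \<theta> * (U \<theta>)\<^sup>2) \<le> \<epsilon>\<^sup>2" using \<delta> by linarith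
  qed (use \<epsilon> in auto)
  also have "\<dots> = \<epsilon> * (integral {0..pi} w + 1)" using \<epsilon> by (simp add: power2_eq_square algebra_simps)
  finally show ?thesis unfolding eq .
qed

section \<open>Approximate point masses\<close>

lemma w_integral_pos:
  assumes "0 \<le> \<alpha>" "\<alpha> < \<beta>" "\<beta> \<le> pi"
  shows "integral {\<alpha>..\<beta>} w > 0"
proof -
  define \<alpha>' \<beta>' where "\<alpha>' = (2 * \<alpha> + \<beta>) / 3" and "\<beta>' = (\<alpha> + 2 * \<beta>) / 3"
  have *: "\<alpha> < \<alpha>'" "\<alpha>' < \<beta>'" "\<beta>' < \<beta>" using assms by (auto simp: \<alpha>'_def \<beta>'_def field_simps)
  obtain z where z: "z \<in> {\<alpha>'..\<beta>'}" "\<And>x. x \<in> {\<alpha>'..\<beta>'} \<Longrightarrow> w z \<le> w x"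
    using continuous_attains_inf[of "{\<alpha>'..\<beta>'}" w] continuous_w * by auto
  have "0 < w z" using z(1) * assms by (intro w_pos) auto
  then have "0 < (\<beta>' - \<alpha>') * w z" using * by simp
  also have "\<dots> = integral {\<alpha>'..\<beta>'} (\<lambda>_. w z)" using * by simp
  also have "\<dots> \<le> integral {\<alpha>'..\<beta>'} w"
    using z(2) by (intro integral_le integrable_continuous_real continuous_w) auto
  also have "\<dots> \<le> integral {\<alpha>..\<beta>} w"
    using * by (intro integral_subset_le integrable_continuous_real continuous_w) auto
  finally show ?thesis .
qed

text \<open>A Landau kernel in the variable \<open>cos \<theta>\<close>: a polynomial of degree at
  most \<open>2 * m\<close> in \<open>cos \<theta>\<close>, nonnegative because
  \<open>\<bar>cos \<theta> - cos \<phi>\<bar> \<le> 2\<close>, with its maximum at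
  \<open>\<phi>\<close>. Being a polynomial it expands into finitely many \<open>e k\<close>, as the
  wave argument requires.\<close>

definition landau :: "real \<Rightarrow> nat \<Rightarrow> real \<Rightarrow> real" where
  "landau \<phi> m \<theta> = (1 - (cos \<theta> - cos \<phi>)\<^sup>2 / 4) ^ m"

definition landau_mass :: "real \<Rightarrow> nat \<Rightarrow> real" where
  "landau_mass \<phi> m = integral {0..pi} (\<lambda>\<theta>. w \<theta> * landau \<phi> m \<theta>)"

definition delta :: "real \<Rightarrow> nat \<Rightarrow> real \<Rightarrow> real" where
  "delta \<phi> m \<theta> = landau \<phi> m \<theta> / landau_mass \<phi> m"

lemma continuous_landau [continuous_intros]: "continuous_on S (landau \<phi> m)"
  unfolding landau_def[abs_def] by (intro continuous_intros) auto

lemma continuous_delta [continuous_intros]: "continuous_on S (delta \<phi> m)"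
  unfolding delta_def[abs_def] divide_inverse by (intro continuous_intros)

lemma landau_base: "0 \<le> 1 - (cos \<theta> - cos \<phi>)\<^sup>2 / (4::real)"
proof -
  have "\<bar>cos \<theta> - cos \<phi>\<bar> \<le> \<bar>cos \<theta>\<bar> + \<bar>cos \<phi>\<bar>" by (rule abs_triangle_ineq4)
  also have "\<dots> \<le> 1 + 1" by (intro add_mono abs_cos_le_one)
  finally have "\<bar>cos \<theta> - cos \<phi>\<bar>\<^sup>2 \<le> 2\<^sup>2" by (intro power_mono) auto
  then show ?thesis by simp
qed

lemma landau_nonneg: "0 \<le> landau \<phi> m \<theta>"
  unfolding landau_def by (intro zero_le_power landau_base)

text \<open>On a short interval to the left of \<open>\<phi>\<close> the base is at least
  \<open>1 - d^2 / 16\<close>. The left side is available for every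
  \<open>0 < \<phi> \<le> pi\<close>, including \<open>pi\<close>.\<close>

lemma landau_mass_lower:
  assumes "0 < \<phi>" "\<phi> \<le> pi" "0 < d" "d \<le> 2"
  shows "\<exists>\<kappa>>0. \<forall>m. \<kappa> * (1 - d\<^sup>2 / 16) ^ m \<le> landau_mass \<phi> m"
proof -
  have "isCont cos \<phi>" by simp
  then obtain \<eta> where \<eta>: "\<eta> > 0" "\<And>x. \<bar>x - \<phi>\<bar> < \<eta> \<Longrightarrow> \<bar>cos x - cos \<phi>\<bar> < d / 2"
    using assms(3) unfolding continuous_at_eps_delta dist_real_def by (metis half_gt_zero)
  define \<alpha> where "\<alpha> = \<phi> - min \<phi> (\<eta> / 2)"
  have \<alpha>: "0 \<le> \<alpha>" "\<alpha> < \<phi>" "\<phi> - \<alpha> < \<eta>" using assms \<eta> by (auto simp: \<alpha>_def min_def)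
  show ?thesis
  proof (intro exI[of _ "integral {\<alpha>..\<phi>} w"] conjI allI)
    show "integral {\<alpha>..\<phi>} w > 0" using \<alpha> assms by (intro w_integral_pos) auto
    fix m
    have "integral {\<alpha>..\<phi>} w * (1 - d\<^sup>2 / 16) ^ m = integral {\<alpha>..\<phi>} (\<lambda>\<theta>. w \<theta> * (1 - d\<^sup>2 / 16) ^ m)"
      by simp
    also have "\<dots> \<le> integral {\<alpha>..\<phi>} (\<lambda>\<theta>. w \<theta> * landau \<phi> m \<theta>)"
    proof (intro integral_le integrable_continuous_real continuous_intros mult_left_mono w_nonneg)
      fix x assume x: "x \<in> {\<alpha>..\<phi>}"
      then have "\<bar>cos x - cos \<phi>\<bar> < d / 2" using \<alpha> by (intro \<eta>) auto
      then have "\<bar>cos x - cos \<phi>\<bar>\<^sup>2 \<le> (d / 2)\<^sup>2" by (intro power_mono) auto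
      then have "1 - d\<^sup>2 / 16 \<le> 1 - (cos x - cos \<phi>)\<^sup>2 / 4" by (simp add: power_divide)
      moreover have "d\<^sup>2 \<le> 2\<^sup>2" using assms by (intro power_mono) auto
      ultimately show "(1 - d\<^sup>2 / 16) ^ m \<le> landau \<phi> m x"
        unfolding landau_def by (intro power_mono) auto
    qed
    also have "\<dots> \<le> landau_mass \<phi> m"
      unfolding landau_mass_def using \<alpha> assms
      by (intro integral_subset_le integrable_continuous_real continuous_intros)
         (auto intro!: mult_nonneg_nonneg landau_nonneg)
    finally show "integral {\<alpha>..\<phi>} w * (1 - d\<^sup>2 / 16) ^ m \<le> landau_mass \<phi> m" .
  qed
qed

lemma landau_mass_pos:
  assumes "0 < \<phi>" "\<phi> \<le> pi"
  shows "landau_mass \<phi> m > 0"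
proof -
  obtain \<kappa> where \<kappa>: "\<kappa> > 0" "\<kappa> * (1 - 2\<^sup>2 / 16) ^ m \<le> landau_mass \<phi> m"
    using landau_mass_lower[OF assms, of 2] by auto
  have "0 < \<kappa> * (1 - 2\<^sup>2 / 16) ^ m" using \<kappa>(1) by simp
  then show ?thesis using \<kappa>(2) by linarith
qed

lemma delta_nonneg:
  assumes "0 < \<phi>" "\<phi> \<le> pi"
  shows "0 \<le> delta \<phi> m \<theta>"
  using landau_mass_pos[OF assms] landau_nonneg by (simp add: delta_def less_imp_le)

lemma integral_delta:
  assumes "0 < \<phi>" "\<phi> \<le> pi"
  shows "integral {0..pi} (\<lambda>\<theta>. w \<theta> * delta \<phi> m \<theta>) = 1"
  using landau_mass_pos[OF assms, of m]
  by (simp add: delta_def landau_mass_def[symmetric] times_divide_eq_right[symmetric] del: times_divide_eq_right)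
     (simp add: landau_mass_def)

text \<open>Away from \<open>\<phi>\<close> the base is at most \<open>1 - d^2 / 4\<close>, while
  the mass decays no faster than the powers of \<open>1 - d^2 / 16\<close>. The quotient is a
  geometric sequence of ratio below 1, uniformly in \<open>\<theta>\<close>.\<close>

lemma delta_concentrates:
  assumes \<phi>: "0 < \<phi>" "\<phi> \<le> pi" and \<eta>: "\<eta> > 0"
  shows "\<exists>u. u \<longlonglongrightarrow> 0 \<and> (\<forall>m. \<forall>\<theta>\<in>{0..pi}. \<bar>\<theta> - \<phi>\<bar> \<ge> \<eta> \<longrightarrow> delta \<phi> m \<theta> \<le> u m)"
proof -
  define F where "F = {0..pi} \<inter> {\<theta>. \<bar>\<theta> - \<phi>\<bar> \<ge> \<eta>}"
  have "closed {\<theta>. \<bar>\<theta> - \<phi>\<bar> \<ge> \<eta>}" by (intro closed_Collect_le continuous_intros)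
  then have comp: "compact F" unfolding F_def by (intro compact_Int_closed) auto
  show ?thesis
  proof (cases "F = {}")
    case True
    then show ?thesis by (intro exI[of _ "\<lambda>_. 0"]) (auto simp: F_def)
  next
    case False
    obtain z where z: "z \<in> F" "\<And>x. x \<in> F \<Longrightarrow> \<bar>cos z - cos \<phi>\<bar> \<le> \<bar>cos x - cos \<phi>\<bar>"
    proof -
      have "continuous_on F (\<lambda>x. \<bar>cos x - cos \<phi>\<bar>)" by (intro continuous_intros)
      from continuous_attains_inf[OF comp False this] show ?thesis using that by blast
    qed
    define d where "d = \<bar>cos z - cos \<phi>\<bar>"
    have "z \<noteq> \<phi>" using z(1) \<eta> by (auto simp: F_def)
    then have "cos z \<noteq> cos \<phi>" using z(1) \<phi> cos_inj_pi[of z \<phi>] by (auto simp: F_def)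
    then have d0: "0 < d" by (simp add: d_def)
    have d4: "d\<^sup>2 / 4 \<le> 1" using landau_base[of z \<phi>] by (simp add: d_def)
    have d2: "d \<le> 2"
    proof (rule power2_le_imp_le)
      show "d\<^sup>2 \<le> 2\<^sup>2" using d4 by simp
    qed simp
    obtain \<kappa> where \<kappa>: "\<kappa> > 0" "\<And>m. \<kappa> * (1 - d\<^sup>2 / 16) ^ m \<le> landau_mass \<phi> m"
      using landau_mass_lower[OF \<phi> d0 d2] by blast
    define r where "r = (1 - d\<^sup>2 / 4) / (1 - d\<^sup>2 / 16)"
    have dd: "0 < d\<^sup>2" using d0 by simp
    have r: "0 \<le> r" "r < 1" using d4 dd by (auto simp: r_def divide_simps)
    show ?thesis
    proof (intro exI[of _ "\<lambda>m. r ^ m / \<kappa>"] conjI allI ballI impI)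
      show "(\<lambda>m. r ^ m / \<kappa>) \<longlonglongrightarrow> 0"
        using tendsto_divide[OF LIMSEQ_power_zero[of r] tendsto_const[of \<kappa>]] r \<kappa> by simp
      fix m \<theta> assume "\<theta> \<in> {0..pi}" "\<eta> \<le> \<bar>\<theta> - \<phi>\<bar>"
      then have "d \<le> \<bar>cos \<theta> - cos \<phi>\<bar>" using z(2)[of \<theta>] by (simp add: F_def d_def)
      then have "d\<^sup>2 \<le> \<bar>cos \<theta> - cos \<phi>\<bar>\<^sup>2" using d0 by (intro power_mono) auto
      then have "landau \<phi> m \<theta> \<le> (1 - d\<^sup>2 / 4) ^ m"
        unfolding landau_def using landau_base[of \<theta> \<phi>] by (intro power_mono) auto
      moreover have pos: "0 < \<kappa> * (1 - d\<^sup>2 / 16) ^ m" using \<kappa> d4 dd by (intro mult_pos_pos zero_less_power) auto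
      ultimately have "delta \<phi> m \<theta> \<le> (1 - d\<^sup>2 / 4) ^ m / (\<kappa> * (1 - d\<^sup>2 / 16) ^ m)"
        unfolding delta_def using \<kappa>(2)[of m] d4 by (intro frac_le zero_le_power) auto
      then show "delta \<phi> m \<theta> \<le> r ^ m / \<kappa>" by (simp add: r_def power_divide mult.commute)
    qed
  qed
qed

lemma delta_approx:
  assumes \<phi>: "0 < \<phi>" "\<phi> \<le> pi" and f: "continuous_on {0..pi} f"
  shows "(\<lambda>m. integral {0..pi} (\<lambda>\<theta>. w \<theta> * delta \<phi> m \<theta> * f \<theta>)) \<longlonglongrightarrow> f \<phi>"
proof (rule LIMSEQ_I)
  fix r :: real assume r: "r > 0"
  have "bounded (f ` {0..pi})" by (intro compact_imp_bounded compact_continuous_image f) auto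
  then obtain K where K: "\<And>\<theta>. \<theta> \<in> {0..pi} \<Longrightarrow> \<bar>f \<theta>\<bar> \<le> K" unfolding bounded_iff by force
  have K0: "K \<ge> 0" using K[of 0] by auto
  obtain \<eta> where \<eta>: "\<eta> > 0" "\<And>\<theta>. \<theta> \<in> {0..pi} \<Longrightarrow> \<bar>\<theta> - \<phi>\<bar> < \<eta> \<Longrightarrow> \<bar>f \<theta> - f \<phi>\<bar> < r / 2"
    using f \<phi> r unfolding continuous_on_iff dist_real_def
    by (metis (no_types, lifting) atLeastAtMost_iff half_gt_zero less_imp_le)
  obtain u where u: "u \<longlonglongrightarrow> 0" "\<And>m \<theta>. \<theta> \<in> {0..pi} \<Longrightarrow> \<bar>\<theta> - \<phi>\<bar> \<ge> \<eta> \<Longrightarrow> delta \<phi> m \<theta> \<le> u m"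
    using delta_concentrates[OF \<phi> \<eta>(1)] by blast
  define \<Omega> where "\<Omega> = integral {0..pi} w"
  have \<Omega>: "\<Omega> > 0" unfolding \<Omega>_def by (intro w_integral_pos) auto
  have "(\<lambda>m. 2 * K * (\<bar>u m\<bar> * \<Omega>)) \<longlonglongrightarrow> 2 * K * (\<bar>0\<bar> * \<Omega>)"
    by (intro tendsto_intros u)
  then have "eventually (\<lambda>m. 2 * K * (\<bar>u m\<bar> * \<Omega>) < r / 2) sequentially"
    using r by (intro order_tendstoD) auto
  then obtain N where N: "\<And>m. m \<ge> N \<Longrightarrow> 2 * K * (\<bar>u m\<bar> * \<Omega>) < r / 2"
    unfolding eventually_sequentially by blast
  show "\<exists>N. \<forall>m\<ge>N. norm (integral {0..pi} (\<lambda>\<theta>. w \<theta> * delta \<phi> m \<theta> * f \<theta>) - f \<phi>) < r"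
  proof (intro exI allI impI)
    fix m assume m: "m \<ge> N"
    have "integral {0..pi} (\<lambda>\<theta>. w \<theta> * delta \<phi> m \<theta> * f \<theta>) - f \<phi>
        = integral {0..pi} (\<lambda>\<theta>. w \<theta> * delta \<phi> m \<theta> * f \<theta>) - integral {0..pi} (\<lambda>\<theta>. w \<theta> * delta \<phi> m \<theta> * f \<phi>)"
      by (simp add: integral_delta[OF \<phi>])
    also have "\<dots> = integral {0..pi} (\<lambda>\<theta>. w \<theta> * delta \<phi> m \<theta> * f \<theta> - w \<theta> * delta \<phi> m \<theta> * f \<phi>)"
      by (intro integral_diff[symmetric] integrable_continuous_real continuous_intros f)
    finally have eq: "integral {0..pi} (\<lambda>\<theta>. w \<theta> * delta \<phi> m \<theta> * f \<theta>) - f \<phi>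
      = integral {0..pi} (\<lambda>\<theta>. w \<theta> * delta \<phi> m \<theta> * f \<theta> - w \<theta> * delta \<phi> m \<theta> * f \<phi>)" .
    have "norm (integral {0..pi} (\<lambda>\<theta>. w \<theta> * delta \<phi> m \<theta> * f \<theta> - w \<theta> * delta \<phi> m \<theta> * f \<phi>))
      \<le> integral {0..pi} (\<lambda>\<theta>. w \<theta> * delta \<phi> m \<theta> * (r / 2) + w \<theta> * (2 * K * \<bar>u m\<bar>))"
    proof (rule integral_norm_bound_integral)
      fix x assume x: "x \<in> {0..pi}"
      have D: "0 \<le> delta \<phi> m x" by (rule delta_nonneg[OF \<phi>])
      have "delta \<phi> m x * \<bar>f x - f \<phi>\<bar> \<le> delta \<phi> m x * (r / 2) + 2 * K * \<bar>u m\<bar>"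
      proof (cases "\<bar>x - \<phi>\<bar> < \<eta>")
        case True
        then have "delta \<phi> m x * \<bar>f x - f \<phi>\<bar> \<le> delta \<phi> m x * (r / 2)"
          using \<eta>(2)[OF x] D by (intro mult_left_mono) auto
        then show ?thesis using K0 by (simp add: add_increasing2)
      next
        case False
        have "\<bar>f x - f \<phi>\<bar> \<le> 2 * K" using K[OF x] K[of \<phi>] \<phi> by auto
        moreover have "delta \<phi> m x \<le> \<bar>u m\<bar>" using u(2)[OF x, of m] False by auto
        ultimately have "delta \<phi> m x * \<bar>f x - f \<phi>\<bar> \<le> \<bar>u m\<bar> * (2 * K)"
          using D by (intro mult_mono) auto
        then show ?thesis using D r by (simp add: add_increasing mult_ac)
      qed
      then have "w x * (delta \<phi> m x * \<bar>f x - f \<phi>\<bar>) \<le> w x * (delta \<phi> m x * (r / 2) + 2 * K * \<bar>u m\<bar>)"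
        by (rule mult_left_mono) simp
      moreover have "norm (w x * delta \<phi> m x * f x - w x * delta \<phi> m x * f \<phi>) = w x * (delta \<phi> m x * \<bar>f x - f \<phi>\<bar>)"
        using D by (simp add: abs_mult mult.assoc flip: right_diff_distrib)
      ultimately show "norm (w x * delta \<phi> m x * f x - w x * delta \<phi> m x * f \<phi>)
          \<le> w x * delta \<phi> m x * (r / 2) + w x * (2 * K * \<bar>u m\<bar>)"
        by (simp add: algebra_simps)
    qed (intro integrable_continuous_real continuous_intros f)+
    also have "\<dots> = 1 * (r / 2) + \<Omega> * (2 * K * \<bar>u m\<bar>)"
    proof (rule integral_unique[OF has_integral_add])
      have "(\<lambda>\<theta>. w \<theta> * delta \<phi> m \<theta>) integrable_on {0..pi}"
        by (intro integrable_continuous_real continuous_intros)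
      from has_integral_mult_left[OF integrable_integral[OF this], of "r / 2"]
      show "((\<lambda>\<theta>. w \<theta> * delta \<phi> m \<theta> * (r / 2)) has_integral 1 * (r / 2)) {0..pi}"
        unfolding integral_delta[OF \<phi>] .
      have "w integrable_on {0..pi}"
        by (intro integrable_continuous_real continuous_w)
      from has_integral_mult_left[OF integrable_integral[OF this], of "2 * K * \<bar>u m\<bar>"]
      show "((\<lambda>\<theta>. w \<theta> * (2 * K * \<bar>u m\<bar>)) has_integral \<Omega> * (2 * K * \<bar>u m\<bar>)) {0..pi}"
        unfolding \<Omega>_def .
    qed
    also have "\<dots> = r / 2 + 2 * K * (\<bar>u m\<bar> * \<Omega>)" by simp
    also have "\<dots> < r" using N[OF m] by simp
    finally show "norm (integral {0..pi} (\<lambda>\<theta>. w \<theta> * delta \<phi> m \<theta> * f \<theta>) - f \<phi>) < r"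
      unfolding eq .
  qed
qed

text \<open>Orthonormality identifies the coefficients with the pairings that
  \<open>delta_approx\<close> handles. Their vanishing from \<open>2 * m + 1\<close> on turns a
  series into a finite sum, to which the definition of \<open>bandlimited\<close> applies.\<close>

lemma delta_expansion:
  assumes \<phi>: "0 < \<phi>" "\<phi> \<le> pi"
  defines "c \<equiv> \<lambda>m k. integral {0..pi} (\<lambda>\<theta>. w \<theta> * delta \<phi> m \<theta> * e k \<theta>)"
  shows "delta \<phi> m \<theta> = (\<Sum>k<2*m+1. c m k * e k \<theta>)" and "k \<ge> 2*m+1 \<Longrightarrow> c m k = 0"
proof -
  define q where "q = (1 - smult (1/4) ([:- cos \<phi>, 1:] ^ 2)) ^ m"
  have "degree ([:- cos \<phi>, 1:] ^ 2) = 2" by (simp add: degree_power_eq)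
  then have "degree (1 - smult (1/4) ([:- cos \<phi>, 1:] ^ 2)) \<le> 2"
    by (intro degree_diff_le) (auto intro: order.trans[OF degree_smult_le])
  then have "degree q \<le> 2 * m" unfolding q_def
    by (intro order.trans[OF degree_power_le]) auto
  then obtain b where b: "\<And>\<theta>. poly q (cos \<theta>) = (\<Sum>k<2*m+1. b k * e k \<theta>)"
    using poly_cos_expansion[of q "2*m+1"] by auto
  have pq: "poly q (cos \<theta>) = landau \<phi> m \<theta>" for \<theta>
    by (simp add: q_def landau_def)
  define b' where "b' k = b k / landau_mass \<phi> m" for k
  have d: "delta \<phi> m \<theta> = (\<Sum>k<2*m+1. b' k * e k \<theta>)" for \<theta>
    unfolding delta_def pq[symmetric] b b'_def by (simp only: sum_divide_distrib times_divide_eq_left)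
  have c: "c m k = (if k < 2*m+1 then b' k else 0)" for k
  proof -
    have "c m k = integral {0..pi} (\<lambda>\<theta>. \<Sum>j<2*m+1. b' j * (w \<theta> * e j \<theta> * e k \<theta>))"
      unfolding c_def d by (intro arg_cong[of _ _ "integral {0..pi}"] ext)
        (simp only: sum_distrib_left sum_distrib_right mult_ac)
    also have "\<dots> = (\<Sum>j<2*m+1. integral {0..pi} (\<lambda>\<theta>. b' j * (w \<theta> * e j \<theta> * e k \<theta>)))"
      by (intro integral_sum integrable_continuous_real continuous_intros) auto
    also have "\<dots> = (\<Sum>j<2*m+1. b' j * (if j = k then 1 else 0))"
      unfolding integral_mult_right orthonormal ..
    also have "\<dots> = (if k < 2*m+1 then b' k else 0)"
      by (simp add: if_distrib[of "\<lambda>x. _ * x"] sum.delta cong: if_cong)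
    finally show ?thesis .
  qed
  show "delta \<phi> m \<theta> = (\<Sum>k<2*m+1. c m k * e k \<theta>)"
    unfolding d by (intro sum.cong) (auto simp: c)
  show "k \<ge> 2*m+1 \<Longrightarrow> c m k = 0" by (simp add: c)
qed

end

subsection \<open>Bandlimited functions and approximation\<close>

text \<open>The function \<open>g\<close> is bandlimited if it is the Fourier transform of a distribution supported in
  \<open>[-R, R]\<close> that acts on continuous functions with norm at most \<open>C\<close>; the definition states the dual property
  for finite combinations of point evaluations of \<open>g\<close>.\<close>

definition bandlimited :: "real \<Rightarrow> real \<Rightarrow> (real \<Rightarrow> complex) \<Rightarrow> bool" where
  "bandlimited R C g \<longleftrightarrow> (\<forall>(n::nat) w u S.
     (\<forall>t. \<bar>t\<bar> \<le> R \<longrightarrow> norm (\<Sum>k<n. w k * cis (t * u k)) \<le> S) \<longrightarrow> norm (\<Sum>k<n. w k * g (u k)) \<le> C * S)"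

lemma bandlimitedI:
  assumes "\<And>(n::nat) w u S. (\<And>t. \<bar>t\<bar> \<le> R \<Longrightarrow> norm (\<Sum>k<n. w k * cis (t * u k)) \<le> S)
    \<Longrightarrow> norm (\<Sum>k<n. w k * g (u k)) \<le> C * S"
  shows "bandlimited R C g"
  unfolding bandlimited_def
proof (intro allI impI)
  fix n :: nat and w :: "nat \<Rightarrow> complex" and u S
  assume "\<forall>t. \<bar>t\<bar> \<le> R \<longrightarrow> norm (\<Sum>k<n. w k * cis (t * u k)) \<le> S"
  then show "norm (\<Sum>k<n. w k * g (u k)) \<le> C * S"
    by (intro assms) blast
qed

lemma bandlimitedD:
  fixes n :: nat
  assumes "bandlimited R C g" "\<And>t. \<bar>t\<bar> \<le> R \<Longrightarrow> norm (\<Sum>k<n. w k * cis (t * u k)) \<le> S"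
  shows "norm (\<Sum>k<n. w k * g (u k)) \<le> C * S"
  using assms unfolding bandlimited_def by blast

lemma bandlimited_one: "bandlimited 0 1 (\<lambda>_. 1)"
proof (rule bandlimitedI)
  fix n :: nat and w :: "nat \<Rightarrow> complex" and u S
  assume "\<And>t. \<bar>t\<bar> \<le> 0 \<Longrightarrow> norm (\<Sum>k<n. w k * cis (t * u k)) \<le> S"
  from this[of 0] show "norm (\<Sum>k<n. w k * 1) \<le> 1 * S" by simp
qed

text \<open>Products correspond to convolutions of the underlying distributions, so the bands add.
  For a frozen frequency \<open>t\<close> of the first factor, \<open>cis (t * u k)\<close> is
  merged into the weights and duality for the second factor applies; duality for the first one
  finishes.\<close>

lemma bandlimited_mult:
  assumes 1: "bandlimited R1 C1 f" and 2: "bandlimited R2 C2 g"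
  shows "bandlimited (R1 + R2) (C1 * C2) (\<lambda>u. f u * g u)"
proof (rule bandlimitedI)
  fix n :: nat and w :: "nat \<Rightarrow> complex" and u S
  assume S: "\<And>t. \<bar>t\<bar> \<le> R1 + R2 \<Longrightarrow> norm (\<Sum>k<n. w k * cis (t * u k)) \<le> S"
  have "norm (\<Sum>k<n. (w k * g (u k)) * cis (t * u k)) \<le> C2 * S" if t: "\<bar>t\<bar> \<le> R1" for t
  proof -
    have "norm (\<Sum>k<n. (w k * cis (t * u k)) * cis (t' * u k)) \<le> S" if "\<bar>t'\<bar> \<le> R2" for t'
    proof -
      have "(\<Sum>k<n. (w k * cis (t * u k)) * cis (t' * u k)) = (\<Sum>k<n. w k * cis ((t + t') * u k))"
        by (simp add: cis_mult mult.assoc distrib_right)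
      then show ?thesis using S[of "t + t'"] t that by simp
    qed
    from bandlimitedD[OF 2 this] show ?thesis by (simp add: mult_ac)
  qed
  from bandlimitedD[OF 1 this] show "norm (\<Sum>k<n. w k * (f (u k) * g (u k))) \<le> C1 * C2 * S"
    by (simp add: mult_ac)
qed

lemma bandlimited_power:
  assumes "bandlimited R 1 f"
  shows "bandlimited (real n * R) 1 (\<lambda>u. f u ^ n)"
proof (induction n)
  case (Suc n)
  from bandlimited_mult[OF assms this] show ?case by (simp add: algebra_simps)
qed (simp add: bandlimited_one)

lemma bandlimited_cmult:
  assumes "bandlimited R C f"
  shows "bandlimited R (norm c * C) (\<lambda>u. c * f u)"
proof (rule bandlimitedI)
  fix n :: nat and w :: "nat \<Rightarrow> complex" and u S
  assume S: "\<And>t. \<bar>t\<bar> \<le> R \<Longrightarrow> norm (\<Sum>k<n. w k * cis (t * u k)) \<le> S"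
  have "(\<Sum>k<n. w k * (c * f (u k))) = c * (\<Sum>k<n. w k * f (u k))"
    by (simp add: sum_distrib_left mult_ac)
  then show "norm (\<Sum>k<n. w k * (c * f (u k))) \<le> norm c * C * S"
    using bandlimitedD[OF assms S] by (simp add: norm_mult mult.assoc mult_left_mono)
qed

lemma bandlimited_add:
  assumes "bandlimited R C f" "bandlimited R D g"
  shows "bandlimited R (C + D) (\<lambda>u. f u + g u)"
proof (rule bandlimitedI)
  fix n :: nat and w :: "nat \<Rightarrow> complex" and u S
  assume S: "\<And>t. \<bar>t\<bar> \<le> R \<Longrightarrow> norm (\<Sum>k<n. w k * cis (t * u k)) \<le> S"
  have "(\<Sum>k<n. w k * (f (u k) + g (u k))) = (\<Sum>k<n. w k * f (u k)) + (\<Sum>k<n. w k * g (u k))"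
    by (simp add: distrib_left sum.distrib)
  then show "norm (\<Sum>k<n. w k * (f (u k) + g (u k))) \<le> (C + D) * S"
    using bandlimitedD[OF assms(1) S] bandlimitedD[OF assms(2) S]
    by (simp add: distrib_right norm_triangle_mono)
qed

lemma bandlimited_zero: "bandlimited R 0 (\<lambda>_. 0)"
  by (rule bandlimitedI) simp

lemma bandlimited_translate:
  assumes "bandlimited R C g"
  shows "bandlimited R C (\<lambda>u. g (u - v))"
proof (rule bandlimitedI)
  fix n :: nat and w :: "nat \<Rightarrow> complex" and u S
  assume S: "\<And>t. \<bar>t\<bar> \<le> R \<Longrightarrow> norm (\<Sum>k<n. w k * cis (t * u k)) \<le> S"
  show "norm (\<Sum>k<n. w k * g (u k - v)) \<le> C * S"
  proof (rule bandlimitedD[OF assms])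
    fix t assume t: "\<bar>t\<bar> \<le> R"
    have "(\<Sum>k<n. w k * cis (t * (u k - v))) = cis (- t * v) * (\<Sum>k<n. w k * cis (t * u k))"
      by (simp add: sum_distrib_left cis_mult mult_ac right_diff_distrib)
    then show "norm (\<Sum>k<n. w k * cis (t * (u k - v))) \<le> S" using S[OF t] by (simp add: norm_mult)
  qed
qed

lemma sum_lessThan_add: "(\<Sum>k<n + m. f k) = (\<Sum>k<n. f k) + (\<Sum>k<m. f (n + k))"
  for f :: "nat \<Rightarrow> 'a :: comm_monoid_add"
  by (induction m) (simp_all add: add.assoc)

text \<open>Evenness permits doubling the points to \<open>u k\<close> and \<open>- u k\<close> with
  half the weight each, whereupon the exponentials combine to cosines. Cosine sums are what the wave
  equation controls.\<close>

lemma bandlimited_even: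
  fixes n :: nat
  assumes g: "bandlimited R C g" "\<And>u. g (- u) = g u"
    and S: "\<And>t. \<bar>t\<bar> \<le> R \<Longrightarrow> norm (\<Sum>k<n. w k * of_real (cos (t * u k))) \<le> S"
  shows "norm (\<Sum>k<n. w k * g (u k)) \<le> C * S"
proof -
  define w' where "w' k = (if k < n then w k else w (k - n)) / 2" for k
  define u' where "u' k = (if k < n then u k else - u (k - n))" for k
  have "norm (\<Sum>k<n + n. w' k * g (u' k)) \<le> C * S"
  proof (rule bandlimitedD[OF g(1)])
    fix t assume t: "\<bar>t\<bar> \<le> R"
    have c: "cis x / 2 + cis (- x) / 2 = of_real (cos x)" for x
      by (simp add: complex_eq_iff)
    have "(\<Sum>k<n + n. w' k * cis (t * u' k)) = (\<Sum>k<n. w k * (cis (t * u k) / 2 + cis (- (t * u k)) / 2))"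
      unfolding sum_lessThan_add sum.distrib[symmetric]
      by (intro sum.cong refl) (simp add: w'_def u'_def algebra_simps)
    then show "norm (\<Sum>k<n + n. w' k * cis (t * u' k)) \<le> S" using S[OF t] unfolding c by simp
  qed
  also have "(\<Sum>k<n + n. w' k * g (u' k)) = (\<Sum>k<n. w k * g (u k))"
    unfolding sum_lessThan_add sum.distrib[symmetric]
    by (intro sum.cong refl) (simp add: w'_def u'_def g(2))
  finally show ?thesis .
qed

text \<open>A superposition of translates of \<open>g\<close>, all with the same band and norm; the
  integrable weight \<open>f\<close> multiplies the norm by its total mass.\<close>

lemma bandlimited_convolution:
  fixes f g :: "real \<Rightarrow> complex"
  assumes g: "bandlimited R C g" and int: "\<And>s. integrable lborel (\<lambda>v. f v * g (s - v))"
    and f: "integrable lborel f"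
  shows "bandlimited R (C * (\<integral>v. norm (f v) \<partial>lborel)) (\<lambda>s. \<integral>v. f v * g (s - v) \<partial>lborel)"
proof (rule bandlimitedI)
  fix n :: nat and w :: "nat \<Rightarrow> complex" and u S
  assume S: "\<And>t. \<bar>t\<bar> \<le> R \<Longrightarrow> norm (\<Sum>k<n. w k * cis (t * u k)) \<le> S"
  have i: "integrable lborel (\<lambda>v. \<Sum>k<n. w k * (f v * g (u k - v)))"
    by (intro Bochner_Integration.integrable_sum integrable_mult_right int)
  have "(\<Sum>k<n. w k * (\<integral>v. f v * g (u k - v) \<partial>lborel)) = (\<integral>v. (\<Sum>k<n. w k * (f v * g (u k - v))) \<partial>lborel)"
    using int by simp
  also have "norm \<dots> \<le> (\<integral>v. norm (\<Sum>k<n. w k * (f v * g (u k - v))) \<partial>lborel)"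
    by (rule integral_norm_bound)
  also have "\<dots> \<le> (\<integral>v. norm (f v) * (C * S) \<partial>lborel)"
  proof (rule integral_mono)
    fix v :: real
    have "(\<Sum>k<n. w k * (f v * g (u k - v))) = f v * (\<Sum>k<n. w k * g (u k - v))"
      by (simp add: sum_distrib_left mult_ac)
    then show "norm (\<Sum>k<n. w k * (f v * g (u k - v))) \<le> norm (f v) * (C * S)"
      using bandlimitedD[OF bandlimited_translate[OF g] S] by (simp add: norm_mult mult_left_mono)
  qed (use i f in auto)
  also have "\<dots> = C * (\<integral>v. norm (f v) \<partial>lborel) * S" by simp
  finally show "norm (\<Sum>k<n. w k * (\<integral>v. f v * g (u k - v) \<partial>lborel)) \<le> C * (\<integral>v. norm (f v) \<partial>lborel) * S" .
qed

section \<open>The cardinal sine and kernels of Jackson type\<close>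

definition cardinal_sine :: "real \<Rightarrow> real" where
  "cardinal_sine x = (if x = 0 then 1 else sin x / x)"

text \<open>Exhibits the function as the Fourier transform of the uniform distribution on
  \<open>[-1, 1]\<close>; its band and its lower bound near 0 both follow from this.\<close>

lemma cardinal_sine_has_integral: "((\<lambda>t. cos (x * t)) has_integral cardinal_sine x) {0..1}"
proof (cases "x = 0")
  case True
  then show ?thesis using has_integral_const_real[of "1::real" 0 1] by (simp add: cardinal_sine_def)
next
  case False
  have "((\<lambda>t. cos (x * t)) has_integral (sin (x * 1) / x - sin (x * 0) / x)) {0..1}"
  proof (rule fundamental_theorem_of_calculus)
    fix t :: real
    have "((\<lambda>t. sin (x * t) / x) has_real_derivative (cos (x * t) * x) / x) (at t within {0..1})"
      by (auto intro!: derivative_eq_intros)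
    then show "((\<lambda>t. sin (x * t) / x) has_vector_derivative cos (x * t)) (at t within {0..1})"
      using False by (simp add: has_real_derivative_iff_has_vector_derivative)
  qed simp
  then show ?thesis using False by (simp add: cardinal_sine_def)
qed

lemma cardinal_sine_minus [simp]: "cardinal_sine (- x) = cardinal_sine x"
  by (simp add: cardinal_sine_def)

lemma abs_cardinal_sine_le_one: "\<bar>cardinal_sine x\<bar> \<le> 1"
  using abs_sin_x_le_abs_x[of x] by (simp add: cardinal_sine_def abs_divide divide_le_eq_1)

lemma abs_mult_cardinal_sine_le_one: "\<bar>x\<bar> * \<bar>cardinal_sine x\<bar> \<le> 1"
  by (simp add: cardinal_sine_def abs_divide)

lemma cardinal_sine_ge: "1 - x\<^sup>2 / 2 \<le> cardinal_sine x"
proof -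
  have c: "1 - y\<^sup>2 / 2 \<le> cos y" for y :: real
  proof -
    have "(sin (y / 2))\<^sup>2 \<le> (y / 2)\<^sup>2"
      using abs_sin_x_le_abs_x[of "y / 2"] by (rule abs_le_square_iff[THEN iffD1])
    then show ?thesis using cos_double_sin[of "y / 2"] by (simp add: power_divide)
  qed
  have "((\<lambda>t::real. 1 - x\<^sup>2 / 2) has_integral (1 - x\<^sup>2 / 2)) {0..1}"
    using has_integral_const_real[of "1 - x\<^sup>2 / 2" 0 1] by simp
  then show ?thesis
  proof (rule has_integral_le[OF _ cardinal_sine_has_integral])
    fix t :: real assume "t \<in> {0..1}"
    then have "\<bar>x * t\<bar> \<le> \<bar>x\<bar>" by (auto simp: abs_mult intro: mult_left_le)
    then have "(x * t)\<^sup>2 \<le> x\<^sup>2" by (simp add: abs_le_square_iff)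
    then show "1 - x\<^sup>2 / 2 \<le> cos (x * t)" using c[of "x * t"] by simp
  qed
qed

lemma continuous_cardinal_sine: "continuous_on S cardinal_sine"
proof -
  have "cardinal_sine = sinc" by (simp add: fun_eq_iff cardinal_sine_def)
  then show ?thesis using continuous_on_sinc[OF continuous_on_id, of S] by (simp only:)
qed

lemma bandlimited_cardinal_sine:
  assumes "r \<ge> 0"
  shows "bandlimited r 1 (\<lambda>u. of_real (cardinal_sine (r * u)))"
proof (rule bandlimitedI)
  fix n :: nat and w :: "nat \<Rightarrow> complex" and u S
  assume S: "\<And>t. \<bar>t\<bar> \<le> r \<Longrightarrow> norm (\<Sum>k<n. w k * cis (t * u k)) \<le> S"
  have S0: "S \<ge> 0" using S[of 0] assms by (auto intro: order.trans[OF norm_ge_zero])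
  have "((\<lambda>t. \<Sum>k<n. w k * of_real (cos (r * u k * t))) has_integral (\<Sum>k<n. w k * of_real (cardinal_sine (r * u k)))) {0..1}"
    by (intro has_integral_sum has_integral_mult_right has_integral_of_real cardinal_sine_has_integral) auto
  then have i: "((\<lambda>t. \<Sum>k<n. w k * of_real (cos (r * u k * t))) has_integral (\<Sum>k<n. w k * of_real (cardinal_sine (r * u k)))) (cbox 0 1)"
    by simp
  have "norm (\<Sum>k<n. w k * of_real (cardinal_sine (r * u k))) \<le> S * measure lborel (cbox (0::real) 1)"
  proof (rule has_integral_bound[OF S0 i])
    fix t :: real assume t: "t \<in> cbox 0 1"
    have c: "of_real (cos x) = (cis x + cis (- x)) / 2" for x
      by (simp add: complex_eq_iff)
    have eq: "(\<Sum>k<n. w k * of_real (cos (r * u k * t)))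
        = ((\<Sum>k<n. w k * cis ((r * t) * u k)) + (\<Sum>k<n. w k * cis ((- (r * t)) * u k))) / 2"
      unfolding c sum.distrib[symmetric] sum_divide_distrib
      by (intro sum.cong refl) (simp add: algebra_simps)
    have "\<bar>r * t\<bar> \<le> r" using t assms by (auto simp: abs_mult intro: mult_left_le)
    then have "norm (\<Sum>k<n. w k * cis ((r * t) * u k)) \<le> S" "norm (\<Sum>k<n. w k * cis ((- (r * t)) * u k)) \<le> S"
      by (intro S; simp)+
    from norm_triangle_mono[OF this] show "norm (\<Sum>k<n. w k * of_real (cos (r * u k * t))) \<le> S"
      unfolding eq by (simp add: norm_divide)
  qed
  then show "norm (\<Sum>k<n. w k * of_real (cardinal_sine (r * u k))) \<le> 1 * S" by simp
qed

lemma integrable_inverse_1_plus_square': "integrable lborel (\<lambda>x::real. 1 / (1 + x\<^sup>2))"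
  using integrable_inverse_1_plus_square by (simp add: set_integrable_def inverse_eq_divide)

text \<open>The fourth power makes the first moment finite; the last factor provides decay of arbitrary order \<open>N\<close>
  without affecting the constants, because its scale grows with \<open>N\<close>.\<close>

definition jackson :: "nat \<Rightarrow> real \<Rightarrow> real" where
  "jackson N w = cardinal_sine w ^ 4 * cardinal_sine (w / real N) ^ N"

lemma continuous_jackson: "continuous_on S (jackson N)"
  unfolding jackson_def[abs_def] divide_inverse
  by (intro continuous_intros continuous_on_compose2[OF continuous_cardinal_sine[of UNIV]]) auto

lemma jackson_nonneg: "even N \<Longrightarrow> jackson N w \<ge> 0"
  unfolding jackson_def by (intro mult_nonneg_nonneg zero_le_even_power) auto

lemma jackson_minus: "jackson N (- w) = jackson N w"
  by (simp add: jackson_def)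

text \<open>After the substitution \<open>w = B * v\<close> the last factor on the left is the
  translation weight \<open>(1 + \<bar>v\<bar>)^N\<close>. It is paid for by the \<open>N\<close>-th
  power in the kernel: the cardinal sine at \<open>w / N\<close> times
  \<open>1 + \<bar>w\<bar> / B\<close> is at most \<open>1 + 1/N\<close> once
  \<open>B \<ge> N^2\<close>, and the \<open>N\<close>-th power of that at most
  \<open>exp 1\<close>. The fourth power absorbs \<open>1 + \<bar>w\<bar>\<close> and leaves
  \<open>1 / (1 + w^2)\<close>; the constant is free of \<open>N\<close>.\<close>

lemma jackson_weighted_bound:
  assumes N: "even N" "N \<ge> 2" and B: "B \<ge> (real N)\<^sup>2"
  shows "jackson N w * (1 + \<bar>w\<bar>) * (1 + \<bar>w\<bar> / B) ^ N \<le> exp 1 * 4 * (1 / (1 + w\<^sup>2))"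
proof -
  let ?s = "cardinal_sine w" and ?t = "cardinal_sine (w / real N)"
  have N0: "real N > 0" using N by simp
  have "(1 + 1 / real N) ^ N \<le> exp (1 / real N) ^ N"
    by (intro power_mono exp_ge_add_one_self) auto
  also have "\<dots> = exp 1" using N0 by (simp flip: exp_of_nat_mult)
  finally have e: "(1 + 1 / real N) ^ N \<le> exp 1" .
  have "\<bar>w\<bar> / B \<le> \<bar>w\<bar> / (real N)\<^sup>2" using B N0 by (intro divide_left_mono mult_pos_pos) (auto intro: less_le_trans[of _ "(real N)\<^sup>2"])
  then have wB: "\<bar>w\<bar> / B \<le> \<bar>w / real N\<bar> / real N" by (simp add: power2_eq_square abs_divide)
  have B0: "0 \<le> \<bar>w\<bar> / B" using B by (auto intro!: divide_nonneg_nonneg intro: order.trans[of 0 "(real N)\<^sup>2"])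
  have "\<bar>?t\<bar> * (1 + \<bar>w\<bar> / B) \<le> 1 + 1 / real N"
  proof -
    have "\<bar>?t\<bar> * (1 + \<bar>w\<bar> / B) \<le> \<bar>?t\<bar> * (1 + \<bar>w / real N\<bar> / real N)"
      using wB by (intro mult_left_mono) auto
    also have "\<dots> = \<bar>?t\<bar> + \<bar>w / real N\<bar> * \<bar>?t\<bar> / real N" by (simp add: algebra_simps)
    also have "\<dots> \<le> 1 + 1 / real N"
      by (intro add_mono divide_right_mono abs_cardinal_sine_le_one abs_mult_cardinal_sine_le_one) auto
    finally show ?thesis .
  qed
  then have "(\<bar>?t\<bar> * (1 + \<bar>w\<bar> / B)) ^ N \<le> (1 + 1 / real N) ^ N"
    using B0 by (intro power_mono) auto
  then have t: "\<bar>?t\<bar> ^ N * (1 + \<bar>w\<bar> / B) ^ N \<le> exp 1"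
    using e by (simp add: power_mult_distrib)
  have tN: "?t ^ N = \<bar>?t\<bar> ^ N" using N by (simp add: power_even_abs)
  have s4: "?s ^ 4 = \<bar>?s\<bar> ^ 4" by (simp add: power_even_abs)
  have s: "?s ^ 4 * (1 + \<bar>w\<bar>) \<le> 4 * (1 / (1 + w\<^sup>2))"
  proof (cases "\<bar>w\<bar> \<le> 1")
    case True
    then have "w\<^sup>2 \<le> 1" by (simp add: abs_square_le_1)
    then have "2 \<le> 4 * (1 / (1 + w\<^sup>2))" by (simp add: field_simps add_pos_nonneg)
    have "\<bar>?s\<bar> ^ 4 * (1 + \<bar>w\<bar>) \<le> 1 * (1 + 1)"
      using True abs_cardinal_sine_le_one[of w] by (intro mult_mono power_le_one) auto
    also have "1 * (1 + 1) = (2::real)" by simp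
    also note \<open>2 \<le> 4 * (1 / (1 + w\<^sup>2))\<close>
    finally show ?thesis unfolding s4 .
  next
    case False
    have "(\<bar>w\<bar> * \<bar>?s\<bar>) ^ 4 \<le> 1"
      using abs_mult_cardinal_sine_le_one[of w] by (intro power_le_one) auto
    then have "\<bar>w\<bar> ^ 4 * \<bar>?s\<bar> ^ 4 \<le> 1" by (simp add: power_mult_distrib)
    moreover have "(1 + w\<^sup>2) * (1 + \<bar>w\<bar>) \<le> 4 * \<bar>w\<bar> ^ 4"
    proof -
      have w1: "1 \<le> \<bar>w\<bar>" using False by simp
      have w2: "w\<^sup>2 = \<bar>w\<bar>\<^sup>2" by simp
      have "1 \<le> \<bar>w\<bar>\<^sup>2" using w1 by (rule one_le_power)
      then have "1 + w\<^sup>2 \<le> 2 * \<bar>w\<bar>\<^sup>2" unfolding w2 by simp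
      moreover have "1 + \<bar>w\<bar> \<le> 2 * \<bar>w\<bar>\<^sup>2"
        using w1 \<open>1 \<le> \<bar>w\<bar>\<^sup>2\<close> self_le_power[of "\<bar>w\<bar>" 2] by simp
      ultimately have "(1 + w\<^sup>2) * (1 + \<bar>w\<bar>) \<le> (2 * \<bar>w\<bar>\<^sup>2) * (2 * \<bar>w\<bar>\<^sup>2)"
        by (intro mult_mono) auto
      then show ?thesis by (simp add: power2_eq_square power4_eq_xxxx)
    qed
    ultimately have "\<bar>?s\<bar> ^ 4 * ((1 + w\<^sup>2) * (1 + \<bar>w\<bar>)) \<le> \<bar>?s\<bar> ^ 4 * (4 * \<bar>w\<bar> ^ 4)"
      by (intro mult_left_mono) auto
    also have "\<dots> \<le> 4" using \<open>\<bar>w\<bar> ^ 4 * \<bar>?s\<bar> ^ 4 \<le> 1\<close> by (simp add: mult_ac)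
    finally show ?thesis unfolding s4 by (simp add: pos_le_divide_eq add_pos_nonneg mult_ac)
  qed
  have "jackson N w * (1 + \<bar>w\<bar>) * (1 + \<bar>w\<bar> / B) ^ N = (?s ^ 4 * (1 + \<bar>w\<bar>)) * (\<bar>?t\<bar> ^ N * (1 + \<bar>w\<bar> / B) ^ N)"
    by (simp add: jackson_def tN mult_ac)
  also have "\<dots> \<le> (4 * (1 / (1 + w\<^sup>2))) * exp 1"
    using B0 by (intro mult_mono s t) auto
  finally show ?thesis by (simp add: mult_ac)
qed

text \<open>Bernoulli's inequality keeps the \<open>N\<close>-th power above 1/2 on
  \<open>[-1, 1]\<close>. Since the bound is free of \<open>N\<close>, the mass of the kernel has an
  absolute lower bound.\<close>

lemma jackson_ge:
  assumes "N \<ge> 2" "\<bar>w\<bar> \<le> 1"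
  shows "1 / 32 \<le> jackson N w"
proof -
  have w: "w\<^sup>2 \<le> 1" using assms(2) by (simp add: abs_square_le_1)
  have N: "real N \<ge> 2" using assms by simp
  have "1/2 \<le> cardinal_sine w" using cardinal_sine_ge[of w] w by simp
  then have 1: "(1/2) ^ 4 \<le> cardinal_sine w ^ 4" by (intro power_mono) auto
  have N2: "1 \<le> (real N)\<^sup>2" using N by (intro one_le_power) auto
  then have N3: "1 / (2 * (real N)\<^sup>2) \<le> 1" by (subst divide_le_eq_1_pos) linarith+
  have "1/2 \<le> 1 + real N * (- (1 / (2 * (real N)\<^sup>2)))"
    using N by (simp add: field_simps power2_eq_square)
  also have "\<dots> \<le> (1 + - (1 / (2 * (real N)\<^sup>2))) ^ N"
    using N3 by (intro Bernoulli_inequality) simp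
  also have "\<dots> \<le> cardinal_sine (w / real N) ^ N"
  proof (rule power_mono)
    have "(w / real N)\<^sup>2 / 2 = w\<^sup>2 / (2 * (real N)\<^sup>2)" by (simp add: power_divide)
    also have "\<dots> \<le> 1 / (2 * (real N)\<^sup>2)" using w by (intro divide_right_mono) auto
    finally show "1 + - (1 / (2 * (real N)\<^sup>2)) \<le> cardinal_sine (w / real N)"
      using cardinal_sine_ge[of "w / real N"] by linarith
    show "0 \<le> 1 + - (1 / (2 * (real N)\<^sup>2))" using N3 by simp
  qed
  finally have 2: "1/2 \<le> cardinal_sine (w / real N) ^ N" .
  have "(1/2) ^ 4 * (1/2) \<le> jackson N w"
    unfolding jackson_def by (intro mult_mono 1 2) auto
  then show ?thesis by (simp add: power4_eq_xxxx)
qed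

text \<open>The weight \<open>(1 + \<bar>v\<bar>)^N\<close> is the price of translating the decay
  \<open>1 / (1 + \<bar>s\<bar>)^N\<close> by \<open>v\<close>. The bound \<open>C1\<close> for the
  weighted first moment is the factor per derivative in the approximation error, and
  \<open>R\<close> is the band.\<close>

locale approx_kernel =
  fixes k :: "real \<Rightarrow> real" and N :: nat and C1 R Ck :: real
  assumes N: "N \<ge> 2"
    and cont: "continuous_on UNIV k" and nonneg: "\<And>v. 0 \<le> k v" and even: "\<And>v. k (- v) = k v"
    and int0: "integrable lborel (\<lambda>v. k v * (1 + \<bar>v\<bar>) ^ N)" and mass: "(\<integral>v. k v \<partial>lborel) = 1"
    and int1: "integrable lborel (\<lambda>v. \<bar>v\<bar> * k v * (1 + \<bar>v\<bar>) ^ N)"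
    and moment: "(\<integral>v. \<bar>v\<bar> * k v * (1 + \<bar>v\<bar>) ^ N \<partial>lborel) \<le> C1"
    and band: "bandlimited R Ck (\<lambda>u. of_real (k u))"

text \<open>The order of quantifiers is the point: \<open>C1\<close> precedes \<open>N\<close>, and
  the threshold \<open>B0\<close> depends on \<open>N\<close>. The exponential rate, which will be
  computed from \<open>C1\<close>, is therefore absolute.\<close>

lemma jackson_kernel:
  "\<exists>C1\<ge>1. \<forall>N\<ge>2. \<exists>B0>0. \<forall>B\<ge>B0. \<exists>k Ck. approx_kernel k N (C1 / B) B Ck"
proof -
  let ?g = "\<lambda>x::real. 1 / (1 + x\<^sup>2)"
  define P where "P = (\<integral>x. ?g x \<partial>lborel)"
  have P: "P \<ge> 0" unfolding P_def by (intro integral_nonneg_AE) (auto simp: add_nonneg_nonneg)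
  show ?thesis
  \<comment> \<open>The factor 320 is \<open>16 * 4 * 5\<close>: 16 from
    \<open>1 / c0 \<le> 16\<close>, 4 from the weighted bound, 5 from the scaling
    \<open>b = B / 5\<close>.\<close>
  proof (rule exI[of _ "320 * exp 1 * P + 1"], intro conjI allI impI)
    show "320 * exp 1 * P + 1 \<ge> 1" using P by simp
    fix N :: nat assume N2: "2 \<le> N"
    \<comment> \<open>Even, which makes the kernel nonnegative, and at least both 2 and
      \<open>N\<close>.\<close>
    define N' where "N' = 2 * N + 2"
    have N': "even N'" "N' \<ge> 2" "N \<le> N'" by (auto simp: N'_def)
    let ?J = "jackson N'"
    have J0: "0 \<le> ?J w" for w by (rule jackson_nonneg[OF N'(1)])
    have meas: "?J \<in> borel_measurable borel" by (intro borel_measurable_continuous_onI continuous_jackson)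
    have Jint: "integrable lborel ?J"
    proof (rule Bochner_Integration.integrable_bound)
      show "integrable lborel (\<lambda>w. exp 1 * 4 * ?g w)"
        by (intro integrable_mult_right integrable_inverse_1_plus_square')
      show "AE w in lborel. norm (?J w) \<le> norm (exp 1 * 4 * ?g w)"
      proof (rule AE_I2)
        fix w :: real
        let ?B = "(real N')\<^sup>2"
        have "?J w * 1 * 1 \<le> ?J w * (1 + \<bar>w\<bar>) * (1 + \<bar>w\<bar> / ?B) ^ N'"
          by (intro mult_mono one_le_power) (auto simp: J0)
        also have "\<dots> \<le> exp 1 * 4 * ?g w" by (rule jackson_weighted_bound[OF N'(1,2) order.refl])
        finally show "norm (?J w) \<le> norm (exp 1 * 4 * ?g w)" using J0[of w] by simp
      qed
    qed (use meas in simp)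
    define c0 where "c0 = (\<integral>w. ?J w \<partial>lborel)"
    have c0: "c0 \<ge> 1/16"
    proof -
      have "(\<integral>w. indicator {-1..1::real} w * (1/32) \<partial>lborel) \<le> c0"
        unfolding c0_def
      proof (rule Bochner_Integration.integral_mono[OF _ Jint])
        show "integrable lborel (\<lambda>w::real. indicator {-1..1} w * (1/32) :: real)"
          by (intro integrable_mult_left) simp
        show "indicator {-1..1} w * (1/32) \<le> ?J w" for w :: real
          using jackson_ge[OF N'(2), of w] J0[of w] by (auto simp: indicator_def abs_le_iff)
      qed
      then show ?thesis by simp
    qed
    show "\<exists>B0>0. \<forall>B\<ge>B0. \<exists>k Ck. approx_kernel k N ((320 * exp 1 * P + 1) / B) B Ck"
    proof (rule exI[of _ "5 * (real N')\<^sup>2"], intro conjI allI impI)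
      show "0 < 5 * (real N')\<^sup>2" using N' by simp
      fix B assume B: "5 * (real N')\<^sup>2 \<le> B"
      \<comment> \<open>The two factors have bands \<open>4 * b\<close> and
        \<open>N' * (b / N') = b\<close>, together \<open>5 * b = B\<close>.\<close>
      define b where "b = B / 5"
      have bN: "(real N')\<^sup>2 \<le> b" using B by (simp add: b_def)
      have "0 < (real N')\<^sup>2" using N' by simp
      then have b0: "b > 0" using bN by linarith
      define k where "k v = b / c0 * ?J (b * v)" for v
      have k0: "0 \<le> k v" for v using J0 b0 c0 by (simp add: k_def)
      have kcont: "continuous_on S k" for S
        unfolding k_def[abs_def]
        by (intro continuous_intros continuous_on_compose2[OF continuous_jackson[of UNIV]]) auto
      have kmeas: "k \<in> borel_measurable borel" by (intro borel_measurable_continuous_onI kcont)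
      have w: "k v * (1 + \<bar>b * v\<bar>) * (1 + \<bar>v\<bar>) ^ N \<le> b / c0 * (exp 1 * 4 * ?g (b * v))" for v
      proof -
        have "k v * (1 + \<bar>b * v\<bar>) * (1 + \<bar>v\<bar>) ^ N \<le> k v * (1 + \<bar>b * v\<bar>) * (1 + \<bar>v\<bar>) ^ N'"
          using k0[of v] N' by (intro mult_left_mono power_increasing) auto
        also have "\<dots> = b / c0 * (?J (b * v) * (1 + \<bar>b * v\<bar>) * (1 + \<bar>b * v\<bar> / b) ^ N')"
          using b0 by (simp add: k_def abs_mult mult_ac)
        also have "\<dots> \<le> b / c0 * (exp 1 * 4 * ?g (b * v))"
          using b0 c0 by (intro mult_left_mono jackson_weighted_bound N' bN) auto
        finally show ?thesis .
      qed
      have gint: "integrable lborel (\<lambda>v. ?g (b * v))"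
        using lborel_integrable_real_affine[OF integrable_inverse_1_plus_square', of b 0] b0 by simp
      have gval: "(\<integral>v. ?g (b * v) \<partial>lborel) = P / b"
        using lborel_integral_real_affine[of b ?g 0] b0 by (simp add: P_def field_simps)
      have w1: "\<bar>v\<bar> * k v * (1 + \<bar>v\<bar>) ^ N \<le> 1 / c0 * (exp 1 * 4 * ?g (b * v))" for v
      proof -
        have "b * (\<bar>v\<bar> * k v * (1 + \<bar>v\<bar>) ^ N) = k v * \<bar>b * v\<bar> * (1 + \<bar>v\<bar>) ^ N"
          using b0 by (simp add: abs_mult mult_ac)
        also have "\<dots> \<le> k v * (1 + \<bar>b * v\<bar>) * (1 + \<bar>v\<bar>) ^ N"
          using k0[of v] by (intro mult_right_mono mult_left_mono) auto
        also note w[of v]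
        also have "b / c0 * (exp 1 * 4 * ?g (b * v)) = b * (1 / c0 * (exp 1 * 4 * ?g (b * v)))" by simp
        finally show ?thesis using b0 by (simp only: mult_le_cancel_left_pos)
      qed
      have w0: "k v * (1 + \<bar>v\<bar>) ^ N \<le> b / c0 * (exp 1 * 4 * ?g (b * v))" for v
      proof -
        have "k v * 1 * (1 + \<bar>v\<bar>) ^ N \<le> k v * (1 + \<bar>b * v\<bar>) * (1 + \<bar>v\<bar>) ^ N"
          using k0[of v] by (intro mult_right_mono mult_left_mono) auto
        then show ?thesis using w[of v] by simp
      qed
      have i1: "integrable lborel (\<lambda>v. \<bar>v\<bar> * k v * (1 + \<bar>v\<bar>) ^ N)"
      proof (rule Bochner_Integration.integrable_bound)
        show "integrable lborel (\<lambda>v. 1 / c0 * (exp 1 * 4 * ?g (b * v)))"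
          by (intro integrable_mult_right gint)
        show "AE v in lborel. norm (\<bar>v\<bar> * k v * (1 + \<bar>v\<bar>) ^ N) \<le> norm (1 / c0 * (exp 1 * 4 * ?g (b * v)))"
        proof (rule AE_I2)
          fix v
          have "0 \<le> \<bar>v\<bar> * k v * (1 + \<bar>v\<bar>) ^ N" using k0[of v] by simp
          then show "norm (\<bar>v\<bar> * k v * (1 + \<bar>v\<bar>) ^ N) \<le> norm (1 / c0 * (exp 1 * 4 * ?g (b * v)))"
            using w1[of v] unfolding real_norm_def by linarith
        qed
      qed (use kmeas in measurable)
      have i0: "integrable lborel (\<lambda>v. k v * (1 + \<bar>v\<bar>) ^ N)"
      proof (rule Bochner_Integration.integrable_bound)
        show "integrable lborel (\<lambda>v. b / c0 * (exp 1 * 4 * ?g (b * v)))"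
          by (intro integrable_mult_right gint)
        show "AE v in lborel. norm (k v * (1 + \<bar>v\<bar>) ^ N) \<le> norm (b / c0 * (exp 1 * 4 * ?g (b * v)))"
        proof (rule AE_I2)
          fix v
          have "0 \<le> k v * (1 + \<bar>v\<bar>) ^ N" using k0[of v] by simp
          then show "norm (k v * (1 + \<bar>v\<bar>) ^ N) \<le> norm (b / c0 * (exp 1 * 4 * ?g (b * v)))"
            using w0[of v] unfolding real_norm_def by linarith
        qed
      qed (use kmeas in measurable)
      have mass: "(\<integral>v. k v \<partial>lborel) = 1"
      proof -
        have J: "c0 = b * (\<integral>v. ?J (b * v) \<partial>lborel)"
          unfolding c0_def using lborel_integral_real_affine[of b ?J 0] b0 by simp
        have "(\<integral>v. k v \<partial>lborel) = b / c0 * (\<integral>v. ?J (b * v) \<partial>lborel)"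
          unfolding k_def by (rule integral_mult_right_zero)
        also have "\<dots> = b * (\<integral>v. ?J (b * v) \<partial>lborel) / c0" by (simp only: times_divide_eq_left)
        also have "\<dots> = c0 / c0" by (simp only: J[symmetric])
        finally show ?thesis using c0 by simp
      qed
      have "(\<integral>v. \<bar>v\<bar> * k v * (1 + \<bar>v\<bar>) ^ N \<partial>lborel) \<le> (\<integral>v. 1 / c0 * (exp 1 * 4 * ?g (b * v)) \<partial>lborel)"
        by (intro integral_mono i1 w1 integrable_mult_right gint)
      also have "\<dots> = 1 / c0 * (exp 1 * 4 * (P / b))" by (simp only: integral_mult_right_zero gval)
      also have "\<dots> \<le> 16 * (exp 1 * 4 * (P / b))"
        using c0 P b0 by (intro mult_right_mono) (auto simp: divide_le_eq)
      also have "\<dots> = 320 * exp 1 * P / B" by (simp add: b_def)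
      also have "\<dots> \<le> (320 * exp 1 * P + 1) / B" using b0 by (intro divide_right_mono) (auto simp: b_def)
      finally have moment: "(\<integral>v. \<bar>v\<bar> * k v * (1 + \<bar>v\<bar>) ^ N \<partial>lborel) \<le> (320 * exp 1 * P + 1) / B" .
      have "bandlimited (real 4 * b + real N' * (b / real N')) (1 * 1)
          (\<lambda>u. of_real (cardinal_sine (b * u)) ^ 4 * of_real (cardinal_sine (b / real N' * u)) ^ N')"
        using b0 by (intro bandlimited_mult bandlimited_power bandlimited_cardinal_sine) auto
      moreover have "real 4 * b + real N' * (b / real N') = B" using N' by (simp add: b_def)
      ultimately have "bandlimited B (norm (complex_of_real (b / c0)) * 1) (\<lambda>u. of_real (b / c0) *
          (of_real (cardinal_sine (b * u)) ^ 4 * of_real (cardinal_sine (b / real N' * u)) ^ N'))"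
        by (intro bandlimited_cmult) simp
      then have bl: "bandlimited B (norm (complex_of_real (b / c0)) * 1) (\<lambda>u. of_real (k u))"
        by (simp add: k_def jackson_def)
      have keven: "k (- v) = k v" for v by (simp add: k_def jackson_minus)
      have "approx_kernel k N ((320 * exp 1 * P + 1) / B) B (norm (complex_of_real (b / c0)) * 1)"
        by unfold_locales (fact N2 kcont k0 keven i0 mass i1 moment bl)+
      then show "\<exists>k Ck. approx_kernel k N ((320 * exp 1 * P + 1) / B) B Ck" by blast
    qed
  qed
qed

lemma norm_lebesgue_integral_le:
  fixes f :: "'a \<Rightarrow> complex" and g :: "'a \<Rightarrow> real"
  assumes "integrable M f" "integrable M g" "\<And>x. norm (f x) \<le> g x"
  shows "norm (\<integral>x. f x \<partial>M) \<le> (\<integral>x. g x \<partial>M)"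
proof -
  have "norm (\<integral>x. f x \<partial>M) \<le> (\<integral>x. norm (f x) \<partial>M)" by (rule integral_norm_bound)
  also have "\<dots> \<le> (\<integral>x. g x \<partial>M)"
    using assms by (intro Bochner_Integration.integral_mono) auto
  finally show ?thesis .
qed

lemma vector_increment_bound:
  fixes f :: "real \<Rightarrow> complex"
  assumes f: "\<And>x. (f has_vector_derivative f' x) (at x)"
    and M: "\<And>z. min x y \<le> z \<Longrightarrow> z \<le> max x y \<Longrightarrow> norm (f' z) \<le> M"
  shows "norm (f y - f x) \<le> M * \<bar>y - x\<bar>"
proof -
  have cont: "continuous_on S f" for S
    using f by (intro continuous_at_imp_continuous_on ballI has_vector_derivative_continuous) auto
  have *: "norm (f v - f u) \<le> M * (v - u)" if uv: "u < v" "u = min x y" "v = max x y" for u v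
  proof -
    obtain z where z: "z \<in> {u<..<v}" "norm (f v - f u) \<le> norm ((v - u) *\<^sub>R f' z)"
      using mvt_general[OF uv(1) cont, of "\<lambda>z t. t *\<^sub>R f' z"] f
      unfolding has_vector_derivative_def by blast
    have "norm (f' z) \<le> M" using z(1) uv by (intro M) auto
    have "norm (f v - f u) \<le> (v - u) * norm (f' z)" using z(2) uv(1) by simp
    also have "\<dots> \<le> (v - u) * M"
      using \<open>norm (f' z) \<le> M\<close> uv(1) by (intro mult_left_mono) auto
    finally show ?thesis by (simp only: mult.commute)
  qed
  show ?thesis
  proof (cases x y rule: linorder_cases)
    case less
    then show ?thesis using *[of x y] by simp
  next
    case greater
    then show ?thesis using *[of y x] by (simp add: norm_minus_commute)
  qed simp
qed

section \<open>Approximation by iterated convolution\<close>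

context approx_kernel
begin

definition \<omega> :: "real \<Rightarrow> real" where "\<omega> s = 1 / (1 + \<bar>s\<bar>) ^ N"

definition conv :: "(real \<Rightarrow> complex) \<Rightarrow> real \<Rightarrow> complex" where
  "conv f s = (\<integral>v. k v *\<^sub>R f (s - v) \<partial>lborel)"

definition T :: "(real \<Rightarrow> complex) \<Rightarrow> real \<Rightarrow> complex" where "T f s = f s - conv f s"

text \<open>\<open>F l\<close> stands for the \<open>l\<close>-th derivative of \<open>F 0\<close>,
  and \<open>D l\<close> for its bound relative to the decay \<open>\<omega>\<close>. Carrying the
  whole sequence makes the class stable under \<open>T\<close>, which shifts \<open>D\<close> by one
  index.\<close>

definition weighted_family :: "(nat \<Rightarrow> real \<Rightarrow> complex) \<Rightarrow> (nat \<Rightarrow> real) \<Rightarrow> bool" where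
  "weighted_family F D \<longleftrightarrow> (\<forall>l s. (F l has_vector_derivative F (Suc l) s) (at s)) \<and>
     (\<forall>l s. norm (F l s) \<le> D l * \<omega> s)"

lemma \<omega>_pos: "\<omega> s > 0" by (simp add: \<omega>_def)

lemma \<omega>_le_one: "\<omega> s \<le> 1"
  by (simp add: \<omega>_def divide_le_eq one_le_power)

lemma \<omega>_shift:
  assumes "\<bar>z - s\<bar> \<le> \<bar>v\<bar>"
  shows "\<omega> z \<le> \<omega> s * (1 + \<bar>v\<bar>) ^ N"
proof -
  have "\<bar>s\<bar> \<le> \<bar>z\<bar> + \<bar>v\<bar>" using assms by linarith
  moreover have "(1 + \<bar>z\<bar>) * (1 + \<bar>v\<bar>) = 1 + \<bar>z\<bar> + \<bar>v\<bar> + \<bar>z\<bar> * \<bar>v\<bar>" by (simp add: algebra_simps)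
  moreover have "0 \<le> \<bar>z\<bar> * \<bar>v\<bar>" by simp
  ultimately have "1 + \<bar>s\<bar> \<le> (1 + \<bar>z\<bar>) * (1 + \<bar>v\<bar>)" by linarith
  then have "(1 + \<bar>s\<bar>) ^ N \<le> ((1 + \<bar>z\<bar>) * (1 + \<bar>v\<bar>)) ^ N" by (intro power_mono) auto
  then have "(1 + \<bar>s\<bar>) ^ N \<le> (1 + \<bar>z\<bar>) ^ N * (1 + \<bar>v\<bar>) ^ N" by (simp add: power_mult_distrib)
  then show ?thesis by (simp add: \<omega>_def pos_divide_le_eq pos_le_divide_eq mult.commute)
qed

lemma k_meas [measurable]: "k \<in> borel_measurable borel"
  by (intro borel_measurable_continuous_onI cont)

lemma int_k: "integrable lborel k"
proof (rule Bochner_Integration.integrable_bound[OF int0])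
  show "AE v in lborel. norm (k v) \<le> norm (k v * (1 + \<bar>v\<bar>) ^ N)"
  proof (rule AE_I2)
    fix v
    have "k v * 1 \<le> k v * (1 + \<bar>v\<bar>) ^ N" by (intro mult_left_mono nonneg one_le_power) simp
    then show "norm (k v) \<le> norm (k v * (1 + \<bar>v\<bar>) ^ N)" using nonneg[of v] by simp
  qed
qed simp

lemma weighted_familyD:
  assumes "weighted_family F D"
  shows "(F l has_vector_derivative F (Suc l) s) (at s)" "norm (F l s) \<le> D l * \<omega> s"
    "continuous_on S (F l)" "F l \<in> borel_measurable borel" "norm (F l s) \<le> D l" "0 \<le> D l"
proof -
  show d: "(F l has_vector_derivative F (Suc l) s) (at s)" for l s
    using assms by (simp add: weighted_family_def)
  show n: "norm (F l s) \<le> D l * \<omega> s" for l s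
    using assms by (simp add: weighted_family_def)
  show c: "continuous_on S (F l)" for S l
    using d by (intro continuous_at_imp_continuous_on ballI has_vector_derivative_continuous) auto
  show "F l \<in> borel_measurable borel" by (intro borel_measurable_continuous_onI c)
  have "0 \<le> D l * \<omega> s" using n[of l s] norm_ge_zero order.trans by blast
  then show D0: "0 \<le> D l" using \<omega>_pos[of s] by (simp add: zero_le_mult_iff)
  show "norm (F l s) \<le> D l"
    using n[of l s] mult_left_mono[OF \<omega>_le_one D0, of s] by simp
qed

lemma conv_integrable:
  assumes F: "weighted_family F D"
  shows "integrable lborel (\<lambda>v. k v *\<^sub>R F l (s - v))"
proof (rule Bochner_Integration.integrable_bound[OF integrable_mult_right[OF int_k, of "D l"]])
  note [measurable] = weighted_familyD(4)[OF F]
  show "(\<lambda>v. k v *\<^sub>R F l (s - v)) \<in> borel_measurable lborel" by measurable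
  show "AE v in lborel. norm (k v *\<^sub>R F l (s - v)) \<le> norm (D l * k v)"
    using weighted_familyD(5,6)[OF F, of l] nonneg
    by (intro AE_I2) (auto simp: abs_mult mult.commute[of "D l"] intro!: mult_left_mono)
qed

lemma T_eq:
  assumes F: "weighted_family F D"
  shows "T (F l) s = (\<integral>v. k v *\<^sub>R (F l s - F l (s - v)) \<partial>lborel)"
proof -
  have "(\<integral>v. k v *\<^sub>R (F l s - F l (s - v)) \<partial>lborel)
      = (\<integral>v. k v *\<^sub>R F l s \<partial>lborel) - (\<integral>v. k v *\<^sub>R F l (s - v) \<partial>lborel)"
    unfolding scaleR_diff_right
    by (intro Bochner_Integration.integral_diff conv_integrable[OF F] integrable_scaleR_left int_k)
  also have "(\<integral>v. k v *\<^sub>R F l s \<partial>lborel) = F l s"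
    using int_k mass by simp
  finally show ?thesis by (simp add: T_def conv_def)
qed

text \<open>As \<open>k\<close> has mass 1, \<open>T f s\<close> is the mean of
  \<open>f s - f (s - v)\<close>, at most \<open>\<bar>v\<bar>\<close> times a bound for the
  derivative between the two points. Moving that bound to \<open>s\<close> costs
  \<open>(1 + \<bar>v\<bar>)^N\<close>, and the weighted first moment remains.\<close>

lemma T_bound:
  assumes F: "weighted_family F D"
  shows "norm (T (F l) s) \<le> C1 * D (Suc l) * \<omega> s"
proof -
  have pt: "norm (k v *\<^sub>R (F l s - F l (s - v))) \<le> \<bar>v\<bar> * k v * (1 + \<bar>v\<bar>) ^ N * (D (Suc l) * \<omega> s)" for v
  proof -
    have "norm (F l s - F l (s - v)) \<le> (D (Suc l) * (\<omega> s * (1 + \<bar>v\<bar>) ^ N)) * \<bar>s - (s - v)\<bar>"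
    proof (rule vector_increment_bound[OF weighted_familyD(1)[OF F]])
      fix z assume "min (s - v) s \<le> z" "z \<le> max (s - v) s"
      then have "\<bar>z - s\<bar> \<le> \<bar>v\<bar>" by (auto simp: min_def max_def split: if_splits)
      then have "D (Suc l) * \<omega> z \<le> D (Suc l) * (\<omega> s * (1 + \<bar>v\<bar>) ^ N)"
        by (intro mult_left_mono \<omega>_shift weighted_familyD(6)[OF F])
      then show "norm (F (Suc l) z) \<le> D (Suc l) * (\<omega> s * (1 + \<bar>v\<bar>) ^ N)"
        using weighted_familyD(2)[OF F, of "Suc l" z] by linarith
    qed
    from mult_left_mono[OF this nonneg[of v]] show ?thesis
      using nonneg[of v] by (simp add: mult_ac)
  qed
  have i: "integrable lborel (\<lambda>v. \<bar>v\<bar> * k v * (1 + \<bar>v\<bar>) ^ N * (D (Suc l) * \<omega> s))"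
    by (intro integrable_mult_left int1)
  have "norm (T (F l) s) \<le> (\<integral>v. \<bar>v\<bar> * k v * (1 + \<bar>v\<bar>) ^ N * (D (Suc l) * \<omega> s) \<partial>lborel)"
    unfolding T_eq[OF F] by (rule norm_lebesgue_integral_le[OF _ i pt])
      (unfold scaleR_diff_right, intro Bochner_Integration.integrable_diff conv_integrable[OF F] integrable_scaleR_left int_k)
  also have "\<dots> = (\<integral>v. \<bar>v\<bar> * k v * (1 + \<bar>v\<bar>) ^ N \<partial>lborel) * (D (Suc l) * \<omega> s)"
    by (rule integral_mult_left_zero)
  also have "\<dots> \<le> C1 * (D (Suc l) * \<omega> s)"
    using weighted_familyD(6)[OF F] \<omega>_pos[of s] by (intro mult_right_mono moment) auto
  finally show ?thesis by (simp add: mult.assoc)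
qed

text \<open>Second derivatives are bounded, so the Taylor remainder is quadratic uniformly in
  \<open>v\<close> and stays so after integration against the mass 1.\<close>

lemma conv_deriv:
  assumes F: "weighted_family F D"
  shows "(conv (F l) has_vector_derivative conv (F (Suc l)) s) (at s)"
proof -
  let ?M = "D (Suc (Suc l))"
  have M0: "0 \<le> ?M" by (rule weighted_familyD(6)[OF F])
  have taylor: "norm (F l y - F l x - (y - x) *\<^sub>R F (Suc l) x) \<le> ?M * \<bar>y - x\<bar> * \<bar>y - x\<bar>" for x y
  proof -
    have "norm ((F l y - y *\<^sub>R F (Suc l) x) - (F l x - x *\<^sub>R F (Suc l) x)) \<le> (?M * \<bar>y - x\<bar>) * \<bar>y - x\<bar>"
    proof (rule vector_increment_bound[where f' = "\<lambda>z. F (Suc l) z - F (Suc l) x"])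
      fix z :: real
      show "((\<lambda>y. F l y - y *\<^sub>R F (Suc l) x) has_vector_derivative F (Suc l) z - F (Suc l) x) (at z)"
        by (auto intro!: derivative_eq_intros weighted_familyD(1)[OF F])
      assume z: "min x y \<le> z" "z \<le> max x y"
      have "norm (F (Suc l) z - F (Suc l) x) \<le> ?M * \<bar>z - x\<bar>"
        by (rule vector_increment_bound[OF weighted_familyD(1)[OF F] weighted_familyD(5)[OF F]])
      also have "\<dots> \<le> ?M * \<bar>y - x\<bar>" using z by (intro mult_left_mono M0) (auto simp: min_def max_def split: if_splits)
      finally show "norm (F (Suc l) z - F (Suc l) x) \<le> ?M * \<bar>y - x\<bar>" .
    qed
    then show ?thesis by (simp add: algebra_simps)
  qed
  have rem: "norm (conv (F l) y - conv (F l) s - (y - s) *\<^sub>R conv (F (Suc l)) s) \<le> ?M * \<bar>y - s\<bar> * \<bar>y - s\<bar>" for y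
  proof -
    have i: "integrable lborel (\<lambda>v. k v *\<^sub>R F l (y - v) - k v *\<^sub>R F l (s - v) - (y - s) *\<^sub>R (k v *\<^sub>R F (Suc l) (s - v)))"
      by (intro Bochner_Integration.integrable_diff integrable_scaleR_right conv_integrable[OF F])
    have eq: "conv (F l) y - conv (F l) s - (y - s) *\<^sub>R conv (F (Suc l)) s
        = (\<integral>v. k v *\<^sub>R F l (y - v) - k v *\<^sub>R F l (s - v) - (y - s) *\<^sub>R (k v *\<^sub>R F (Suc l) (s - v)) \<partial>lborel)"
    proof -
      have "(\<integral>v. (y - s) *\<^sub>R (k v *\<^sub>R F (Suc l) (s - v)) \<partial>lborel) = (y - s) *\<^sub>R conv (F (Suc l)) s"
        unfolding conv_def by (intro integral_scaleR_right)
      then show ?thesis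
        unfolding conv_def[of "F l"]
        by (subst Bochner_Integration.integral_diff,
            (intro Bochner_Integration.integrable_diff integrable_scaleR_right conv_integrable[OF F])+,
            subst Bochner_Integration.integral_diff)
           (simp_all only: conv_integrable[OF F])
    qed
    have "norm (\<integral>v. k v *\<^sub>R F l (y - v) - k v *\<^sub>R F l (s - v) - (y - s) *\<^sub>R (k v *\<^sub>R F (Suc l) (s - v)) \<partial>lborel)
        \<le> (\<integral>v. k v * (?M * \<bar>y - s\<bar> * \<bar>y - s\<bar>) \<partial>lborel)"
    proof (rule norm_lebesgue_integral_le[OF i])
      fix v
      have "k v *\<^sub>R F l (y - v) - k v *\<^sub>R F l (s - v) - (y - s) *\<^sub>R (k v *\<^sub>R F (Suc l) (s - v))
          = k v *\<^sub>R (F l (y - v) - F l (s - v) - ((y - v) - (s - v)) *\<^sub>R F (Suc l) (s - v))"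
        by (simp add: algebra_simps)
      also have "norm \<dots> \<le> k v * (?M * \<bar>(y - v) - (s - v)\<bar> * \<bar>(y - v) - (s - v)\<bar>)"
        using mult_left_mono[OF taylor[of "y - v" "s - v"] nonneg[of v]] nonneg[of v] by simp
      finally show "norm (k v *\<^sub>R F l (y - v) - k v *\<^sub>R F l (s - v) - (y - s) *\<^sub>R (k v *\<^sub>R F (Suc l) (s - v)))
        \<le> k v * (?M * \<bar>y - s\<bar> * \<bar>y - s\<bar>)" by simp
    qed (intro integrable_mult_left int_k)
    also have "\<dots> = ?M * \<bar>y - s\<bar> * \<bar>y - s\<bar>" by (simp only: integral_mult_left_zero mass mult_1_left)
    finally show ?thesis unfolding eq .
  qed
  show ?thesis
    unfolding has_vector_derivative_def has_derivative_at_alt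
  proof (intro conjI allI impI)
    show "bounded_linear (\<lambda>x. x *\<^sub>R conv (F (Suc l)) s)" by (rule bounded_linear_scaleR_left)
    fix \<epsilon> :: real assume \<epsilon>: "\<epsilon> > 0"
    show "\<exists>d>0. \<forall>y. norm (y - s) < d \<longrightarrow>
      norm (conv (F l) y - conv (F l) s - (y - s) *\<^sub>R conv (F (Suc l)) s) \<le> \<epsilon> * norm (y - s)"
    proof (intro exI[of _ "\<epsilon> / (?M + 1)"] conjI allI impI)
      show "0 < \<epsilon> / (?M + 1)" using \<epsilon> M0 by simp
      fix y assume "norm (y - s) < \<epsilon> / (?M + 1)"
      then have "(?M + 1) * \<bar>y - s\<bar> < \<epsilon>" using M0 by (simp add: pos_less_divide_eq mult.commute)
      then have "?M * \<bar>y - s\<bar> \<le> \<epsilon>" by (simp add: distrib_right)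
      then have "?M * \<bar>y - s\<bar> * \<bar>y - s\<bar> \<le> \<epsilon> * \<bar>y - s\<bar>" by (intro mult_right_mono) auto
      then show "norm (conv (F l) y - conv (F l) s - (y - s) *\<^sub>R conv (F (Suc l)) s) \<le> \<epsilon> * norm (y - s)"
        using rem[of y] by simp
    qed
  qed
qed

lemma T_family:
  assumes F: "weighted_family F D"
  shows "weighted_family (\<lambda>l. T (F l)) (\<lambda>l. C1 * D (Suc l))"
  unfolding weighted_family_def
  using T_bound[OF F]
  by (auto simp: T_def[abs_def] intro!: has_vector_derivative_diff weighted_familyD(1)[OF F] conv_deriv[OF F])

text \<open>Each application of \<open>T\<close> trades one derivative for a factor
  \<open>C1\<close>; for the kernels above, where this factor is of order \<open>1 / B\<close>, it
  gives approximation of arbitrary order.\<close>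

lemma T_iterate_family:
  assumes F: "weighted_family F D"
  shows "weighted_family (\<lambda>l. (T ^^ i) (F l)) (\<lambda>l. C1 ^ i * D (l + i))"
proof (induction i)
  case (Suc i)
  from T_family[OF this] show ?case by (simp add: mult.assoc)
qed (use F in simp)

lemma conv_even:
  assumes "\<And>s. f (- s) = f s"
  shows "conv f (- s) = conv f s"
proof -
  have "conv f (- s) = (\<integral>v. k v *\<^sub>R f (- s - v) \<partial>lborel)" by (simp add: conv_def)
  also have "\<dots> = (\<integral>v. k (- v) *\<^sub>R f (- s - - v) \<partial>lborel)"
    using lborel_integral_real_affine[of "-1" "\<lambda>v. k v *\<^sub>R f (- s - v)" 0] by simp
  also have "\<dots> = (\<integral>v. k v *\<^sub>R f (- (s - v)) \<partial>lborel)"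
    by (simp add: even)
  finally show ?thesis unfolding assms by (simp add: conv_def)
qed

lemma T_iterate_even:
  assumes "\<And>s. f (- s) = f s"
  shows "(T ^^ i) f (- s) = (T ^^ i) f s"
  by (induction i arbitrary: s) (simp_all add: assms T_def conv_even)

lemma weighted_integrable:
  assumes F: "weighted_family F D"
  shows "integrable lborel (F l)"
proof (rule Bochner_Integration.integrable_bound[OF integrable_mult_right[OF integrable_inverse_1_plus_square', of "D l * 1"]])
  show "F l \<in> borel_measurable lborel" using weighted_familyD(4)[OF F] by simp
  show "AE s in lborel. norm (F l s) \<le> norm (D l * 1 * (1 / (1 + s\<^sup>2)))"
  proof (rule AE_I2)
    fix s :: real
    have "1 + s\<^sup>2 \<le> (1 + \<bar>s\<bar>)\<^sup>2" by (simp add: power2_eq_square algebra_simps)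
    also have "\<dots> \<le> (1 + \<bar>s\<bar>) ^ N" using N by (intro power_increasing) auto
    finally have "\<omega> s \<le> 1 / (1 + s\<^sup>2)"
      unfolding \<omega>_def by (intro divide_left_mono mult_pos_pos) (auto simp: add_pos_nonneg)
    then have "D l * \<omega> s \<le> D l * (1 / (1 + s\<^sup>2))" by (intro mult_left_mono weighted_familyD(6)[OF F])
    moreover have "0 \<le> D l * (1 / (1 + s\<^sup>2))"
      using weighted_familyD(6)[OF F, of l] by (intro mult_nonneg_nonneg) (auto simp: add_nonneg_nonneg)
    ultimately show "norm (F l s) \<le> norm (D l * 1 * (1 / (1 + s\<^sup>2)))"
      using weighted_familyD(2)[OF F, of l s] weighted_familyD(6)[OF F, of l] by simp
  qed
qed

lemma conv_bandlimited:
  assumes F: "weighted_family F D"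
  shows "bandlimited R (Ck * (\<integral>v. norm (F l v) \<partial>lborel)) (conv (F l))"
proof -
  have eq: "conv (F l) s = (\<integral>v. F l v * of_real (k (s - v)) \<partial>lborel)" for s
  proof -
    have "conv (F l) s = (\<integral>v. k (s - v) *\<^sub>R F l (s - (s - v)) \<partial>lborel)"
      unfolding conv_def using lborel_integral_real_affine[of "-1" "\<lambda>v. k v *\<^sub>R F l (s - v)" s] by simp
    then show ?thesis by (simp add: scaleR_conv_of_real mult.commute)
  qed
  have int: "integrable lborel (\<lambda>v. F l v * of_real (k (s - v)))" for s
    using lborel_integrable_real_affine[OF conv_integrable[OF F, of l s], of "-1" s]
    by (simp add: scaleR_conv_of_real mult.commute)
  show ?thesis
    unfolding eq[abs_def] by (rule bandlimited_convolution[OF band int weighted_integrable[OF F]])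
qed

text \<open>Telescoping: \<open>f - T^K f\<close> is the sum of \<open>conv (T^i f)\<close> over
  \<open>i < K\<close>. Every summand is a convolution with \<open>k\<close>, so the band is
  \<open>R\<close> whatever \<open>K\<close> is; evenness survives because \<open>k\<close> is
  even.\<close>

lemma approximation:
  assumes F: "weighted_family F D" and even: "\<And>s. F 0 (- s) = F 0 s"
  shows "\<exists>g Cg C. (\<forall>s. g (- s) = g s) \<and> bandlimited R Cg g \<and> (\<forall>s. norm (g s) \<le> C * \<omega> s) \<and>
    (\<forall>s. norm (F 0 s - g s) \<le> C1 ^ K * D K * \<omega> s)"
proof -
  define g where "g K s = (\<Sum>i<K. conv ((T ^^ i) (F 0)) s)" for K s
  have g: "F 0 s - g K s = (T ^^ K) (F 0) s" for K s
  proof (induction K)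
    case (Suc K)
    have "F 0 s - g (Suc K) s = (F 0 s - g K s) - conv ((T ^^ K) (F 0)) s"
      by (simp add: g_def)
    also have "\<dots> = T ((T ^^ K) (F 0)) s" unfolding Suc.IH by (rule T_def[symmetric])
    finally show ?case by simp
  qed (simp add: g_def)
  have ev: "g K (- s) = g K s" for s
    unfolding g_def by (intro sum.cong refl conv_even T_iterate_even even)
  have bl: "\<exists>Cg. bandlimited R Cg (g K)" for K
  proof (induction K)
    case 0
    then show ?case using bandlimited_zero[of R] by (auto simp: g_def[abs_def])
  next
    case (Suc K)
    then obtain Cg where "bandlimited R Cg (g K)" by blast
    from bandlimited_add[OF this conv_bandlimited[OF T_iterate_family[OF F], of K 0]]
    show ?case by (auto simp: g_def[abs_def])
  qed
  then obtain Cg where Cg: "bandlimited R Cg (g K)" by blast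
  have err: "norm (F 0 s - g K s) \<le> C1 ^ K * D K * \<omega> s" for s
    using weighted_familyD(2)[OF T_iterate_family[OF F], of K 0 s] by (simp add: g)
  have "norm (g K s) \<le> (D 0 + C1 ^ K * D K) * \<omega> s" for s
  proof -
    have "norm (g K s) \<le> norm (F 0 s) + norm (F 0 s - g K s)"
      using norm_triangle_ineq4[of "F 0 s" "F 0 s - g K s"] by simp
    then show ?thesis using weighted_familyD(2)[OF F, of 0 s] err[of s] by (simp add: distrib_right)
  qed
  then show ?thesis using ev Cg err by blast
qed

end

subsection \<open>Vanishing of bandlimited kernels\<close>

context jacobi_system
begin

text \<open>Averages are taken to the right of \<open>\<theta>\<close>, so that
  \<open>\<theta> = 0\<close> is included; the denominators are positive although \<open>w\<close>
  may vanish at the endpoints.\<close>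

lemma average_tendsto:
  assumes f: "continuous_on {0..pi} f" and \<theta>: "0 \<le> \<theta>" "0 < \<eta>" "\<theta> + \<eta> \<le> pi"
  shows "(\<lambda>j. integral {\<theta>..\<theta> + \<eta> / real (Suc j)} (\<lambda>x. w x * f x) / integral {\<theta>..\<theta> + \<eta> / real (Suc j)} w) \<longlonglongrightarrow> f \<theta>"
proof (rule LIMSEQ_I)
  fix r :: real assume r: "r > 0"
  have "\<theta> \<in> {0..pi}" using \<theta> by auto
  then obtain d where d: "d > 0" "\<And>x. x \<in> {0..pi} \<Longrightarrow> dist x \<theta> < d \<Longrightarrow> dist (f x) (f \<theta>) < r / 2"
    using f r unfolding continuous_on_iff by (metis half_gt_zero)
  obtain J where J: "\<eta> / d < real J" using reals_Archimedean2 by blast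
  show "\<exists>J. \<forall>j\<ge>J. norm (integral {\<theta>..\<theta> + \<eta> / real (Suc j)} (\<lambda>x. w x * f x) / integral {\<theta>..\<theta> + \<eta> / real (Suc j)} w - f \<theta>) < r"
  proof (intro exI[of _ J] allI impI)
    fix j assume "j \<ge> J"
    then have "\<eta> / d < real (Suc j)" using J by (meson less_le_trans of_nat_le_iff le_SucI)
    define \<theta>2 where "\<theta>2 = \<theta> + \<eta> / real (Suc j)"
    have "\<eta> / real (Suc j) < d"
      using \<open>\<eta> / d < real (Suc j)\<close> d(1) by (simp add: divide_less_eq mult.commute)
    moreover have "\<eta> / real (Suc j) \<le> \<eta>"
      using \<theta> by (simp add: divide_le_eq_1_pos divide_le_eq)
    ultimately have \<theta>2: "\<theta> < \<theta>2" "\<theta>2 \<le> pi" "\<theta>2 - \<theta> < d" using \<theta> by (auto simp: \<theta>2_def)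
    have cf: "continuous_on {\<theta>..\<theta>2} f" using \<theta> \<theta>2 by (intro continuous_on_subset[OF f]) auto
    have W: "integral {\<theta>..\<theta>2} w > 0" using \<theta> \<theta>2 by (intro w_integral_pos) auto
    have "integral {\<theta>..\<theta>2} (\<lambda>x. w x * f x) - integral {\<theta>..\<theta>2} w * f \<theta>
        = integral {\<theta>..\<theta>2} (\<lambda>x. w x * f x) - integral {\<theta>..\<theta>2} (\<lambda>x. w x * f \<theta>)"
      by simp
    also have "\<dots> = integral {\<theta>..\<theta>2} (\<lambda>x. w x * f x - w x * f \<theta>)"
      by (intro integral_diff[symmetric] integrable_continuous_real continuous_intros cf)
    finally have eq: "integral {\<theta>..\<theta>2} (\<lambda>x. w x * f x) - integral {\<theta>..\<theta>2} w * f \<theta>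
      = integral {\<theta>..\<theta>2} (\<lambda>x. w x * f x - w x * f \<theta>)" .
    have "norm (integral {\<theta>..\<theta>2} (\<lambda>x. w x * f x - w x * f \<theta>)) \<le> integral {\<theta>..\<theta>2} (\<lambda>x. w x * (r / 2))"
    proof (rule integral_norm_bound_integral)
      fix x assume x: "x \<in> {\<theta>..\<theta>2}"
      then have "\<bar>f x - f \<theta>\<bar> \<le> r / 2"
        using d(2)[of x] \<theta> \<theta>2 by (auto simp: dist_real_def)
      then have "w x * \<bar>f x - f \<theta>\<bar> \<le> w x * (r / 2)" by (intro mult_left_mono) auto
      then show "norm (w x * f x - w x * f \<theta>) \<le> w x * (r / 2)"
        by (simp add: abs_mult flip: right_diff_distrib)
    qed (intro integrable_continuous_real continuous_intros cf)+
    also have "\<dots> = integral {\<theta>..\<theta>2} w * (r / 2)" by (rule integral_mult_left)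
    finally have b: "\<bar>integral {\<theta>..\<theta>2} (\<lambda>x. w x * f x) - integral {\<theta>..\<theta>2} w * f \<theta>\<bar> \<le> integral {\<theta>..\<theta>2} w * (r / 2)"
      unfolding eq by simp
    have "integral {\<theta>..\<theta>2} (\<lambda>x. w x * f x) / integral {\<theta>..\<theta>2} w - f \<theta>
        = (integral {\<theta>..\<theta>2} (\<lambda>x. w x * f x) - integral {\<theta>..\<theta>2} w * f \<theta>) / integral {\<theta>..\<theta>2} w"
      using W by (simp add: diff_divide_distrib)
    then have "norm (integral {\<theta>..\<theta>2} (\<lambda>x. w x * f x) / integral {\<theta>..\<theta>2} w - f \<theta>) \<le> r / 2"
      using b W by (simp add: abs_divide pos_divide_le_eq mult.commute)
    then show "norm (integral {\<theta>..\<theta> + \<eta> / real (Suc j)} (\<lambda>x. w x * f x) / integral {\<theta>..\<theta> + \<eta> / real (Suc j)} w - f \<theta>) < r"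
      using r unfolding \<theta>2_def by linarith
  qed
qed

context
  fixes g :: "real \<Rightarrow> complex" and R C :: real and Bk :: "nat \<Rightarrow> real"
  assumes g: "bandlimited R C g" "\<And>u. g (- u) = g u" and R: "R \<ge> 0"
    and Bk: "\<And>k \<theta>. \<theta> \<in> {0..pi} \<Longrightarrow> \<bar>e k \<theta>\<bar> \<le> Bk k"
    and summ: "summable (\<lambda>k. norm (g (\<mu> k)) * (Bk k)\<^sup>2)"
begin

lemma Bk_nonneg: "0 \<le> Bk k"
  using Bk[of 0 k] by auto

lemma weighted_mean_bound:
  assumes "0 \<le> \<theta>1" "\<theta>1 \<le> \<theta>2" "\<theta>2 \<le> pi" "continuous_on {\<theta>1..\<theta>2} D" "\<And>x. x \<in> {\<theta>1..\<theta>2} \<Longrightarrow> 0 \<le> D x"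
  shows "\<bar>integral {\<theta>1..\<theta>2} (\<lambda>\<theta>. w \<theta> * D \<theta> * e k \<theta>)\<bar> \<le> integral {\<theta>1..\<theta>2} (\<lambda>\<theta>. w \<theta> * D \<theta>) * Bk k"
proof -
  have "norm (integral {\<theta>1..\<theta>2} (\<lambda>\<theta>. w \<theta> * D \<theta> * e k \<theta>)) \<le> integral {\<theta>1..\<theta>2} (\<lambda>\<theta>. w \<theta> * D \<theta> * Bk k)"
  proof (rule integral_norm_bound_integral)
    fix x assume x: "x \<in> {\<theta>1..\<theta>2}"
    then have "w x * D x * \<bar>e k x\<bar> \<le> w x * D x * Bk k"
      using assms by (intro mult_left_mono Bk mult_nonneg_nonneg) auto
    then show "norm (w x * D x * e k x) \<le> w x * D x * Bk k"
      using assms(5)[OF x] by (simp add: abs_mult)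
  qed (intro integrable_continuous_real continuous_intros assms)+
  then show ?thesis by simp
qed

text \<open>A wave that starts from the approximate point mass at \<open>\<phi>\<close> cannot reach
  \<open>[\<theta>1, \<theta>2]\<close> within time \<open>R\<close>, except for the small part of
  the datum on \<open>[0, s]\<close>. Duality and evenness turn this into smallness of the sum with
  weights \<open>g (\<mu> k)\<close>, which therefore tends to 0. The majorants \<open>Bk\<close>
  allow the limit to be taken inside the series.\<close>

lemma interval_kernel_vanish:
  assumes \<theta>: "0 \<le> \<theta>1" "\<theta>1 \<le> \<theta>2" "\<theta>2 + R < \<phi>" "\<phi> \<le> pi"
  defines "\<xi> \<equiv> \<lambda>k. integral {\<theta>1..\<theta>2} (\<lambda>\<theta>. w \<theta> * e k \<theta>)"
  shows "(\<Sum>k. g (\<mu> k) * of_real (\<xi> k * e k \<phi>)) = 0" and "summable (\<lambda>k. g (\<mu> k) * of_real (\<xi> k * e k \<phi>))"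
    and "\<bar>\<xi> k\<bar> \<le> integral {\<theta>1..\<theta>2} w * Bk k"
proof -
  define c where "c m k = integral {0..pi} (\<lambda>\<theta>. w \<theta> * delta \<phi> m \<theta> * e k \<theta>)" for m k
  define \<Omega> where "\<Omega> = integral {0..pi} w"
  have \<phi>: "0 < \<phi>" "\<phi> \<le> pi" using \<theta> R by auto
  have \<Omega>: "\<Omega> > 0" unfolding \<Omega>_def by (intro w_integral_pos) auto
  have \<xi>_bound: "\<bar>\<xi> k\<bar> \<le> integral {\<theta>1..\<theta>2} w * Bk k" for k
    using weighted_mean_bound[of \<theta>1 \<theta>2 "\<lambda>_. 1" k] \<theta> R \<phi> by (simp add: \<xi>_def)
  then show "\<bar>\<xi> k\<bar> \<le> integral {\<theta>1..\<theta>2} w * Bk k" .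
  have "integral {\<theta>1..\<theta>2} w \<le> \<Omega>"
    unfolding \<Omega>_def using \<theta> R by (intro integral_subset_le integrable_continuous_real continuous_w) auto
  then have \<xi>\<Omega>: "\<bar>\<xi> k\<bar> \<le> \<Omega> * Bk k" for k
    using \<xi>_bound[of k] mult_right_mono[OF _ Bk_nonneg[of k]] by (meson order.trans)
  have c_bound: "\<bar>c m k\<bar> \<le> Bk k" for m k
    using weighted_mean_bound[of 0 pi "delta \<phi> m" k] delta_nonneg[OF \<phi>] continuous_delta
    by (simp add: c_def integral_delta[OF \<phi>])
  have c_lim: "(\<lambda>m. c m k) \<longlonglongrightarrow> e k \<phi>" for k
    unfolding c_def by (rule delta_approx[OF \<phi> continuous_e])
  define M where "M k = norm (g (\<mu> k)) * (Bk k)\<^sup>2 * \<Omega>" for k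
  have M: "summable M" unfolding M_def by (intro summable_mult2 summ)
  have dom: "norm (g (\<mu> k) * of_real (\<xi> k * x)) \<le> M k" if "\<bar>x\<bar> \<le> Bk k" for k x
  proof -
    have "\<bar>\<xi> k\<bar> * \<bar>x\<bar> \<le> (\<Omega> * Bk k) * Bk k"
      using \<xi>\<Omega>[of k] that \<Omega> Bk_nonneg[of k] by (intro mult_mono) auto
    then have "norm (g (\<mu> k)) * (\<bar>\<xi> k\<bar> * \<bar>x\<bar>) \<le> norm (g (\<mu> k)) * ((\<Omega> * Bk k) * Bk k)"
      by (intro mult_left_mono) auto
    then show ?thesis by (simp add: norm_mult M_def power2_eq_square mult_ac)
  qed
  show summable: "summable (\<lambda>k. g (\<mu> k) * of_real (\<xi> k * e k \<phi>))"
    using \<phi> by (intro summable_comparison_test'[OF M, of 0] dom Bk) auto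
  have "((\<lambda>m. \<Sum>k. g (\<mu> k) * of_real (\<xi> k * c m k)) \<longlongrightarrow> (\<Sum>k. g (\<mu> k) * of_real (\<xi> k * e k \<phi>))) sequentially"
  proof (rule tannerys_theorem[THEN conjunct2, THEN conjunct2, OF _ _ M])
    show "((\<lambda>m. g (\<mu> k) * of_real (\<xi> k * c m k)) \<longlongrightarrow> g (\<mu> k) * of_real (\<xi> k * e k \<phi>)) sequentially" for k
      by (intro tendsto_intros c_lim)
    show "\<forall>\<^sub>F (k, m) in sequentially \<times>\<^sub>F sequentially. norm (g (\<mu> k) * of_real (\<xi> k * c m k)) \<le> M k"
      using dom[OF c_bound] by (intro always_eventually) auto
  qed simp
  moreover have "(\<lambda>m. \<Sum>k. g (\<mu> k) * of_real (\<xi> k * c m k)) \<longlonglongrightarrow> 0"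
  proof (rule LIMSEQ_I)
    fix r :: real assume r: "r > 0"
    define \<epsilon> where "\<epsilon> = r / ((\<bar>C\<bar> + 1) * (\<Omega> + 1))"
    have \<epsilon>: "\<epsilon> > 0" using r \<Omega> by (simp add: \<epsilon>_def)
    have C\<epsilon>: "C * (\<epsilon> * (\<Omega> + 1)) < r"
    proof -
      have eq: "\<epsilon> * (\<Omega> + 1) = r / (\<bar>C\<bar> + 1)" using \<Omega> by (simp add: \<epsilon>_def)
      have "C * (\<epsilon> * (\<Omega> + 1)) \<le> \<bar>C\<bar> * (r / (\<bar>C\<bar> + 1))"
        unfolding eq using r by (intro mult_right_mono) auto
      also have "\<dots> < (\<bar>C\<bar> + 1) * (r / (\<bar>C\<bar> + 1))" using r by (intro mult_strict_right_mono) auto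
      also have "\<dots> = r" by simp
      finally show ?thesis .
    qed
    \<comment> \<open>Strictly between \<open>\<theta>2 + R\<close> and \<open>\<phi>\<close>:
      \<open>[0, s]\<close> stays away from the peak, and waves from beyond \<open>s\<close> do not
      reach \<open>\<theta>2\<close> in time \<open>R\<close>.\<close>
    define s where "s = ((\<theta>2 + R) + \<phi>) / 2"
    have s: "\<theta>2 \<le> s - R" "R < s" "s < \<phi>" "s < pi" using \<theta> by (auto simp: s_def field_simps)
    obtain u where u: "u \<longlonglongrightarrow> 0" "\<And>m \<theta>. \<theta> \<in> {0..pi} \<Longrightarrow> \<bar>\<theta> - \<phi>\<bar> \<ge> \<phi> - s \<Longrightarrow> delta \<phi> m \<theta> \<le> u m"
      using delta_concentrates[OF \<phi>, of "\<phi> - s"] s by auto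
    have "(\<lambda>m. \<Omega> * (u m)\<^sup>2) \<longlonglongrightarrow> \<Omega> * 0\<^sup>2" by (intro tendsto_intros u)
    then have "eventually (\<lambda>m. \<Omega> * (u m)\<^sup>2 < \<epsilon>\<^sup>2) sequentially"
      using \<epsilon> by (intro order_tendstoD) auto
    then obtain m0 where m0: "\<And>m. m \<ge> m0 \<Longrightarrow> \<Omega> * (u m)\<^sup>2 < \<epsilon>\<^sup>2" unfolding eventually_sequentially by blast
    show "\<exists>m0. \<forall>m\<ge>m0. norm ((\<Sum>k. g (\<mu> k) * of_real (\<xi> k * c m k)) - 0) < r"
    proof (intro exI[of _ m0] allI impI)
      fix m assume m: "m \<ge> m0"
      note exp = delta_expansion[OF \<phi>, of m, folded c_def]
      have "integral {0..s} (\<lambda>\<theta>. w \<theta> * (\<Sum>k<2*m+1. c m k * e k \<theta>)\<^sup>2) \<le> integral {0..s} (\<lambda>\<theta>. w \<theta> * (u m)\<^sup>2)"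
        unfolding exp(1)[symmetric]
      proof (intro integral_le integrable_continuous_real continuous_intros mult_left_mono power_mono w_nonneg)
        fix x assume "x \<in> {0..s}"
        then show "delta \<phi> m x \<le> u m" using s by (intro u(2)) auto
      qed (rule delta_nonneg[OF \<phi>])
      also have "\<dots> = integral {0..s} w * (u m)\<^sup>2" by (rule integral_mult_left)
      also have "\<dots> \<le> \<Omega> * (u m)\<^sup>2"
        unfolding \<Omega>_def using s
        by (intro mult_right_mono integral_subset_le integrable_continuous_real continuous_w) auto
      finally have small: "integral {0..s} (\<lambda>\<theta>. w \<theta> * (\<Sum>k<2*m+1. c m k * e k \<theta>)\<^sup>2) \<le> \<epsilon>\<^sup>2"
        using m0[OF m] by linarith
      have "(\<Sum>k. g (\<mu> k) * of_real (\<xi> k * c m k)) = (\<Sum>k<2*m+1. g (\<mu> k) * of_real (\<xi> k * c m k))"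
        by (intro suminf_finite) (auto simp: exp(2))
      also have "\<dots> = (\<Sum>k<2*m+1. of_real (c m k * \<xi> k) * g (\<mu> k))" by (simp only: mult_ac)
      finally have eq: "(\<Sum>k. g (\<mu> k) * of_real (\<xi> k * c m k)) = (\<Sum>k<2*m+1. of_real (c m k * \<xi> k) * g (\<mu> k))" .
      have "norm (\<Sum>k<2*m+1. of_real (c m k * \<xi> k) * g (\<mu> k)) \<le> C * (\<epsilon> * (\<Omega> + 1))"
      proof (rule bandlimited_even[OF g])
        fix t assume t: "\<bar>t\<bar> \<le> R"
        have "norm (\<Sum>k<2*m+1. complex_of_real (c m k * \<xi> k) * of_real (cos (t * \<mu> k)))
            = \<bar>\<Sum>k<2*m+1. c m k * \<xi> k * cos (t * \<mu> k)\<bar>"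
          unfolding of_real_mult[symmetric] of_real_sum[symmetric] norm_of_real ..
        also have "\<dots> \<le> \<epsilon> * (\<Omega> + 1)"
          unfolding \<xi>_def \<Omega>_def by (rule wave_test_bound[OF \<theta>(1,2) s(1,2,4) t \<epsilon> small])
        finally show "norm (\<Sum>k<2*m+1. complex_of_real (c m k * \<xi> k) * of_real (cos (t * \<mu> k))) \<le> \<epsilon> * (\<Omega> + 1)" .
      qed
      then show "norm ((\<Sum>k. g (\<mu> k) * of_real (\<xi> k * c m k)) - 0) < r"
        unfolding eq using C\<epsilon> by simp
    qed
  qed
  ultimately show "(\<Sum>k. g (\<mu> k) * of_real (\<xi> k * e k \<phi>)) = 0" by (rule LIMSEQ_unique)
qed

text \<open>The interval shrinks to its left endpoint. The averages of \<open>e k\<close> obey the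
  same bound \<open>Bk k\<close> as \<open>e k\<close>, so the limit passes through the
  series.\<close>

lemma kernel_vanish:
  assumes \<theta>: "0 \<le> \<theta>" "\<theta> + R < \<phi>" "\<phi> \<le> pi"
  shows "(\<Sum>k. g (\<mu> k) * of_real (e k \<theta> * e k \<phi>)) = 0"
proof -
  \<comment> \<open>Half of the gap, so that every interval \<open>[\<theta>, \<theta>2 j]\<close>
    is still farther than \<open>R\<close> from \<open>\<phi>\<close>.\<close>
  define \<eta> where "\<eta> = (\<phi> - R - \<theta>) / 2"
  define \<theta>2 where "\<theta>2 j = \<theta> + \<eta> / real (Suc j)" for j
  have \<eta>: "\<eta> > 0" using \<theta> by (simp add: \<eta>_def)
  have \<theta>2: "\<theta> < \<theta>2 j" "\<theta>2 j + R < \<phi>" "\<theta>2 j \<le> pi" for j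
  proof -
    have "\<eta> / real (Suc j) \<le> \<eta>" using \<eta> by (simp add: divide_le_eq)
    then have "\<theta>2 j \<le> \<theta> + \<eta>" by (simp add: \<theta>2_def)
    moreover have "\<theta> + \<eta> + R < \<phi>" using \<theta> by (simp add: \<eta>_def field_simps)
    ultimately show "\<theta>2 j + R < \<phi>" by linarith
    then show "\<theta>2 j \<le> pi" using R \<theta> by linarith
    show "\<theta> < \<theta>2 j" using \<eta> by (simp add: \<theta>2_def)
  qed
  define \<Omega> where "\<Omega> j = integral {\<theta>..\<theta>2 j} w" for j
  define \<xi> where "\<xi> j k = integral {\<theta>..\<theta>2 j} (\<lambda>\<theta>. w \<theta> * e k \<theta>)" for j k
  have \<Omega>: "\<Omega> j > 0" for j unfolding \<Omega>_def using \<theta> \<theta>2[of j] by (intro w_integral_pos) auto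
  note V = interval_kernel_vanish[OF \<theta>(1) less_imp_le[OF \<theta>2(1)] \<theta>2(2) \<theta>(3), folded \<xi>_def \<Omega>_def]
  have zero: "(\<Sum>k. g (\<mu> k) * of_real (\<xi> j k / \<Omega> j * e k \<phi>)) = 0" for j
  proof -
    have "(\<Sum>k. g (\<mu> k) * of_real (\<xi> j k / \<Omega> j * e k \<phi>)) = (\<Sum>k. g (\<mu> k) * of_real (\<xi> j k * e k \<phi>) * of_real (1 / \<Omega> j))"
      by (simp add: mult_ac)
    also have "\<dots> = (\<Sum>k. g (\<mu> k) * of_real (\<xi> j k * e k \<phi>)) * of_real (1 / \<Omega> j)"
      by (rule suminf_mult2[symmetric, OF V(2)])
    finally show ?thesis unfolding V(1) by simp
  qed
  have "((\<lambda>j. \<Sum>k. g (\<mu> k) * of_real (\<xi> j k / \<Omega> j * e k \<phi>)) \<longlongrightarrow> (\<Sum>k. g (\<mu> k) * of_real (e k \<theta> * e k \<phi>))) sequentially"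
  proof (rule tannerys_theorem[THEN conjunct2, THEN conjunct2, OF _ _ summ])
    fix k
    have "(\<lambda>j. \<xi> j k / \<Omega> j) \<longlonglongrightarrow> e k \<theta>"
      unfolding \<xi>_def \<Omega>_def \<theta>2_def
      using \<theta> \<eta> R by (intro average_tendsto continuous_e) (auto simp: \<eta>_def field_simps)
    then show "((\<lambda>j. g (\<mu> k) * of_real (\<xi> j k / \<Omega> j * e k \<phi>)) \<longlongrightarrow> g (\<mu> k) * of_real (e k \<theta> * e k \<phi>)) sequentially"
      by (intro tendsto_intros)
  next
    have "norm (g (\<mu> k) * of_real (\<xi> j k / \<Omega> j * e k \<phi>)) \<le> norm (g (\<mu> k)) * (Bk k)\<^sup>2" for k j
    proof -
      have "\<bar>\<xi> j k / \<Omega> j\<bar> \<le> Bk k"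
        using V(3)[of j k] \<Omega>[of j] by (simp add: abs_divide pos_divide_le_eq mult.commute)
      then have "\<bar>\<xi> j k / \<Omega> j\<bar> * \<bar>e k \<phi>\<bar> \<le> Bk k * Bk k"
        using Bk[of \<phi> k] \<theta> R Bk_nonneg[of k] by (intro mult_mono) auto
      then have "norm (g (\<mu> k)) * (\<bar>\<xi> j k / \<Omega> j\<bar> * \<bar>e k \<phi>\<bar>) \<le> norm (g (\<mu> k)) * (Bk k * Bk k)"
        by (intro mult_left_mono) auto
      moreover have "norm (g (\<mu> k) * of_real (\<xi> j k / \<Omega> j * e k \<phi>)) = norm (g (\<mu> k)) * (\<bar>\<xi> j k / \<Omega> j\<bar> * \<bar>e k \<phi>\<bar>)"
        unfolding norm_mult norm_of_real abs_mult ..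
      ultimately show ?thesis by (simp only: power2_eq_square)
    qed
    then show "\<forall>\<^sub>F (k, j) in sequentially \<times>\<^sub>F sequentially. norm (g (\<mu> k) * of_real (\<xi> j k / \<Omega> j * e k \<phi>)) \<le> norm (g (\<mu> k)) * (Bk k)\<^sup>2"
      by (intro always_eventually) auto
  qed simp
  then show ?thesis unfolding zero by (simp add: LIMSEQ_const_iff)
qed

end

end

subsection \<open>Localization in one variable\<close>

text \<open>\<open>G l\<close> plays the role of the \<open>l\<close>-th derivative of a restriction of the cutoff function to one coordinate.\<close>

definition profile :: "real \<Rightarrow> real \<Rightarrow> (real \<Rightarrow> real) \<Rightarrow> (nat \<Rightarrow> real \<Rightarrow> complex) \<Rightarrow> bool" where
  "profile \<gamma> \<delta> L G \<longleftrightarrow>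
     (\<forall>l. \<forall>\<tau>\<ge>0. (G l has_vector_derivative G (Suc l) \<tau>) (at \<tau> within {0..})) \<and>
     (\<forall>\<tau>\<ge>0. norm (G 0 \<tau>) \<le> \<gamma>) \<and>
     (\<forall>l\<ge>1. \<forall>\<tau>\<ge>0. norm (G l \<tau>) \<le> \<gamma> * (fact l * (\<delta> * L (real l - 1)) ^ l)) \<and>
     (\<forall>\<tau>>2. G 0 \<tau> = 0) \<and>
     (\<exists>\<epsilon>>0. \<forall>\<tau>. 0 \<le> \<tau> \<and> \<tau> \<le> \<epsilon> \<longrightarrow> G 0 \<tau> = G 0 0)"

lemma profile_deriv_at:
  assumes "profile \<gamma> \<delta> L G" "\<tau> > 0"
  shows "(G l has_vector_derivative G (Suc l) \<tau>) (at \<tau>)"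
proof -
  have "(G l has_vector_derivative G (Suc l) \<tau>) (at \<tau> within {0..})"
    using assms unfolding profile_def by simp
  moreover have "at \<tau> within {0..} = at \<tau>"
    using assms(2) by (intro at_within_interior) (simp add: interior_real_atLeast)
  ultimately show ?thesis by simp
qed

lemma profile_zero:
  assumes "profile \<gamma> \<delta> L G" "\<tau> > 2"
  shows "G l \<tau> = 0"
  using assms(2)
proof (induction l arbitrary: \<tau>)
  case 0
  then show ?case using assms(1) by (simp add: profile_def)
next
  case (Suc l)
  have "((\<lambda>_. 0) has_vector_derivative 0) (at \<tau>)" by simp
  then have "(G l has_vector_derivative 0) (at \<tau>)"
    by (rule has_vector_derivative_transform_within_open[of _ _ _ "{2<..}"]) (use Suc in auto)
  moreover have "(G l has_vector_derivative G (Suc l) \<tau>) (at \<tau>)"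
    using assms(1) Suc.prems by (intro profile_deriv_at) auto
  ultimately show ?case using vector_derivative_unique_at by blast
qed

text \<open>One-sided derivatives within the half line are unique at each of its points, including
  0, so constancy of \<open>G 0\<close> near 0 forces all \<open>G (Suc l)\<close> to vanish there,
  one after the other.\<close>

lemma profile_flat:
  assumes "profile \<gamma> \<delta> L G"
  shows "\<exists>\<epsilon>>0. (\<forall>\<tau>. 0 \<le> \<tau> \<and> \<tau> < \<epsilon> \<longrightarrow> G 0 \<tau> = G 0 0) \<and> (\<forall>l \<tau>. 0 \<le> \<tau> \<and> \<tau> < \<epsilon> \<longrightarrow> G (Suc l) \<tau> = 0)"
proof -
  obtain \<epsilon> where \<epsilon>: "\<epsilon> > 0" "\<And>\<tau>. 0 \<le> \<tau> \<Longrightarrow> \<tau> \<le> \<epsilon> \<Longrightarrow> G 0 \<tau> = G 0 0"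
    using assms unfolding profile_def by blast
  have flat: "G (Suc l) \<tau> = 0"
    if \<tau>: "0 \<le> \<tau>" "\<tau> < \<epsilon>" and c: "\<And>x. 0 \<le> x \<Longrightarrow> x < \<epsilon> \<Longrightarrow> G l x = c" for l \<tau> c
  proof -
    have "((\<lambda>_. c) has_vector_derivative 0) (at \<tau> within {0..})" by simp
    then have "(G l has_vector_derivative 0) (at \<tau> within {0..})"
    proof (rule has_vector_derivative_transform_within[where d = "\<epsilon> - \<tau>"])
      fix x assume "x \<in> {0..}" "dist x \<tau> < \<epsilon> - \<tau>"
      then have "0 \<le> x" "x < \<epsilon>" by (auto simp: dist_real_def)
      then show "c = G l x" using c by simp
    qed (use \<tau> in auto)
    moreover have "(G l has_vector_derivative G (Suc l) \<tau>) (at \<tau> within {0..})"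
      using assms \<tau> unfolding profile_def by simp
    moreover have "at \<tau> within {0..} \<noteq> bot"
    proof -
      have "at_right \<tau> \<le> at \<tau> within {0..}" by (rule at_le) (use \<tau> in auto)
      then show ?thesis using trivial_limit_at_right_real[of \<tau>] by (metis bot.extremum_uniqueI)
    qed
    ultimately show ?thesis by (metis vector_derivative_within)
  qed
  have "G (Suc l) \<tau> = 0" if "0 \<le> \<tau>" "\<tau> < \<epsilon>" for l \<tau>
    using that
  proof (induction l arbitrary: \<tau>)
    case 0
    show ?case by (rule flat[OF 0]) (rule \<epsilon>(2), auto)
  next
    case (Suc l)
    show ?case by (rule flat[OF Suc.prems, of _ 0]) (rule Suc.IH)
  qed
  moreover have "G 0 \<tau> = G 0 0" if "0 \<le> \<tau>" "\<tau> < \<epsilon>" for \<tau>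
    by (rule \<epsilon>(2)) (use that in auto)
  ultimately show ?thesis using \<epsilon>(1) by blast
qed

text \<open>The even extension, constant on \<open>[-\<eta>, \<eta>]\<close>; it is smooth because \<open>G 0\<close> is constant near the origin.\<close>

definition even_extension :: "real \<Rightarrow> (nat \<Rightarrow> real \<Rightarrow> complex) \<Rightarrow> nat \<Rightarrow> real \<Rightarrow> complex" where
  "even_extension \<eta> G l s =
     (if \<bar>s\<bar> \<le> \<eta> then (if l = 0 then G 0 0 else 0) else (sgn s) ^ l *\<^sub>R G l (\<bar>s\<bar> - \<eta>))"

lemma even_extension_deriv:
  assumes G: "profile \<gamma> \<delta> L G" and \<eta>: "\<eta> \<ge> 0"
  shows "(even_extension \<eta> G l has_vector_derivative even_extension \<eta> G (Suc l) s) (at s)"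
proof -
  obtain \<epsilon> where \<epsilon>: "\<epsilon> > 0" "\<And>\<tau>. 0 \<le> \<tau> \<Longrightarrow> \<tau> < \<epsilon> \<Longrightarrow> G 0 \<tau> = G 0 0"
    "\<And>l \<tau>. 0 \<le> \<tau> \<Longrightarrow> \<tau> < \<epsilon> \<Longrightarrow> G (Suc l) \<tau> = 0"
    using profile_flat[OF G] by blast
  \<comment> \<open>Three overlapping open regions: the flat one, which contains
    \<open>\<plusminus> \<eta>\<close>, and on either side one where the profile is shifted or
    reflected.\<close>
  consider "\<bar>s\<bar> < \<eta> + \<epsilon>" | "s > \<eta>" | "s < - \<eta>" using \<epsilon>(1) by linarith
  then show ?thesis
  proof cases
    case 1
    define c where "c = (if l = 0 then G 0 0 else 0)"
    have eq: "even_extension \<eta> G l x = c" if "\<bar>x\<bar> < \<eta> + \<epsilon>" for x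
      using that \<epsilon>(2)[of "\<bar>x\<bar> - \<eta>"] \<epsilon>(3)[of "\<bar>x\<bar> - \<eta>"]
      by (cases l) (auto simp: even_extension_def c_def)
    have "((\<lambda>_. c) has_vector_derivative 0) (at s)" by simp
    then have "(even_extension \<eta> G l has_vector_derivative 0) (at s)"
      by (rule has_vector_derivative_transform_within_open[of _ _ _ "{- (\<eta> + \<epsilon>)<..<\<eta> + \<epsilon>}"])
         (use 1 eq in auto)
    moreover have "even_extension \<eta> G (Suc l) s = 0"
      using 1 \<epsilon>(3)[of "\<bar>s\<bar> - \<eta>"] by (auto simp: even_extension_def)
    ultimately show ?thesis by simp
  next
    case 2
    have d: "(G l has_vector_derivative G (Suc l) (s - \<eta>)) (at (s - \<eta>))"
      using 2 by (intro profile_deriv_at[OF G]) auto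
    have "((\<lambda>x. x - \<eta>) has_vector_derivative 1) (at s)" by (auto intro!: derivative_eq_intros)
    from vector_diff_chain_at[OF this d] have "((\<lambda>x. G l (x - \<eta>)) has_vector_derivative G (Suc l) (s - \<eta>)) (at s)"
      by (simp add: comp_def)
    then have "(even_extension \<eta> G l has_vector_derivative G (Suc l) (s - \<eta>)) (at s)"
      by (rule has_vector_derivative_transform_within_open[of _ _ _ "{\<eta><..}"])
         (use 2 \<eta> in \<open>auto simp: even_extension_def\<close>)
    then show ?thesis using 2 \<eta> by (simp add: even_extension_def)
  next
    case 3
    have d: "(G l has_vector_derivative G (Suc l) (- s - \<eta>)) (at (- s - \<eta>))"
      using 3 by (intro profile_deriv_at[OF G]) auto
    have "((\<lambda>x. - x - \<eta>) has_vector_derivative - 1) (at s)" by (auto intro!: derivative_eq_intros)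
    from vector_diff_chain_at[OF this d] have "((\<lambda>x. G l (- x - \<eta>)) has_vector_derivative - G (Suc l) (- s - \<eta>)) (at s)"
      by (simp add: comp_def)
    then have "((\<lambda>x. (-1) ^ l *\<^sub>R G l (- x - \<eta>)) has_vector_derivative (-1) ^ l *\<^sub>R (- G (Suc l) (- s - \<eta>))) (at s)"
      by (rule has_vector_derivative_scaleR[OF DERIV_const, THEN has_vector_derivative_eq_rhs]) simp
    then have "(even_extension \<eta> G l has_vector_derivative (-1) ^ l *\<^sub>R (- G (Suc l) (- s - \<eta>))) (at s)"
      by (rule has_vector_derivative_transform_within_open[of _ _ _ "{..<-\<eta>}"])
         (use 3 \<eta> in \<open>auto simp: even_extension_def\<close>)
    then show ?thesis using 3 \<eta> by (simp add: even_extension_def)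
  qed
qed

lemma even_extension_minus: "even_extension \<eta> G 0 (- s) = even_extension \<eta> G 0 s"
  by (simp add: even_extension_def)

lemma even_extension_at:
  assumes "\<eta> \<ge> 0" "\<tau> \<ge> 0"
  shows "even_extension \<eta> G 0 (\<tau> + \<eta>) = G 0 \<tau>"
  using assms by (auto simp: even_extension_def)

definition derivative_bound :: "real \<Rightarrow> real \<Rightarrow> (real \<Rightarrow> real) \<Rightarrow> nat \<Rightarrow> real" where
  "derivative_bound \<gamma> \<delta> L l = (if l = 0 then \<gamma> else \<gamma> * (fact l * (\<delta> * L (real l - 1)) ^ l))"

lemma derivative_bound_nonneg:
  assumes "profile \<gamma> \<delta> L G"
  shows "0 \<le> derivative_bound \<gamma> \<delta> L l"
proof -
  have "norm (G l 0) \<le> derivative_bound \<gamma> \<delta> L l"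
    using assms unfolding profile_def derivative_bound_def by (cases "l = 0") auto
  then show ?thesis using norm_ge_zero order.trans by blast
qed

text \<open>The support lies in \<open>\<bar>s\<bar> \<le> 2 + h\<close>, where
  \<open>1 + \<bar>s\<bar> \<le> 3 + h\<close>. Any polynomial decay can therefore be imposed at the
  cost of \<open>(3 + h)^N\<close>, a factor free of the order \<open>l\<close>.\<close>

lemma even_extension_bound:
  assumes G: "profile \<gamma> \<delta> L G" and \<eta>: "0 \<le> \<eta>" "\<eta> \<le> h"
  shows "norm (even_extension \<eta> G l s) \<le> (3 + h) ^ N * derivative_bound \<gamma> \<delta> L l * (1 / (1 + \<bar>s\<bar>) ^ N)"
proof (cases "\<bar>s\<bar> \<le> 2 + \<eta>")
  case True
  note D0 = derivative_bound_nonneg[OF G]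
  have "norm (G l \<tau>) \<le> derivative_bound \<gamma> \<delta> L l" if "\<tau> \<ge> 0" for \<tau>
    using that G unfolding profile_def derivative_bound_def by (cases "l = 0") auto
  then have "norm (even_extension \<eta> G l s) \<le> derivative_bound \<gamma> \<delta> L l"
    using D0[of l] \<eta> by (auto simp: even_extension_def sgn_if power_abs)
  also have "\<dots> \<le> derivative_bound \<gamma> \<delta> L l * ((3 + h) ^ N / (1 + \<bar>s\<bar>) ^ N)"
  proof -
    have "(1 + \<bar>s\<bar>) ^ N \<le> (3 + h) ^ N" using True \<eta> by (intro power_mono) auto
    then have "1 \<le> (3 + h) ^ N / (1 + \<bar>s\<bar>) ^ N" by (simp add: pos_le_divide_eq)
    from mult_left_mono[OF this D0[of l]] show ?thesis by simp
  qed
  finally show ?thesis by (simp add: mult_ac)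
next
  case False
  then have "even_extension \<eta> G l s = 0"
    using profile_zero[OF G, of "\<bar>s\<bar> - \<eta>" l] \<eta> by (auto simp: even_extension_def)
  then show ?thesis using derivative_bound_nonneg[OF G, of l] \<eta> by (auto intro!: mult_nonneg_nonneg)
qed

section \<open>Scaling, growth and summation\<close>

lemma bandlimited_scale:
  assumes "bandlimited R C g" "c > 0"
  shows "bandlimited (R * c) C (\<lambda>u. g (c * u))"
proof (rule bandlimitedI)
  fix n :: nat and w :: "nat \<Rightarrow> complex" and u S
  assume S: "\<And>t. \<bar>t\<bar> \<le> R * c \<Longrightarrow> norm (\<Sum>k<n. w k * cis (t * u k)) \<le> S"
  show "norm (\<Sum>k<n. w k * g (c * u k)) \<le> C * S"
  proof (rule bandlimitedD[OF assms(1)])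
    fix t assume "\<bar>t\<bar> \<le> R"
    then have "\<bar>t * c\<bar> \<le> R * c" using assms(2) by (simp add: abs_mult)
    from S[OF this] show "norm (\<Sum>k<n. w k * cis (t * (c * u k))) \<le> S" by (simp add: mult.assoc)
  qed
qed

text \<open>On \<open>[0, B]\<close> monotonicity gives \<open>L t \<le> L B\<close>, so the
  integral is at least \<open>ln (B + 1) / L B\<close>. Integrability thus forces logarithmic growth
  of \<open>L\<close>, with a constant that depends on the integral alone.\<close>

lemma log_le_growth:
  fixes L :: "real \<Rightarrow> real"
  assumes L: "\<And>t. t \<ge> 0 \<Longrightarrow> L t \<ge> 1" "mono_on {0..} L"
    and int: "set_integrable lborel {0..} (\<lambda>t. 1 / ((t + 1) * L t))" and B: "B \<ge> 0"
  shows "ln (B + 1) \<le> (LINT t:{0..}|lborel. 1 / ((t + 1) * L t)) * L B"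
proof -
  have LB: "L B \<ge> 1" using L(1) B by simp
  have int': "set_integrable lborel {0..B} (\<lambda>t. 1 / ((t + 1) * L t))"
    by (rule set_integrable_subset[OF int]) (use B in auto)
  have cont: "continuous_on {0..B} (\<lambda>t. 1 / ((t + 1) * L B))"
    using LB by (intro continuous_intros) auto
  have i2: "set_integrable lborel {0..B} (\<lambda>t. 1 / ((t + 1) * L B))"
    by (rule borel_integrable_atLeastAtMost'[OF cont])
  have "((\<lambda>t. 1 / ((t + 1) * L B)) has_integral (ln (B + 1) / L B - ln (0 + 1) / L B)) {0..B}"
  proof (rule fundamental_theorem_of_calculus[OF B])
    fix t assume "t \<in> {0..B}"
    then have "((\<lambda>t. ln (t + 1) / L B) has_real_derivative 1 / ((t + 1) * L B)) (at t within {0..B})"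
      using LB by (auto intro!: derivative_eq_intros)
    then show "((\<lambda>t. ln (t + 1) / L B) has_vector_derivative 1 / ((t + 1) * L B)) (at t within {0..B})"
      by (simp add: has_real_derivative_iff_has_vector_derivative)
  qed
  then have "ln (B + 1) / L B = (LINT t:{0..B}|lborel. 1 / ((t + 1) * L B))"
    unfolding set_borel_integral_eq_integral(2)[OF i2] by (simp add: integral_unique)
  also have "\<dots> \<le> (LINT t:{0..B}|lborel. 1 / ((t + 1) * L t))"
  proof (rule set_integral_mono[OF i2 int'])
    fix t assume t: "t \<in> {0..B}"
    then have "1 \<le> L t" "L t \<le> L B" using L mono_onD[OF L(2), of t B] by auto
    then show "1 / ((t + 1) * L B) \<le> 1 / ((t + 1) * L t)"
      using t by (intro divide_left_mono mult_left_mono mult_pos_pos) auto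
  qed
  also have "\<dots> \<le> (LINT t:{0..}|lborel. 1 / ((t + 1) * L t))"
    unfolding set_lebesgue_integral_def
  proof (rule Bochner_Integration.integral_mono)
    fix t :: real
    show "indicat_real {0..B} t *\<^sub>R (1 / ((t + 1) * L t)) \<le> indicat_real {0..} t *\<^sub>R (1 / ((t + 1) * L t))"
      using L(1)[of t] by (auto simp: indicator_def)
  qed (use int int' in \<open>simp_all add: set_integrable_def\<close>)
  finally show ?thesis using LB by (simp add: pos_divide_le_eq)
qed

text \<open>Comparison with the telescoping differences of \<open>1 / (n + k)\<close>. The resulting
  factor \<open>n\<close> is the one power of \<open>n\<close> that each coordinate contributes to
  the kernel bound.\<close>

lemma sum_inverse_square_le:
  assumes "n \<ge> 1"
  shows "(\<Sum>k<m. 1 / (1 + real k / real n)\<^sup>2) \<le> 2 * real n"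
proof -
  have n: "real n \<ge> 1" using assms by simp
  have "(\<Sum>k<m. 1 / (1 + real k / real n)\<^sup>2) \<le> 2 * real n - 2 * (real n)\<^sup>2 / (real n + real m)"
  proof (induction m)
    case 0
    then show ?case using n by (simp add: power2_eq_square)
  next
    case (Suc m)
    define t where "t = real n + real m"
    have t: "t \<ge> 1" using n by (simp add: t_def)
    have "1 + real m / real n = t / real n" using n by (simp add: t_def field_simps)
    then have "1 / (1 + real m / real n)\<^sup>2 = (real n)\<^sup>2 * (1 / t\<^sup>2)" by (simp add: power_divide)
    also have "\<dots> \<le> (real n)\<^sup>2 * (2 * (1 / t - 1 / (t + 1)))"
    proof (rule mult_left_mono)
      have "1 / t - 1 / (t + 1) = 1 / (t * (t + 1))" using t by (simp add: field_simps)
      moreover have "1 / t\<^sup>2 \<le> 2 / (t * (t + 1))"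
      proof -
        have "t * (t + 1) \<le> 2 * t\<^sup>2"
          using mult_left_mono[of 1 t t] t by (simp add: power2_eq_square algebra_simps)
        then have "2 / (2 * t\<^sup>2) \<le> 2 / (t * (t + 1))" using t by (intro divide_left_mono) auto
        then show ?thesis by simp
      qed
      ultimately show "1 / t\<^sup>2 \<le> 2 * (1 / t - 1 / (t + 1))" by simp
    qed simp
    also have "\<dots> = 2 * (real n)\<^sup>2 / t - 2 * (real n)\<^sup>2 / (t + 1)" by (simp add: algebra_simps)
    finally show ?case using Suc.IH by (simp add: t_def algebra_simps)
  qed
  also have "\<dots> \<le> 2 * real n" by simp
  finally show ?thesis .
qed

lemma power_ratio: "x > 0 \<Longrightarrow> x ^ P / x ^ (P + 2) = 1 / x\<^sup>2" for x :: real
  by (simp add: power_add power2_eq_square)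

lemma summable_inverse_square:
  assumes "n \<ge> 1"
  shows "summable (\<lambda>k. 1 / (1 + real k / real n)\<^sup>2)"
  by (rule bounded_imp_summable[of _ "2 * real n"])
     (use sum_inverse_square_le[OF assms, of "Suc _"] in \<open>auto simp: lessThan_Suc_atMost\<close>)

context jacobi_system
begin

definition W1 :: "nat \<Rightarrow> real \<Rightarrow> real" where
  "W1 n x = shifted_weight (a + 1/2) (b + 1/2) (1 / (real n)\<^sup>2) x"

lemma W1_pos:
  assumes "n \<ge> 1" "-1 \<le> x" "x \<le> 1"
  shows "W1 n x > 0"
proof -
  have "1 / (real n)\<^sup>2 > 0" using assms by simp
  then have "1 - x + 1 / (real n)\<^sup>2 > 0" "1 + x + 1 / (real n)\<^sup>2 > 0" using assms by linarith+
  then show ?thesis by (simp add: W1_def shifted_weight_def)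
qed

text \<open>By the pointwise bounds, \<open>\<bar>e k \<theta> * e k \<phi>\<bar>\<close> times the
  root of the weights grows at most like \<open>(1 + k/n)^P\<close>; two further powers in the decay
  of the coefficients leave a sum of order \<open>n\<close>. The version for partial sums serves
  coefficients cut off at \<open>2 * n\<close>.\<close>

lemma series_bound:
  fixes c :: "nat \<Rightarrow> complex"
  assumes e: "\<And>k \<theta>. \<theta> \<in> {0..pi} \<Longrightarrow> (e k \<theta>)\<^sup>2 * W1 n (cos \<theta>) \<le> C * (1 + real k / real n) ^ P"
    and C: "C \<ge> 0" and n: "n \<ge> 1" and \<theta>: "\<theta> \<in> {0..pi}" "\<phi> \<in> {0..pi}" and \<epsilon>: "\<epsilon> \<ge> 0"
    and c: "\<And>k. norm (c k) \<le> \<epsilon> * (1 / (1 + real k / real n) ^ (P + 2))"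
  shows "summable (\<lambda>k. c k * of_real (e k \<theta> * e k \<phi>))"
    and "norm (\<Sum>k. c k * of_real (e k \<theta> * e k \<phi>)) \<le> \<epsilon> * (2 * C) * real n / (sqrt (W1 n (cos \<theta>)) * sqrt (W1 n (cos \<phi>)))"
    and "norm (\<Sum>k<m. c k * of_real (e k \<theta> * e k \<phi>)) \<le> \<epsilon> * (2 * C) * real n / (sqrt (W1 n (cos \<theta>)) * sqrt (W1 n (cos \<phi>)))"
proof -
  define q where "q = \<epsilon> * C / (sqrt (W1 n (cos \<theta>)) * sqrt (W1 n (cos \<phi>)))"
  have W: "W1 n (cos \<theta>) > 0" "W1 n (cos \<phi>) > 0" using n by (auto intro!: W1_pos)
  have q: "q \<ge> 0" using C \<epsilon> W by (simp add: q_def)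
  have ek: "\<bar>e k x\<bar> \<le> sqrt (C * (1 + real k / real n) ^ P) / sqrt (W1 n (cos x))"
    if "x \<in> {0..pi}" "W1 n (cos x) > 0" for k x
  proof -
    have "(e k x)\<^sup>2 \<le> C * (1 + real k / real n) ^ P / W1 n (cos x)"
      using e[OF that(1), of k] that(2) by (simp add: pos_le_divide_eq)
    then have "sqrt ((e k x)\<^sup>2) \<le> sqrt (C * (1 + real k / real n) ^ P / W1 n (cos x))" by (rule real_sqrt_le_mono)
    then show ?thesis by (simp add: real_sqrt_divide)
  qed
  have summand: "norm (c k * of_real (e k \<theta> * e k \<phi>)) \<le> q * (1 / (1 + real k / real n)\<^sup>2)" for k
  proof -
    let ?r = "1 + real k / real n"
    have r: "?r > 0" by (simp add: add_pos_nonneg)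
    have "\<bar>e k \<theta>\<bar> * \<bar>e k \<phi>\<bar> \<le> (sqrt (C * ?r ^ P) / sqrt (W1 n (cos \<theta>))) * (sqrt (C * ?r ^ P) / sqrt (W1 n (cos \<phi>)))"
      using C r W by (intro mult_mono ek \<theta>) (auto intro!: divide_nonneg_nonneg)
    also have "\<dots> = C * ?r ^ P / (sqrt (W1 n (cos \<theta>)) * sqrt (W1 n (cos \<phi>)))"
      using C r by (simp add: mult_nonneg_nonneg)
    finally have 1: "\<bar>e k \<theta>\<bar> * \<bar>e k \<phi>\<bar> \<le> C * ?r ^ P / (sqrt (W1 n (cos \<theta>)) * sqrt (W1 n (cos \<phi>)))" .
    have "norm (c k) * (\<bar>e k \<theta>\<bar> * \<bar>e k \<phi>\<bar>)
        \<le> (\<epsilon> * (1 / ?r ^ (P + 2))) * (C * ?r ^ P / (sqrt (W1 n (cos \<theta>)) * sqrt (W1 n (cos \<phi>))))"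
      using \<epsilon> r by (intro mult_mono c 1) auto
    also have "\<dots> = q * (?r ^ P / ?r ^ (P + 2))" by (simp add: q_def)
    also have "?r ^ P / ?r ^ (P + 2) = 1 / ?r\<^sup>2" using r by (rule power_ratio)
    finally show ?thesis by (simp only: norm_mult norm_of_real abs_mult)
  qed
  note sq = summable_inverse_square[OF n]
  show s: "summable (\<lambda>k. c k * of_real (e k \<theta> * e k \<phi>))"
    by (rule summable_comparison_test'[OF summable_mult[OF sq, of q], of 0]) (rule summand)
  have partial: "norm (\<Sum>k<m. c k * of_real (e k \<theta> * e k \<phi>)) \<le> q * (2 * real n)" for m
  proof -
    have "norm (\<Sum>k<m. c k * of_real (e k \<theta> * e k \<phi>)) \<le> (\<Sum>k<m. q * (1 / (1 + real k / real n)\<^sup>2))"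
      by (intro sum_norm_le summand)
    also have "\<dots> = q * (\<Sum>k<m. 1 / (1 + real k / real n)\<^sup>2)" by (rule sum_distrib_left[symmetric])
    also have "\<dots> \<le> q * (2 * real n)" by (intro mult_left_mono sum_inverse_square_le n q)
    finally show ?thesis .
  qed
  have eq: "q * (2 * real n) = \<epsilon> * (2 * C) * real n / (sqrt (W1 n (cos \<theta>)) * sqrt (W1 n (cos \<phi>)))"
    by (simp add: q_def)
  show "norm (\<Sum>k<m. c k * of_real (e k \<theta> * e k \<phi>)) \<le> \<epsilon> * (2 * C) * real n / (sqrt (W1 n (cos \<theta>)) * sqrt (W1 n (cos \<phi>)))"
    using partial unfolding eq .
  have "(\<lambda>m. norm (\<Sum>k<m. c k * of_real (e k \<theta> * e k \<phi>))) \<longlonglongrightarrow> norm (\<Sum>k. c k * of_real (e k \<theta> * e k \<phi>))"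
    by (intro tendsto_norm summable_LIMSEQ s)
  then have "norm (\<Sum>k. c k * of_real (e k \<theta> * e k \<phi>)) \<le> q * (2 * real n)"
    by (rule LIMSEQ_le_const2) (use partial in auto)
  then show "norm (\<Sum>k. c k * of_real (e k \<theta> * e k \<phi>)) \<le> \<epsilon> * (2 * C) * real n / (sqrt (W1 n (cos \<theta>)) * sqrt (W1 n (cos \<phi>)))"
    unfolding eq .
qed

text \<open>Dilation by \<open>1 / n\<close> divides the band by \<open>n\<close>, so it suffices
  that the points are more than \<open>B / n\<close> apart. The pointwise bounds enter with the
  weight for \<open>n = 1\<close>, which is at least 1 and so gives polynomial majorants for the
  series; symmetry settles which point is the smaller.\<close>

lemma scaled_kernel_vanish:
  assumes e: "\<And>k \<theta>. \<theta> \<in> {0..pi} \<Longrightarrow> (e k \<theta>)\<^sup>2 * W1 1 (cos \<theta>) \<le> C * (1 + real k) ^ P" and C: "C \<ge> 0"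
    and n: "n \<ge> 1" and B: "0 \<le> B"
    and g: "bandlimited B Cg g" "\<And>s. g (- s) = g s" "\<And>s. norm (g s) \<le> D * (1 / (1 + \<bar>s\<bar>) ^ (P + 2))"
    and \<theta>: "\<theta> \<in> {0..pi}" "\<phi> \<in> {0..pi}" "B / real n < \<bar>\<theta> - \<phi>\<bar>"
  shows "(\<Sum>k. g (\<mu> k / real n) * of_real (e k \<theta> * e k \<phi>)) = 0"
proof -
  have n0: "real n > 0" using n by simp
  define g' where "g' u = g (1 / real n * u)" for u
  define Bk where "Bk k = sqrt (C * (1 + real k) ^ P)" for k
  have bl: "bandlimited (B * (1 / real n)) Cg g'"
    unfolding g'_def by (rule bandlimited_scale[OF g(1)]) (use n0 in simp)
  have even: "g' (- u) = g' u" for u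
    unfolding g'_def using g(2)[of "1 / real n * u"] by simp
  have Bk: "\<bar>e k x\<bar> \<le> Bk k" if "x \<in> {0..pi}" for k x
  proof -
    have "1 \<le> W1 1 (cos x)"
    proof -
      have "1 \<le> 1 - cos x + 1" "1 \<le> 1 + cos x + 1" using one_plus_cos_nonneg[of x] by auto
      then have "1 * 1 \<le> (1 - cos x + 1) powr (a + 1/2) * (1 + cos x + 1) powr (b + 1/2)"
        using a b by (intro mult_mono ge_one_powr_ge_zero) auto
      then show ?thesis by (simp add: W1_def shifted_weight_def)
    qed
    then have "(e k x)\<^sup>2 * 1 \<le> (e k x)\<^sup>2 * W1 1 (cos x)" by (intro mult_left_mono) auto
    then have "(e k x)\<^sup>2 \<le> C * (1 + real k) ^ P" using e[OF that, of k] by simp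
    then have "sqrt ((e k x)\<^sup>2) \<le> Bk k" unfolding Bk_def by (rule real_sqrt_le_mono)
    then show ?thesis by simp
  qed
  have Bk2: "(Bk k)\<^sup>2 = C * (1 + real k) ^ P" for k
    using C by (simp add: Bk_def)
  have D: "D \<ge> 0" using order.trans[OF norm_ge_zero g(3)[of 0]] by simp
  have summ: "summable (\<lambda>k. norm (g' (\<mu> k)) * (Bk k)\<^sup>2)"
  proof (rule summable_comparison_test'[of _ 0])
    have "summable (\<lambda>k. 1 / (1 + real k)\<^sup>2)" using summable_inverse_square[of 1] by simp
    then show "summable (\<lambda>k. D * real n ^ (P + 2) * C * (1 / (1 + real k)\<^sup>2))" by (rule summable_mult)
    fix k
    let ?r = "1 + real k"
    have "0 \<le> \<mu> k" using h_nonneg by (simp add: \<mu>_def)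
    then have "(1 + \<bar>\<mu> k / real n\<bar>) * real n = real n + \<mu> k"
      using n0 by (simp add: distrib_right)
    then have "?r \<le> (1 + \<bar>\<mu> k / real n\<bar>) * real n"
      using n h_nonneg by (simp add: \<mu>_def)
    then have "?r ^ (P + 2) \<le> (1 + \<bar>\<mu> k / real n\<bar>) ^ (P + 2) * real n ^ (P + 2)"
      unfolding power_mult_distrib[symmetric] by (intro power_mono) auto
    then have "1 / (1 + \<bar>\<mu> k / real n\<bar>) ^ (P + 2) \<le> real n ^ (P + 2) / ?r ^ (P + 2)"
      by (simp add: pos_divide_le_eq pos_le_divide_eq add_pos_nonneg mult.commute)
    then have "D * (1 / (1 + \<bar>\<mu> k / real n\<bar>) ^ (P + 2)) \<le> D * (real n ^ (P + 2) / ?r ^ (P + 2))"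
      using D by (rule mult_left_mono)
    then have "norm (g' (\<mu> k)) \<le> D * (real n ^ (P + 2) / ?r ^ (P + 2))"
      using g(3)[of "\<mu> k / real n"] by (simp add: g'_def)
    then have "norm (g' (\<mu> k)) * (Bk k)\<^sup>2 \<le> D * (real n ^ (P + 2) / ?r ^ (P + 2)) * (C * ?r ^ P)"
      unfolding Bk2 using C by (intro mult_right_mono) auto
    also have "\<dots> = D * real n ^ (P + 2) * C * (?r ^ P / ?r ^ (P + 2))" by simp
    also have "?r ^ P / ?r ^ (P + 2) = 1 / ?r\<^sup>2" by (rule power_ratio) simp
    finally show "norm (norm (g' (\<mu> k)) * (Bk k)\<^sup>2) \<le> D * real n ^ (P + 2) * C * (1 / ?r\<^sup>2)" by simp
  qed
  have R: "0 \<le> B * (1 / real n)" using B by simp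
  note V = kernel_vanish[OF bl even R Bk summ]
  have g'_eq: "g' (\<mu> k) = g (\<mu> k / real n)" for k by (simp add: g'_def)
  show ?thesis
  proof (cases "\<theta> < \<phi>")
    case True
    then show ?thesis using V[of \<theta> \<phi>] \<theta> by (simp add: g'_eq)
  next
    case False
    then show ?thesis using V[of \<phi> \<theta>] \<theta> by (simp add: g'_eq mult.commute[of "complex_of_real (e _ \<phi>)"])
  qed
qed

lemma e_arccos: "-1 \<le> x \<Longrightarrow> x \<le> 1 \<Longrightarrow> e k (arccos x) = jacobi_normalized k a b x"
  by (simp add: e_def)

end

section \<open>The growth condition and the order of differentiation\<close>

definition admissible_growth :: "real \<Rightarrow> (real \<Rightarrow> real) \<Rightarrow> bool" where
  "admissible_growth M L \<longleftrightarrow> (\<forall>t\<ge>0. L t \<ge> 1) \<and> mono_on {0..} L \<and>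
     set_integrable lborel {0..} (\<lambda>t. 1 / ((t + 1) * L t)) \<and>
     M = 1 + (LINT t:{0..}|lborel. 1 / ((t + 1) * L t))"

lemma admissible_growth_ge_one:
  assumes "admissible_growth M L"
  shows "M \<ge> 1"
proof -
  have "0 \<le> (LINT t:{0..}|lborel. 1 / ((t + 1) * L t))"
    unfolding set_lebesgue_integral_def
  proof (intro integral_nonneg_AE AE_I2)
    fix t :: real
    have "0 \<le> L t" if "t \<ge> 0"
    proof -
      have "1 \<le> L t" using assms that by (simp add: admissible_growth_def)
      then show ?thesis by linarith
    qed
    then show "0 \<le> indicat_real {0..} t *\<^sub>R (1 / ((t + 1) * L t))" by (simp add: indicator_def)
  qed
  then show ?thesis using assms by (simp add: admissible_growth_def)
qed

text \<open>Logarithmic growth of \<open>L\<close> with the constant \<open>M - 1\<close> yields a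
  threshold for \<open>B\<close> in terms of \<open>M\<close> and \<open>\<delta>\<close> alone.
  This keeps the constant of the theorem uniform in \<open>L\<close>.\<close>

lemma growth_eventually_large:
  assumes L: "admissible_growth M L" and \<delta>: "\<delta> > 0" and B: "B \<ge> exp ((M - 1) / \<delta>)"
  shows "\<delta> * L B \<ge> 1"
proof -
  have B0: "B > 0" using B exp_gt_zero order.strict_trans2 by blast
  have M: "M \<ge> 1" by (rule admissible_growth_ge_one[OF L])
  have LB: "L B \<ge> 1" using L B0 by (simp add: admissible_growth_def)
  have "(M - 1) / \<delta> = ln (exp ((M - 1) / \<delta>))" by simp
  also have "\<dots> < ln (B + 1)" using B by (subst ln_less_cancel_iff) (use B0 in auto)
  also have "\<dots> \<le> (M - 1) * L B"
    using log_le_growth[of L B] L B0 by (simp add: admissible_growth_def)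
  finally have *: "(M - 1) / \<delta> < (M - 1) * L B" .
  show ?thesis
  proof (cases "M = 1")
    case False
    then have "M - 1 > 0" using M by simp
    moreover have "(M - 1) * (1 / \<delta>) < (M - 1) * L B" using * by simp
    ultimately have "1 / \<delta> < L B" by (simp only: mult_less_cancel_left_pos)
    then show ?thesis using \<delta> by (simp add: pos_divide_less_eq mult.commute)
  qed (use * in simp)
qed

text \<open>Choice of the order \<open>K\<close> of differentiation that makes the factorial growth and the powers balance.\<close>

lemma optimal_order:
  assumes L: "admissible_growth M L" and \<delta>: "\<delta> > 0" and C1: "C1 \<ge> 1" and \<gamma>: "\<gamma> \<ge> 0"
    and r: "r > 0" "\<delta> * L r \<ge> 1"
  shows "\<exists>K. (C1 / (r / 2)) ^ K * derivative_bound \<gamma> \<delta> L K \<le> \<gamma> * exp 1 * exp (- (1 / (2 * exp 1 * C1) / \<delta> * r / L r))"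
proof -
  \<comment> \<open>\<open>\<delta> * L r \<ge> 1\<close> gives \<open>X \<le> r\<close> and later
    \<open>K \<le> r\<close>, which lets monotonicity replace \<open>L (K - 1)\<close> by
    \<open>L r\<close>.\<close>
  define X where "X = r / (\<delta> * L r)"
  have Lr: "L r \<ge> 1" using L r by (simp add: admissible_growth_def)
  have X: "0 \<le> X" "X \<le> r" using r \<delta> Lr by (auto simp: X_def divide_le_eq)
  \<comment> \<open>Normalized so that
    \<open>C1 / (r / 2) * (Y * (\<delta> * L r)) = exp (- 1)\<close>: each of the \<open>K\<close>
    factors is then at most \<open>exp (- 1)\<close>. Rounding \<open>Y\<close> down to
    \<open>K\<close> costs a factor \<open>exp 1\<close>.\<close>
  define Y where "Y = X / (2 * exp 1 * C1)"
  have eC: "2 * exp 1 * C1 \<ge> 1"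
  proof -
    have "(1::real) \<le> exp 1" by simp
    then have "1 * 1 \<le> exp 1 * C1" using C1 by (intro mult_mono) auto
    then show ?thesis by simp
  qed
  have Y: "0 \<le> Y" "Y \<le> r"
  proof -
    show "0 \<le> Y" unfolding Y_def using X eC by (intro divide_nonneg_nonneg) linarith+
    have "X / (2 * exp 1 * C1) \<le> X / 1" using X eC C1 by (intro divide_left_mono) (auto intro!: mult_pos_pos)
    then show "Y \<le> r" using X by (simp add: Y_def)
  qed
  define K where "K = nat \<lfloor>Y\<rfloor>"
  have K: "real K \<le> Y" "Y < real K + 1" using Y unfolding K_def by linarith+
  have bound: "(C1 / (r / 2)) ^ K * derivative_bound \<gamma> \<delta> L K \<le> \<gamma> * exp (- real K)"
  proof (cases "K = 0")
    case True
    then show ?thesis by (simp add: derivative_bound_def)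
  next
    case False
    have K1: "0 \<le> real K - 1" "real K - 1 \<le> r" using False K Y by auto
    have "L (real K - 1) \<le> L r"
      using L K1 r by (intro mono_onD[of "{0..}" L]) (auto simp: admissible_growth_def)
    moreover have "0 \<le> L (real K - 1)" using L K1 by (auto simp: admissible_growth_def intro: order.trans[of 0 1])
    ultimately have "(\<delta> * L (real K - 1)) ^ K \<le> (\<delta> * L r) ^ K"
      using \<delta> by (intro power_mono mult_left_mono mult_nonneg_nonneg) auto
    moreover have "fact K \<le> real K ^ K" using fact_le_power[of K, where 'a = real] by simp
    ultimately have "fact K * (\<delta> * L (real K - 1)) ^ K \<le> real K ^ K * (\<delta> * L r) ^ K"
      using \<delta> \<open>0 \<le> L (real K - 1)\<close> by (intro mult_mono) auto
    then have "(C1 / (r / 2)) ^ K * (fact K * (\<delta> * L (real K - 1)) ^ K) \<le> (C1 / (r / 2)) ^ K * (real K ^ K * (\<delta> * L r) ^ K)"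
      using C1 r by (intro mult_left_mono) auto
    also have "\<dots> = (C1 / (r / 2) * (real K * (\<delta> * L r))) ^ K" by (simp only: power_mult_distrib)
    also have "\<dots> \<le> (exp (- 1)) ^ K"
    proof (rule power_mono)
      have "C1 / (r / 2) * (real K * (\<delta> * L r)) \<le> C1 / (r / 2) * (Y * (\<delta> * L r))"
        using K C1 r \<delta> Lr by (intro mult_left_mono mult_right_mono) auto
      also have "\<dots> = exp (- 1)"
        using C1 r \<delta> Lr by (simp add: Y_def X_def exp_minus field_simps)
      finally show "C1 / (r / 2) * (real K * (\<delta> * L r)) \<le> exp (- 1)" .
    qed (use C1 r \<delta> Lr in \<open>auto intro!: mult_nonneg_nonneg divide_nonneg_nonneg\<close>)
    also have "\<dots> = exp (- real K)" by (simp flip: exp_of_nat_mult)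
    finally have "(C1 / (r / 2)) ^ K * (fact K * (\<delta> * L (real K - 1)) ^ K) \<le> exp (- real K)" .
    from mult_left_mono[OF this \<gamma>] show ?thesis
      using False by (simp add: derivative_bound_def mult.left_commute)
  qed
  have "exp (- real K) \<le> exp (1 + - Y)" using K by simp
  also have "\<dots> = exp 1 * exp (- Y)" by (simp only: exp_add)
  finally have "\<gamma> * exp (- real K) \<le> \<gamma> * (exp 1 * exp (- Y))" using \<gamma> by (intro mult_left_mono) auto
  moreover have "Y = 1 / (2 * exp 1 * C1) / \<delta> * r / L r" by (simp add: Y_def X_def)
  ultimately show ?thesis using bound by (intro exI[of _ K]) simp
qed

text \<open>Put \<open>r = n * \<bar>arccos x - arccos y\<bar>\<close>. Below a threshold for
  \<open>r\<close> the exponential is bounded from below and absolute values suffice. Beyond it an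
  approximation of band \<open>r / 2\<close>, half of what the distance would allow, drops out and
  its error is all that contributes. The constant \<open>c\<close> precedes \<open>L\<close>,
  \<open>G\<close>, \<open>n\<close> and the points.\<close>

theorem localization_1d:
  "\<exists>c'>0. \<forall>a b M \<gamma> \<gamma>'. a \<ge> -1/2 \<and> b \<ge> -1/2 \<and> \<gamma> > 0 \<and> \<gamma>' > 0 \<and> M \<ge> 1 \<longrightarrow>
     (\<exists>c>0. \<forall>L G n x y. admissible_growth M L \<and> profile \<gamma> (\<gamma>' * M) L G \<and> n \<ge> 1 \<and> x \<in> {-1..1} \<and> y \<in> {-1..1} \<longrightarrow>
        norm (\<Sum>k\<le>2*n. G 0 (real k / real n) * of_real (jacobi_normalized k a b x * jacobi_normalized k a b y))
          \<le> c * real n / (sqrt (shifted_weight (a + 1/2) (b + 1/2) (1 / (real n)\<^sup>2) x)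
              * sqrt (shifted_weight (a + 1/2) (b + 1/2) (1 / (real n)\<^sup>2) y))
            * exp (- (c' / (\<gamma>' * M) * (real n * \<bar>arccos x - arccos y\<bar>) / L (real n * \<bar>arccos x - arccos y\<bar>))))"
proof -
  obtain C1 where C1: "C1 \<ge> 1" "\<forall>N\<ge>2. \<exists>B0>0. \<forall>B\<ge>B0. \<exists>k Ck. approx_kernel k N (C1 / B) B Ck"
    using jackson_kernel by blast
  define c' where "c' = 1 / (2 * exp 1 * C1)"
  have c': "c' > 0" using C1 by (simp add: c'_def)
  show ?thesis
  proof (rule exI[of _ c'], intro conjI c' allI impI)
    fix a b M \<gamma> \<gamma>' :: real
    assume "a \<ge> -1/2 \<and> b \<ge> -1/2 \<and> \<gamma> > 0 \<and> \<gamma>' > 0 \<and> M \<ge> 1"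
    then have ab: "a \<ge> -1/2" "b \<ge> -1/2" and \<gamma>: "\<gamma> > 0" "\<gamma>' > 0" and M: "M \<ge> 1" by auto
    interpret jacobi_system a b by unfold_locales (fact ab)+
    define \<delta> where "\<delta> = \<gamma>' * M"
    have \<delta>: "\<delta> > 0" using \<gamma> M by (simp add: \<delta>_def)
    obtain C P where C: "C \<ge> 0" and e: "\<And>n k \<theta>. n \<ge> 1 \<Longrightarrow> \<theta> \<in> {0..pi} \<Longrightarrow>
        (e k \<theta>)\<^sup>2 * W1 n (cos \<theta>) \<le> C * (1 + real k / real n) ^ P"
      using e_bound_scaled unfolding W1_def by blast
    \<comment> \<open>Two more than the growth exponent of the squared eigenfunctions, which makes
      the series summable.\<close>
    define N where "N = P + 2"
    have N2: "N \<ge> 2" by (simp add: N_def)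
    obtain B0 where B0: "B0 > 0" "\<And>B. B \<ge> B0 \<Longrightarrow> \<exists>k Ck. approx_kernel k N (C1 / B) B Ck"
      using C1(2) N2 by blast
    \<comment> \<open>The first entry makes the band \<open>r / 2\<close> at least
      \<open>B0\<close>, the second one ensures \<open>\<delta> * L r \<ge> 1\<close>.\<close>
    define B1 where "B1 = max (2 * B0) (exp ((M - 1) / \<delta>))"
    have B1: "B1 \<ge> 2 * B0" "B1 \<ge> exp ((M - 1) / \<delta>)" "B1 > 0" using B0 by (auto simp: B1_def)
    define H where "H = (3 + h) ^ N"
    have H: "H \<ge> 0" using h_nonneg by (simp add: H_def)
    \<comment> \<open>One summand for each of the two ranges of \<open>r\<close>; the final 1 keeps
      \<open>c\<close> positive even if \<open>C = 0\<close>.\<close>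
    define c where "c = \<gamma> * 3 ^ N * (2 * C) * exp (c' / \<delta> * B1) + \<gamma> * exp 1 * H * (2 * C) + 1"
    have c0: "0 \<le> \<gamma> * 3 ^ N * (2 * C) * exp (c' / \<delta> * B1)" "0 \<le> \<gamma> * exp 1 * H * (2 * C)"
      using \<gamma> C H by (auto intro!: mult_nonneg_nonneg)
    have c: "c > 0" unfolding c_def using c0 by linarith
    show "\<exists>c>0. \<forall>L G n x y. admissible_growth M L \<and> profile \<gamma> (\<gamma>' * M) L G \<and> n \<ge> 1 \<and> x \<in> {-1..1} \<and> y \<in> {-1..1} \<longrightarrow>
        norm (\<Sum>k\<le>2*n. G 0 (real k / real n) * of_real (jacobi_normalized k a b x * jacobi_normalized k a b y))
          \<le> c * real n / (sqrt (shifted_weight (a + 1/2) (b + 1/2) (1 / (real n)\<^sup>2) x)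
              * sqrt (shifted_weight (a + 1/2) (b + 1/2) (1 / (real n)\<^sup>2) y))
            * exp (- (c' / (\<gamma>' * M) * (real n * \<bar>arccos x - arccos y\<bar>) / L (real n * \<bar>arccos x - arccos y\<bar>)))"
      unfolding W1_def[symmetric] \<delta>_def[symmetric]
    proof (rule exI[of _ c], intro conjI c allI impI)
      fix L :: "real \<Rightarrow> real" and G :: "nat \<Rightarrow> real \<Rightarrow> complex" and n :: nat and x y :: real
      assume "admissible_growth M L \<and> profile \<gamma> \<delta> L G \<and> n \<ge> 1 \<and> x \<in> {-1..1} \<and> y \<in> {-1..1}"
      then have L: "admissible_growth M L" and G: "profile \<gamma> \<delta> L G" and n: "n \<ge> 1"
        and xy: "-1 \<le> x" "x \<le> 1" "-1 \<le> y" "y \<le> 1" by auto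
      define \<theta> \<phi> where "\<theta> = arccos x" and "\<phi> = arccos y"
      have \<theta>: "\<theta> \<in> {0..pi}" "\<phi> \<in> {0..pi}" "cos \<theta> = x" "cos \<phi> = y"
        using xy by (auto simp: \<theta>_def \<phi>_def arccos_lbound arccos_ubound)
      define r where "r = real n * \<bar>\<theta> - \<phi>\<bar>"
      have r0: "r \<ge> 0" by (simp add: r_def)
      have n0: "real n > 0" using n by simp
      let ?W = "sqrt (W1 n x) * sqrt (W1 n y)"
      have W: "?W > 0" using W1_pos[OF n] xy by simp
      let ?S = "\<Sum>k\<le>2*n. G 0 (real k / real n) * of_real (e k \<theta> * e k \<phi>)"
      let ?ex = "exp (- (c' / \<delta> * r / L r))"
      have Lr: "L r \<ge> 1" using L r0 by (simp add: admissible_growth_def)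
      have main: "norm ?S \<le> c * real n / ?W * ?ex"
      proof (cases "r < B1")
        case True
        \<comment> \<open>For \<open>k \<le> 2 * n\<close> the base \<open>1 + k/n\<close> is at
          most 3, so bounded coefficients satisfy the decay condition up to the factor
          \<open>3^N\<close>.\<close>
        have "norm (if k \<le> 2*n then G 0 (real k / real n) else 0) \<le> (\<gamma> * 3 ^ N) * (1 / (1 + real k / real n) ^ (P + 2))" for k
        proof (cases "k \<le> 2 * n")
          case True
          have "norm (G 0 (real k / real n)) \<le> \<gamma>" using G by (simp add: profile_def)
          have "real k \<le> 2 * real n" using True by (metis of_nat_le_iff of_nat_mult of_nat_numeral)
          then have "real k / real n \<le> 2" using n0 by (simp add: pos_divide_le_eq)
          then have "(1 + real k / real n) ^ (P + 2) \<le> 3 ^ (P + 2)" by (intro power_mono) auto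
          then have "1 \<le> 3 ^ (P + 2) / (1 + real k / real n) ^ (P + 2)"
            by (simp add: pos_le_divide_eq add_pos_nonneg)
          then have "\<gamma> * 1 \<le> \<gamma> * (3 ^ (P + 2) / (1 + real k / real n) ^ (P + 2))"
            using \<gamma> by (intro mult_left_mono) auto
          then show ?thesis using True \<open>norm (G 0 (real k / real n)) \<le> \<gamma>\<close> by (simp add: N_def)
        qed (use \<gamma> in simp)
        note sb = series_bound(3)[where c = "\<lambda>k. if k \<le> 2*n then G 0 (real k / real n) else 0" and m = "2*n+1",
            OF e[OF n] C n \<theta>(1,2) _ this]
        have "norm (\<Sum>k<2*n+1. (if k \<le> 2*n then G 0 (real k / real n) else 0) * of_real (e k \<theta> * e k \<phi>))
            \<le> \<gamma> * 3 ^ N * (2 * C) * real n / ?W"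
          using sb \<gamma> by (simp only: \<theta> mult_nonneg_nonneg less_imp_le zero_le_power zero_le_numeral)
        moreover have "(\<Sum>k<2*n+1. (if k \<le> 2*n then G 0 (real k / real n) else 0) * of_real (e k \<theta> * e k \<phi>)) = ?S"
          by (intro sum.cong) auto
        ultimately have 1: "norm ?S \<le> \<gamma> * 3 ^ N * (2 * C) * real n / ?W" by (simp only:)
        have "c' / \<delta> * r / L r \<le> c' / \<delta> * r / 1"
          using Lr c' \<delta> r0 by (intro divide_left_mono) auto
        also have "\<dots> \<le> c' / \<delta> * B1" using True c' \<delta> by (simp add: divide_right_mono)
        finally have "exp (- (c' / \<delta> * B1)) \<le> ?ex" by simp
        then have "exp (c' / \<delta> * B1) * exp (- (c' / \<delta> * B1)) \<le> exp (c' / \<delta> * B1) * ?ex" by (intro mult_left_mono) auto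
        then have ex: "1 \<le> exp (c' / \<delta> * B1) * ?ex" by (simp flip: exp_add)
        have "\<gamma> * 3 ^ N * (2 * C) * real n / ?W * 1 \<le> \<gamma> * 3 ^ N * (2 * C) * real n / ?W * (exp (c' / \<delta> * B1) * ?ex)"
          using W \<gamma> C by (intro mult_left_mono ex) auto
        also have "\<dots> = (\<gamma> * 3 ^ N * (2 * C) * exp (c' / \<delta> * B1)) * (real n / ?W * ?ex)" by simp
        also have "\<dots> \<le> c * (real n / ?W * ?ex)"
          using W c0 by (intro mult_right_mono, unfold c_def, linarith) simp
        finally show ?thesis using 1 by simp
      next
        case False
        then have rB: "r \<ge> B1" by simp
        have r: "r > 0" using rB B1 by linarith
        have \<delta>L: "\<delta> * L r \<ge> 1" using growth_eventually_large[OF L \<delta>] rB B1 by simp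
        have "r / 2 \<ge> B0" using rB B1 by simp
        then obtain k Ck where "approx_kernel k N (C1 / (r / 2)) (r / 2) Ck" using B0(2) by blast
        then interpret K: approx_kernel k N "C1 / (r / 2)" "r / 2" Ck .
        define \<eta> where "\<eta> = h / real n"
        have \<eta>: "0 \<le> \<eta>" "\<eta> \<le> h"
          using h_nonneg n by (auto simp: \<eta>_def divide_le_eq mult_left_mono[of 1 "real n" h, simplified])
        define F where "F = even_extension \<eta> G"
        have fam: "K.weighted_family F (\<lambda>l. H * derivative_bound \<gamma> \<delta> L l)"
          unfolding K.weighted_family_def F_def H_def K.\<omega>_def
          using even_extension_deriv[OF G \<eta>(1)] even_extension_bound[OF G \<eta>] by blast
        obtain j where j: "(C1 / (r / 2)) ^ j * derivative_bound \<gamma> \<delta> L j \<le> \<gamma> * exp 1 * ?ex"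
          using optimal_order[OF L \<delta> C1(1) _ r \<delta>L, of \<gamma>] \<gamma> unfolding c'_def by auto
        obtain g Cg D where g: "\<And>s. g (- s) = g s" "bandlimited (r / 2) Cg g" "\<And>s. norm (g s) \<le> D * K.\<omega> s"
          "\<And>s. norm (F 0 s - g s) \<le> (C1 / (r / 2)) ^ j * (H * derivative_bound \<gamma> \<delta> L j) * K.\<omega> s"
          using K.approximation[OF fam, of j] even_extension_minus unfolding F_def by blast
        define \<epsilon> where "\<epsilon> = H * (\<gamma> * exp 1 * ?ex)"
        have \<epsilon>: "\<epsilon> \<ge> 0" using H \<gamma> by (simp add: \<epsilon>_def)
        have err: "norm (F 0 s - g s) \<le> \<epsilon> * K.\<omega> s" for s
        proof -
          have "(C1 / (r / 2)) ^ j * (H * derivative_bound \<gamma> \<delta> L j) \<le> \<epsilon>"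
            using mult_left_mono[OF j H] by (simp add: \<epsilon>_def mult.left_commute)
          from mult_right_mono[OF this less_imp_le[OF K.\<omega>_pos[of s]]] show ?thesis using g(4)[of s] by linarith
        qed
        define d where "d k = F 0 (\<mu> k / real n) - g (\<mu> k / real n)" for k
        \<comment> \<open>The extension is shifted by \<open>h / n\<close> precisely so that its
          values at \<open>\<mu> k / n\<close> are the coefficients of the kernel.\<close>
        have F\<mu>: "F 0 (\<mu> k / real n) = G 0 (real k / real n)" for k
          using even_extension_at[OF \<eta>(1), of "real k / real n" G]
          by (simp add: F_def \<mu>_def \<eta>_def add_divide_distrib)
        have d: "norm (d k) \<le> \<epsilon> * (1 / (1 + real k / real n) ^ (P + 2))" for k
        proof -
          have "1 + real k / real n \<le> 1 + \<bar>\<mu> k / real n\<bar>"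
            using h_nonneg n0 by (simp add: \<mu>_def add_divide_distrib)
          then have "K.\<omega> (\<mu> k / real n) \<le> 1 / (1 + real k / real n) ^ (P + 2)"
            unfolding K.\<omega>_def unfolding N_def by (intro divide_left_mono power_mono mult_pos_pos zero_less_power) (auto simp: add_pos_nonneg)
          from mult_left_mono[OF this \<epsilon>] show ?thesis using err[of "\<mu> k / real n"] by (simp add: d_def)
        qed
        note sb = series_bound[OF e[OF n] C n \<theta>(1,2) \<epsilon> d]
        \<comment> \<open>After scaling the band is
          \<open>r / 2 / n = \<bar>\<theta> - \<phi>\<bar> / 2\<close>, so the bandlimited part does
          not contribute.\<close>
        have van: "(\<Sum>k. g (\<mu> k / real n) * of_real (e k \<theta> * e k \<phi>)) = 0"
        proof (rule scaled_kernel_vanish[OF _ C n _ g(2,1) _ \<theta>(1,2)])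
          show "(e k \<theta>)\<^sup>2 * W1 1 (cos \<theta>) \<le> C * (1 + real k) ^ P" if "\<theta> \<in> {0..pi}" for k \<theta>
            using e[of 1 \<theta> k] that by simp
          show "norm (g s) \<le> D * (1 / (1 + \<bar>s\<bar>) ^ (P + 2))" for s
            using g(3)[of s] unfolding K.\<omega>_def unfolding N_def .
          have "\<bar>\<theta> - \<phi>\<bar> > 0" using r by (auto simp: r_def)
          moreover have "r / 2 / real n = \<bar>\<theta> - \<phi>\<bar> / 2" using n0 by (simp add: r_def)
          moreover have "z / 2 < z" if "0 < z" for z :: real using that by simp
          ultimately show "r / 2 / real n < \<bar>\<theta> - \<phi>\<bar>" by (simp only:)
        qed (use r in simp)
        have zero: "G 0 (real k / real n) = 0" if "k \<notin> {..2*n}" for k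
        proof -
          have "2 * real n < real k" using that by (metis atMost_iff not_le of_nat_less_iff of_nat_mult of_nat_numeral)
          then have "real k / real n > 2" using n0 by (simp add: pos_less_divide_eq)
          then show ?thesis using G by (simp add: profile_def)
        qed
        have fin: "(\<lambda>k. F 0 (\<mu> k / real n) * of_real (e k \<theta> * e k \<phi>)) sums ?S"
          unfolding F\<mu> by (rule sums_finite) (use zero in auto)
        have "(\<lambda>k. F 0 (\<mu> k / real n) * of_real (e k \<theta> * e k \<phi>) - d k * of_real (e k \<theta> * e k \<phi>))
            sums (?S - (\<Sum>k. d k * of_real (e k \<theta> * e k \<phi>)))"
          by (intro sums_diff fin summable_sums sb(1))
        moreover have "F 0 (\<mu> k / real n) * of_real (e k \<theta> * e k \<phi>) - d k * of_real (e k \<theta> * e k \<phi>)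
            = g (\<mu> k / real n) * of_real (e k \<theta> * e k \<phi>)" for k
          by (simp add: d_def flip: left_diff_distrib)
        ultimately have "?S = (\<Sum>k. d k * of_real (e k \<theta> * e k \<phi>))"
          using van by (simp add: sums_iff)
        then have "norm ?S \<le> \<epsilon> * (2 * C) * real n / ?W" using sb(2) by (simp only: \<theta>)
        also have "\<dots> = (\<gamma> * exp 1 * H * (2 * C)) * (real n / ?W * ?ex)" by (simp add: \<epsilon>_def)
        also have "\<dots> \<le> c * (real n / ?W * ?ex)"
          using W c0 by (intro mult_right_mono, unfold c_def, linarith) simp
        finally show ?thesis by simp
      qed
      have "?S = (\<Sum>k\<le>2*n. G 0 (real k / real n) * of_real (jacobi_normalized k a b x * jacobi_normalized k a b y))"
        by (simp add: \<theta>_def \<phi>_def e_arccos xy)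
      then show "norm (\<Sum>k\<le>2*n. G 0 (real k / real n) * of_real (jacobi_normalized k a b x * jacobi_normalized k a b y))
          \<le> c * real n / ?W * exp (- (c' / \<delta> * (real n * \<bar>arccos x - arccos y\<bar>) / L (real n * \<bar>arccos x - arccos y\<bar>)))"
        using main by (simp only: r_def \<theta>_def \<phi>_def)
    qed
  qed
qed

subsection \<open>Several variables\<close>

lemma admissible_support:
  assumes "admissible_cutoff_second_kind d A" "t \<in> orthant d" "i < d" "t i > 2"
  shows "A t = 0"
proof (rule ccontr)
  let ?X = "{t \<in> orthant d. A t \<noteq> 0}" and ?Y = "{t \<in> orthant d. \<forall>i<d. t i \<le> 2}"
  have "closure ?X \<subseteq> ?Y" using assms(1) by (simp add: admissible_cutoff_second_kind_def)
  then have "?X \<subseteq> ?Y" by (rule order.trans[OF closure_subset])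
  moreover assume "A t \<noteq> 0"
  then have "t \<in> ?X" using assms(2) by simp
  ultimately have "t \<in> ?Y" by (rule subsetD)
  then show False using assms(3,4) by auto
qed

text \<open>Flatness at 0 is where the second kind enters. If another coordinate of \<open>t\<close>
  is positive, a small \<open>\<tau>\<close> is below half of the maximum and may be replaced by 0.
  Otherwise the line is a coordinate axis, whose points near 0 belong to \<open>B1\<close> and to
  its half, and the type of the cutoff makes \<open>A\<close> constant there; type (c) falls under
  type (b).\<close>

lemma profile_restriction:
  assumes A: "admissible_cutoff_second_kind d A" "A \<in> class_S d L \<gamma> \<delta>"
    and j: "j < d" and t: "t \<in> orthant d"
  shows "profile \<gamma> \<delta> L (\<lambda>l \<tau>. (partial_deriv j ^^ l) A (t(j := \<tau>)))"
  unfolding profile_def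
proof (intro conjI allI impI)
  have orth: "t(j := \<tau>) \<in> orthant d" if "\<tau> \<ge> 0" for \<tau>
    using that t j by (auto simp: orthant_def)
  have iter: "foldr partial_deriv (replicate l j) A = (partial_deriv j ^^ l) A" for l
    by (induction l) auto
  fix l :: nat and \<tau> :: real assume \<tau>: "0 \<le> \<tau>"
  have "smooth_on_orthant d A" using A by (simp add: admissible_cutoff_second_kind_def)
  moreover have "set (replicate l j) \<subseteq> {..<d}" using j by auto
  ultimately have "(\<lambda>s. foldr partial_deriv (replicate l j) A ((t(j := \<tau>))(j := s)))
      differentiable (at ((t(j := \<tau>)) j) within {0..})"
    using j orth[OF \<tau>] unfolding smooth_on_orthant_def by blast
  then have "(\<lambda>s. (partial_deriv j ^^ l) A (t(j := s))) differentiable (at \<tau> within {0..})"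
    unfolding iter by simp
  then show "((\<lambda>\<tau>. (partial_deriv j ^^ l) A (t(j := \<tau>))) has_vector_derivative
      (partial_deriv j ^^ Suc l) A (t(j := \<tau>))) (at \<tau> within {0..})"
    unfolding vector_derivative_works by (simp add: partial_deriv_def)
  show "norm ((partial_deriv j ^^ 0) A (t(j := \<tau>))) \<le> \<gamma>"
    using A(2) orth[OF \<tau>] by (simp add: class_S_def)
  assume l: "1 \<le> l"
  have "1 / fact l * norm ((partial_deriv j ^^ l) A (t(j := \<tau>))) \<le> \<gamma> * (\<delta> * L (real l - 1)) ^ l"
    using A(2) orth[OF \<tau>] l j unfolding class_S_def by blast
  then show "norm ((partial_deriv j ^^ l) A (t(j := \<tau>))) \<le> \<gamma> * (fact l * (\<delta> * L (real l - 1)) ^ l)"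
    by (simp add: pos_divide_le_eq mult_ac)
next
  fix \<tau> :: real assume \<tau>: "2 < \<tau>"
  have "t(j := \<tau>) \<in> orthant d" using \<tau> t j by (auto simp: orthant_def)
  then show "(partial_deriv j ^^ 0) A (t(j := \<tau>)) = 0"
    using admissible_support[OF A(1) _ j, of "t(j := \<tau>)"] \<tau> by simp
next
  have flat: "A t' = A (t'(k := 0))" if "t' \<in> orthant d" "k < d" "t' k \<le> 1/2 * norm_inf d t'" for t' k
    using A(1) that unfolding admissible_cutoff_second_kind_def by blast
  have t0: "t i \<ge> 0" if "i < d" for i using t that by (simp add: orthant_def)
  have "\<exists>\<epsilon>>0. \<forall>\<tau>. 0 \<le> \<tau> \<and> \<tau> \<le> \<epsilon> \<longrightarrow> A (t(j := \<tau>)) = A (t(j := 0))"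
  proof (cases "\<exists>i<d. i \<noteq> j \<and> t i > 0")
    case True
    then obtain i where i: "i < d" "i \<noteq> j" "t i > 0" by blast
    show ?thesis
    proof (intro exI[of _ "t i / 2"] conjI allI impI)
      fix \<tau> assume \<tau>: "0 \<le> \<tau> \<and> \<tau> \<le> t i / 2"
      let ?t = "t(j := \<tau>)"
      have "\<bar>?t i\<bar> \<in> (\<lambda>i. \<bar>?t i\<bar>) ` {..<d}" by (rule imageI) (use i in simp)
      then have "\<bar>?t i\<bar> \<le> norm_inf d ?t" unfolding norm_inf_def by (intro Max_ge) auto
      then have "?t j \<le> 1/2 * norm_inf d ?t" using \<tau> i by simp
      moreover have "?t \<in> orthant d" using \<tau> t j by (auto simp: orthant_def)
      ultimately have "A ?t = A (?t(j := 0))" using j by (intro flat) auto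
      then show "A ?t = A (t(j := 0))" by simp
    qed (use i in simp)
  next
    case False
    have zero: "t i = 0" if "i < d" "i \<noteq> j" for i
      using False t0[OF that(1)] that by force
    have inB1: "t(j := \<tau>) \<in> B1 d" if "0 \<le> \<tau>" "\<tau> \<le> 1" for \<tau>
    proof -
      have "norm_1 d (t(j := \<tau>)) = (\<Sum>i<d. if i = j then \<tau> else 0)"
        unfolding norm_1_def using zero that by (intro sum.cong) auto
      also have "\<dots> = \<tau>" using j by simp
      finally show ?thesis using that t j by (auto simp: B1_def orthant_def)
    qed
    have "cutoff_a d A \<or> cutoff_b d A"
      using A(1) by (auto simp: admissible_cutoff_second_kind_def cutoff_c_def)
    then obtain c where c: "A (t(j := \<tau>)) = c" if "0 \<le> \<tau>" "\<tau> \<le> 1/2" for \<tau>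
    proof
      assume "cutoff_a d A"
      then show thesis using inB1 by (intro that[of 1]) (auto simp: cutoff_a_def)
    next
      assume b: "cutoff_b d A"
      have "A (t(j := \<tau>)) = 0" if "0 \<le> \<tau>" "\<tau> \<le> 1/2" for \<tau>
      proof -
        have "t i = 0" if "i \<noteq> j" for i
          using zero[of i] t that by (cases "i < d") (auto simp: orthant_def)
        then have "t(j := \<tau>) = (\<lambda>i. (t(j := 2 * \<tau>)) i / 2)" by (auto simp: fun_eq_iff)
        moreover have "t(j := 2 * \<tau>) \<in> B1 d" using that by (intro inB1) auto
        ultimately have "t(j := \<tau>) \<in> (\<lambda>t i. t i / 2) ` B1 d" by (rule image_eqI)
        then show ?thesis using b unfolding cutoff_b_def by blast
      qed
      then show thesis by (rule that)
    qed
    show ?thesis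
    proof (intro exI[of _ "1/2"] conjI allI impI)
      fix \<tau> :: real assume "0 \<le> \<tau> \<and> \<tau> \<le> 1/2"
      then show "A (t(j := \<tau>)) = A (t(j := 0))" using c[of \<tau>] c[of 0] by simp
    qed simp
  qed
  then show "\<exists>\<epsilon>>0. \<forall>\<tau>. 0 \<le> \<tau> \<and> \<tau> \<le> \<epsilon> \<longrightarrow> (partial_deriv j ^^ 0) A (t(j := \<tau>)) = (partial_deriv j ^^ 0) A (t(j := 0))"
    by (simp only: funpow_0)
qed

text \<open>The signs of the products, cut off at \<open>2 * n\<close>, are admissible coefficients
  in the series bound and turn the sum into one of absolute values. This treats the coordinates in
  which no cancellation is exploited.\<close>

lemma sum_abs_bound_1d:
  assumes ab: "a \<ge> -1/2" "b \<ge> -1/2"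
  shows "\<exists>c>0. \<forall>n x y. n \<ge> 1 \<and> x \<in> {-1..1} \<and> y \<in> {-1..1} \<longrightarrow>
    (\<Sum>k\<le>2*n. \<bar>jacobi_normalized k a b x * jacobi_normalized k a b y\<bar>)
      \<le> c * real n / (sqrt (shifted_weight (a + 1/2) (b + 1/2) (1 / (real n)\<^sup>2) x)
              * sqrt (shifted_weight (a + 1/2) (b + 1/2) (1 / (real n)\<^sup>2) y))"
proof -
  interpret jacobi_system a b by unfold_locales (fact ab)+
  obtain C P where C: "C \<ge> 0" and e: "\<And>n k \<theta>. n \<ge> 1 \<Longrightarrow> \<theta> \<in> {0..pi} \<Longrightarrow>
      (e k \<theta>)\<^sup>2 * W1 n (cos \<theta>) \<le> C * (1 + real k / real n) ^ P"
    using e_bound_scaled unfolding W1_def by blast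
  show ?thesis
    unfolding W1_def[symmetric]
  proof (rule exI[of _ "3 ^ (P + 2) * (2 * C) + 1"], intro conjI allI impI)
    show "0 < 3 ^ (P + 2) * (2 * C) + 1" using C by (intro add_nonneg_pos) auto
    fix n :: nat and x y :: real assume "n \<ge> 1 \<and> x \<in> {-1..1} \<and> y \<in> {-1..1}"
    then have n: "n \<ge> 1" and xy: "-1 \<le> x" "x \<le> 1" "-1 \<le> y" "y \<le> 1" by auto
    define \<theta> \<phi> where "\<theta> = arccos x" and "\<phi> = arccos y"
    have \<theta>: "\<theta> \<in> {0..pi}" "\<phi> \<in> {0..pi}" "cos \<theta> = x" "cos \<phi> = y"
      using xy by (auto simp: \<theta>_def \<phi>_def arccos_lbound arccos_ubound)
    have n0: "real n > 0" using n by simp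
    have W: "sqrt (W1 n x) * sqrt (W1 n y) > 0" using W1_pos[OF n] xy by simp
    define c where "c k = (if k \<le> 2*n then complex_of_real (sgn (e k \<theta> * e k \<phi>)) else 0)" for k
    have z: "0 \<le> (3::real) ^ (P + 2)" by simp
    have c: "norm (c k) \<le> 3 ^ (P + 2) * (1 / (1 + real k / real n) ^ (P + 2))" for k
    proof (cases "k \<le> 2 * n")
      case True
      have "real k \<le> 2 * real n" using True by (metis of_nat_le_iff of_nat_mult of_nat_numeral)
      then have "real k / real n \<le> 2" using n0 by (simp add: pos_divide_le_eq)
      then have "(1 + real k / real n) ^ (P + 2) \<le> 3 ^ (P + 2)" by (intro power_mono) auto
      then have "1 \<le> 3 ^ (P + 2) / (1 + real k / real n) ^ (P + 2)"
        by (simp add: pos_le_divide_eq add_pos_nonneg)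
      moreover have "norm (c k) \<le> 1" by (auto simp: c_def sgn_if)
      ultimately show ?thesis by simp
    qed (simp add: c_def)
    have "norm (\<Sum>k<2*n+1. c k * of_real (e k \<theta> * e k \<phi>)) \<le> 3 ^ (P + 2) * (2 * C) * real n / (sqrt (W1 n (cos \<theta>)) * sqrt (W1 n (cos \<phi>)))"
      by (rule series_bound(3)[OF e[OF n] C n \<theta>(1,2) z c])
    moreover have "(\<Sum>k<2*n+1. c k * of_real (e k \<theta> * e k \<phi>)) = of_real (\<Sum>k\<le>2*n. \<bar>e k \<theta> * e k \<phi>\<bar>)"
      unfolding of_real_sum
    proof (intro sum.cong)
      fix k assume "k \<in> {..2*n}"
      then show "c k * of_real (e k \<theta> * e k \<phi>) = of_real \<bar>e k \<theta> * e k \<phi>\<bar>"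
        unfolding c_def by (simp only: of_real_mult[symmetric] abs_sgn mult.commute[of "sgn _"] atMost_iff if_True)
    qed auto
    ultimately have "\<bar>\<Sum>k\<le>2*n. \<bar>e k \<theta> * e k \<phi>\<bar>\<bar> \<le> 3 ^ (P + 2) * (2 * C) * real n / (sqrt (W1 n x) * sqrt (W1 n y))"
      by (simp only: norm_of_real \<theta>(3,4))
    then have "(\<Sum>k\<le>2*n. \<bar>e k \<theta> * e k \<phi>\<bar>) \<le> 3 ^ (P + 2) * (2 * C) * real n / (sqrt (W1 n x) * sqrt (W1 n y))"
      by (rule order.trans[OF abs_ge_self])
    also have "\<dots> \<le> (3 ^ (P + 2) * (2 * C) + 1) * real n / (sqrt (W1 n x) * sqrt (W1 n y))"
      using W by (intro divide_right_mono mult_right_mono) auto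
    finally show "(\<Sum>k\<le>2*n. \<bar>jacobi_normalized k a b x * jacobi_normalized k a b y\<bar>)
        \<le> (3 ^ (P + 2) * (2 * C) + 1) * real n / (sqrt (W1 n x) * sqrt (W1 n y))"
      by (simp add: \<theta>_def \<phi>_def e_arccos xy)
  qed
qed

lemma shifted_weight_nonneg: "0 \<le> shifted_weight A B r x"
  by (simp add: shifted_weight_def)

lemma sqrt_W_eq:
  "sqrt (W d \<alpha> \<beta> n x) = (\<Prod>j<d. sqrt (shifted_weight (\<alpha> j + 1/2) (\<beta> j + 1/2) (1 / (real n)\<^sup>2) (x j)))"
  unfolding W_def shifted_weight_def[symmetric] by (induction d) (simp_all add: real_sqrt_mult)

text \<open>Separates the coordinate \<open>j\<close>, in which the points \<open>x\<close> and \<open>y\<close> are farthest apart, from the others.\<close>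

lemma cutoff_kernel_slice:
  fixes A :: "(nat \<Rightarrow> real) \<Rightarrow> complex"
  assumes j: "j < d" and n: "n \<ge> 1"
    and supp: "\<And>t. t \<in> orthant d \<Longrightarrow> \<exists>i<d. t i > 2 \<Longrightarrow> A t = 0"
  defines "I \<equiv> {..<d} - {j}"
  defines "pt \<equiv> \<lambda>p i. if i \<in> I then real (p i :: nat) / real n else 0"
  shows "cutoff_kernel d \<alpha> \<beta> A n x y = (\<Sum>p\<in>PiE I (\<lambda>_. {..2*n}).
     (\<Sum>k\<le>2*n. A ((pt p)(j := real k / real n)) * of_real (jacobi_normalized k (\<alpha> j) (\<beta> j) (x j) * jacobi_normalized k (\<alpha> j) (\<beta> j) (y j)))
     * of_real (\<Prod>i\<in>I. jacobi_normalized (p i) (\<alpha> i) (\<beta> i) (x i) * jacobi_normalized (p i) (\<alpha> i) (\<beta> i) (y i)))"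
proof -
  let ?f = "\<lambda>\<nu>. A (\<lambda>i. real (\<nu> i) / real n) * of_real (jacobi_product d \<alpha> \<beta> \<nu> x) * of_real (jacobi_product d \<alpha> \<beta> \<nu> y)"
  let ?S = "\<lambda>_::nat. {..2*n}"
  \<comment> \<open>Reassembles a multi-index from its entry \<open>k\<close> at \<open>j\<close>
    and the remaining ones. Outside \<open>I\<close> the function \<open>p\<close> has the default
    value \<open>undefined\<close>, so \<open>G\<close> itself supplies the zeros beyond
    \<open>d\<close>.\<close>
  define G where "G = (\<lambda>(k, p) i. if i = j then k else if i \<in> I then p i else (0::nat))"
  define V where "V = {\<nu> \<in> multi_indices d. \<forall>i<d. \<nu> i \<le> 2*n}"
  have n0: "real n > 0" using n by simp
  have bij: "bij_betw G ({..2*n} \<times> PiE I ?S) V"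
  proof (rule bij_betwI[where g = "\<lambda>\<nu>. (\<nu> j, restrict \<nu> I)"])
    show "G \<in> {..2*n} \<times> PiE I ?S \<rightarrow> V"
    proof (rule Pi_I)
      fix z assume "z \<in> {..2*n} \<times> PiE I ?S"
      then obtain k p where z: "z = (k, p)" "k \<le> 2*n" "p \<in> PiE I ?S" by (elim SigmaE) simp
      have "p i \<le> 2*n" if "i \<in> I" for i using PiE_mem[OF z(3) that] by simp
      then have "G z i \<le> 2*n" for i using z(2) by (simp add: z(1) G_def)
      moreover have "G z i = 0" if "i \<ge> d" for i using that j by (simp add: z(1) G_def I_def)
      ultimately show "G z \<in> V" unfolding V_def multi_indices_def by blast
    qed
    show "(\<lambda>\<nu>. (\<nu> j, restrict \<nu> I)) \<in> V \<rightarrow> {..2*n} \<times> PiE I ?S"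
    proof (rule Pi_I)
      fix \<nu> assume "\<nu> \<in> V"
      then have "\<nu> i \<le> 2*n" if "i < d" for i using that by (simp add: V_def)
      then show "(\<nu> j, restrict \<nu> I) \<in> {..2*n} \<times> PiE I ?S"
        using j by (simp add: restrict_PiE_iff I_def)
    qed
    show "(G z j, restrict (G z) I) = z" if zz: "z \<in> {..2*n} \<times> PiE I ?S" for z
    proof -
      obtain k p where z: "z = (k, p)" "p \<in> PiE I ?S" using zz by (elim SigmaE) simp
      have "restrict (G z) I i = p i" for i
        using PiE_arb[OF z(2), of i] by (cases "i \<in> I") (auto simp: z(1) G_def I_def)
      then show ?thesis by (simp add: z(1) G_def fun_eq_iff)
    qed
    show "G (\<nu> j, restrict \<nu> I) = \<nu>" if "\<nu> \<in> V" for \<nu>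
    proof
      fix i
      have "\<nu> i = 0" if "i \<ge> d" using \<open>\<nu> \<in> V\<close> that by (simp add: V_def multi_indices_def)
      then show "G (\<nu> j, restrict \<nu> I) i = \<nu> i" by (cases "i < d") (auto simp: G_def I_def)
    qed
  qed
  have fin: "finite I" "finite ({..2*n} \<times> PiE I ?S)"
    by (auto simp: I_def intro!: finite_PiE)
  have finV: "finite V" using bij_betw_finite[OF bij] fin by blast
  \<comment> \<open>Outside \<open>V\<close> some entry exceeds \<open>2 * n\<close>, where the
    cutoff vanishes; the unordered sum thus becomes finite.\<close>
  have "cutoff_kernel d \<alpha> \<beta> A n x y = infsum ?f V"
    unfolding cutoff_kernel_def
  proof (rule infsum_cong_neutral)
    fix \<nu> assume \<nu>: "\<nu> \<in> multi_indices d - V"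
    then obtain i where i: "i < d" "2 * n < \<nu> i" by (auto simp: V_def not_le)
    have "(\<lambda>i. real (\<nu> i) / real n) \<in> orthant d" using \<nu> by (auto simp: orthant_def multi_indices_def)
    moreover have "real (\<nu> i) / real n > 2"
    proof -
      have "2 * real n < real (\<nu> i)" using i(2) by (metis of_nat_less_iff of_nat_mult of_nat_numeral)
      then show ?thesis using n0 by (simp add: pos_less_divide_eq)
    qed
    ultimately show "?f \<nu> = 0" using supp i(1) by auto
  qed (auto simp: V_def)
  also have "\<dots> = sum ?f V" by (rule infsum_finite[OF finV])
  also have "\<dots> = (\<Sum>z\<in>{..2*n} \<times> PiE I ?S. ?f (G z))"
    by (rule sum.reindex_bij_betw[OF bij, symmetric])
  also have "\<dots> = (\<Sum>k\<le>2*n. \<Sum>p\<in>PiE I ?S. ?f (G (k, p)))"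
    by (simp add: sum.cartesian_product)
  also have "\<dots> = (\<Sum>p\<in>PiE I ?S. \<Sum>k\<le>2*n. ?f (G (k, p)))" by (rule sum.swap)
  also have "\<dots> = (\<Sum>p\<in>PiE I ?S.
     (\<Sum>k\<le>2*n. A ((pt p)(j := real k / real n)) * of_real (jacobi_normalized k (\<alpha> j) (\<beta> j) (x j) * jacobi_normalized k (\<alpha> j) (\<beta> j) (y j)))
     * of_real (\<Prod>i\<in>I. jacobi_normalized (p i) (\<alpha> i) (\<beta> i) (x i) * jacobi_normalized (p i) (\<alpha> i) (\<beta> i) (y i)))"
    unfolding sum_distrib_right
  proof (intro sum.cong refl)
    fix p k
    have pt: "(\<lambda>i. real (G (k, p) i) / real n) = (pt p)(j := real k / real n)"
      by (auto simp: fun_eq_iff G_def pt_def I_def)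
    have P: "jacobi_product d \<alpha> \<beta> (G (k, p)) z
        = jacobi_normalized k (\<alpha> j) (\<beta> j) (z j) * (\<Prod>i\<in>I. jacobi_normalized (p i) (\<alpha> i) (\<beta> i) (z i))" for z
    proof -
      have "jacobi_product d \<alpha> \<beta> (G (k, p)) z = jacobi_normalized (G (k, p) j) (\<alpha> j) (\<beta> j) (z j)
          * (\<Prod>i\<in>I. jacobi_normalized (G (k, p) i) (\<alpha> i) (\<beta> i) (z i))"
        unfolding jacobi_product_def I_def using j by (intro prod.remove) auto
      also have "(\<Prod>i\<in>I. jacobi_normalized (G (k, p) i) (\<alpha> i) (\<beta> i) (z i)) = (\<Prod>i\<in>I. jacobi_normalized (p i) (\<alpha> i) (\<beta> i) (z i))"
        by (intro prod.cong) (auto simp: G_def I_def)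
      finally show ?thesis by (simp add: G_def)
    qed
    show "?f (G (k, p)) = A ((pt p)(j := real k / real n)) * of_real (jacobi_normalized k (\<alpha> j) (\<beta> j) (x j) * jacobi_normalized k (\<alpha> j) (\<beta> j) (y j))
     * of_real (\<Prod>i\<in>I. jacobi_normalized (p i) (\<alpha> i) (\<beta> i) (x i) * jacobi_normalized (p i) (\<alpha> i) (\<beta> i) (y i))"
      unfolding pt P prod.distrib of_real_mult by (simp only: mult_ac)
  qed
  finally show ?thesis .
qed

theorem theorem4p2:
  "\<exists>c'>0::real.
     \<forall>(d::nat) (\<alpha>::nat \<Rightarrow> real) (\<beta>::nat \<Rightarrow> real) (M::real) (\<gamma>::real) (\<gamma>'::real).
       d \<ge> 1 \<and> (\<forall>j<d. \<alpha> j \<ge> -1/2 \<and> \<beta> j \<ge> -1/2) \<and> \<gamma> > 0 \<and> \<gamma>' > 0 \<longrightarrow>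
       (\<exists>c>0::real.
          \<forall>(L::real \<Rightarrow> real) (A::(nat \<Rightarrow> real) \<Rightarrow> complex).
            (\<forall>t\<ge>0. L t \<ge> 1) \<and> mono_on {0..} L \<and> L 0 = 1 \<and>
            set_integrable lborel {0..} (\<lambda>t. 1 / ((t + 1) * L t)) \<and>
            M = 1 + (LINT t:{0..}|lborel. 1 / ((t + 1) * L t)) \<and>
            admissible_cutoff_second_kind d A \<and>
            A \<in> class_S d L \<gamma> (\<gamma>' * M) \<longrightarrow>
            (\<forall>n::nat. n \<ge> 1 \<longrightarrow>
               (\<forall>x y. (\<forall>j<d. x j \<in> {-1..1} \<and> y j \<in> {-1..1}) \<longrightarrow>
                  norm (cutoff_kernel d \<alpha> \<beta> A n x y)
                    \<le> c * real n ^ d / (sqrt (W d \<alpha> \<beta> n x) * sqrt (W d \<alpha> \<beta> n y))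
                       * exp (- (c' / (\<gamma>' * M) * real n * rho d x y / L (real n * rho d x y))))))"
proof -
  obtain c' where c': "c' > 0" and loc: "\<forall>a b M \<gamma> \<gamma>'. a \<ge> -1/2 \<and> b \<ge> -1/2 \<and> \<gamma> > 0 \<and> \<gamma>' > 0 \<and> M \<ge> 1 \<longrightarrow>
     (\<exists>c>0. \<forall>L G n x y. admissible_growth M L \<and> profile \<gamma> (\<gamma>' * M) L G \<and> n \<ge> 1 \<and> x \<in> {-1..1} \<and> y \<in> {-1..1} \<longrightarrow>
        norm (\<Sum>k\<le>2*n. G 0 (real k / real n) * of_real (jacobi_normalized k a b x * jacobi_normalized k a b y))
          \<le> c * real n / (sqrt (shifted_weight (a + 1/2) (b + 1/2) (1 / (real n)\<^sup>2) x)
              * sqrt (shifted_weight (a + 1/2) (b + 1/2) (1 / (real n)\<^sup>2) y))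
            * exp (- (c' / (\<gamma>' * M) * (real n * \<bar>arccos x - arccos y\<bar>) / L (real n * \<bar>arccos x - arccos y\<bar>))))"
    using localization_1d by (elim exE conjE)
  show ?thesis
  proof (rule exI[of _ c'], intro conjI c' allI impI)
    fix d :: nat and \<alpha> \<beta> :: "nat \<Rightarrow> real" and M \<gamma> \<gamma>' :: real
    assume *: "d \<ge> 1 \<and> (\<forall>j<d. \<alpha> j \<ge> -1/2 \<and> \<beta> j \<ge> -1/2) \<and> \<gamma> > 0 \<and> \<gamma>' > 0"
    let ?sw = "\<lambda>j n x. sqrt (shifted_weight (\<alpha> j + 1/2) (\<beta> j + 1/2) (1 / (real n)\<^sup>2) x)"
    let ?J = "\<lambda>j k x y. jacobi_normalized k (\<alpha> j) (\<beta> j) x * jacobi_normalized k (\<alpha> j) (\<beta> j) y"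
    \<comment> \<open>The constants for all coordinates are fixed before \<open>L\<close> and
      \<open>A\<close> appear. The premise \<open>M \<ge> 1\<close> sits inside because it is
      derived only later, from an admissible \<open>L\<close>.\<close>
    define Q1 where "Q1 j c \<longleftrightarrow> c > 0 \<and> (M \<ge> 1 \<longrightarrow> (\<forall>L G n x y.
        admissible_growth M L \<and> profile \<gamma> (\<gamma>' * M) L G \<and> n \<ge> 1 \<and> x \<in> {-1..1} \<and> y \<in> {-1..1} \<longrightarrow>
        norm (\<Sum>k\<le>2*n. G 0 (real k / real n) * of_real (?J j k x y))
          \<le> c * real n / (?sw j n x * ?sw j n y)
            * exp (- (c' / (\<gamma>' * M) * (real n * \<bar>arccos x - arccos y\<bar>) / L (real n * \<bar>arccos x - arccos y\<bar>)))))" for j c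
    have "\<forall>j. j < d \<longrightarrow> (\<exists>c. Q1 j c)"
    proof (intro allI impI)
      fix j assume j: "j < d"
      show "\<exists>c. Q1 j c"
      proof (cases "M \<ge> 1")
        case True
        have "\<alpha> j \<ge> -1/2 \<and> \<beta> j \<ge> -1/2 \<and> \<gamma> > 0 \<and> \<gamma>' > 0 \<and> M \<ge> 1" using * j True by blast
        from loc[THEN spec, THEN spec, THEN spec, THEN spec, THEN spec, THEN mp, OF this]
        show ?thesis unfolding Q1_def by blast
      next
        case False
        then show ?thesis unfolding Q1_def by (intro exI[of _ 1]) simp
      qed
    qed
    from choice_iff'[THEN iffD1, OF this] obtain c1 where "\<And>j. j < d \<Longrightarrow> Q1 j (c1 j)" by blast
    then have c1: "\<And>j. j < d \<Longrightarrow> c1 j > 0" "\<And>j L G n x y. j < d \<Longrightarrow> M \<ge> 1 \<Longrightarrow>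
        admissible_growth M L \<Longrightarrow> profile \<gamma> (\<gamma>' * M) L G \<Longrightarrow> n \<ge> 1 \<Longrightarrow> x \<in> {-1..1} \<Longrightarrow> y \<in> {-1..1} \<Longrightarrow>
        norm (\<Sum>k\<le>2*n. G 0 (real k / real n) * of_real (?J j k x y))
          \<le> c1 j * real n / (?sw j n x * ?sw j n y)
            * exp (- (c' / (\<gamma>' * M) * (real n * \<bar>arccos x - arccos y\<bar>) / L (real n * \<bar>arccos x - arccos y\<bar>)))"
      unfolding Q1_def by blast+
    define Q2 where "Q2 j c \<longleftrightarrow> c > 0 \<and> (\<forall>n x y. n \<ge> 1 \<and> x \<in> {-1..1} \<and> y \<in> {-1..1} \<longrightarrow>
        (\<Sum>k\<le>2*n. \<bar>?J j k x y\<bar>) \<le> c * real n / (?sw j n x * ?sw j n y))" for j c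
    have "\<forall>j. j < d \<longrightarrow> (\<exists>c. Q2 j c)"
      unfolding Q2_def using sum_abs_bound_1d * by blast
    from choice_iff'[THEN iffD1, OF this] obtain c2 where "\<And>j. j < d \<Longrightarrow> Q2 j (c2 j)" by blast
    then have c2: "\<And>j. j < d \<Longrightarrow> c2 j > 0" "\<And>j n x y. j < d \<Longrightarrow> n \<ge> 1 \<Longrightarrow> x \<in> {-1..1} \<Longrightarrow> y \<in> {-1..1} \<Longrightarrow>
        (\<Sum>k\<le>2*n. \<bar>?J j k x y\<bar>) \<le> c2 j * real n / (?sw j n x * ?sw j n y)"
      unfolding Q2_def by blast+
    \<comment> \<open>The coordinate \<open>j\<close> of largest distance depends on
      \<open>x\<close> and \<open>y\<close>, while \<open>c\<close> must not; so the constants of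
      all possible \<open>j\<close> are added up.\<close>
    define c where "c = (\<Sum>j<d. c1 j * (\<Prod>i\<in>{..<d} - {j}. c2 i))"
    have cj0: "c1 j * (\<Prod>i\<in>{..<d} - {j}. c2 i) > 0" if "j < d" for j
      using c1(1)[OF that] c2(1) by (intro mult_pos_pos prod_pos) auto
    have cj: "c1 j * (\<Prod>i\<in>{..<d} - {j}. c2 i) \<le> c" if "j < d" for j
      unfolding c_def using that cj0 by (intro member_le_sum) (auto intro: less_imp_le)
    have c: "c > 0" using cj0[of 0] cj[of 0] * by fastforce
    show "\<exists>c>0::real.
          \<forall>(L::real \<Rightarrow> real) (A::(nat \<Rightarrow> real) \<Rightarrow> complex).
            (\<forall>t\<ge>0. L t \<ge> 1) \<and> mono_on {0..} L \<and> L 0 = 1 \<and>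
            set_integrable lborel {0..} (\<lambda>t. 1 / ((t + 1) * L t)) \<and>
            M = 1 + (LINT t:{0..}|lborel. 1 / ((t + 1) * L t)) \<and>
            admissible_cutoff_second_kind d A \<and>
            A \<in> class_S d L \<gamma> (\<gamma>' * M) \<longrightarrow>
            (\<forall>n::nat. n \<ge> 1 \<longrightarrow>
               (\<forall>x y. (\<forall>j<d. x j \<in> {-1..1} \<and> y j \<in> {-1..1}) \<longrightarrow>
                  norm (cutoff_kernel d \<alpha> \<beta> A n x y)
                    \<le> c * real n ^ d / (sqrt (W d \<alpha> \<beta> n x) * sqrt (W d \<alpha> \<beta> n y))
                       * exp (- (c' / (\<gamma>' * M) * real n * rho d x y / L (real n * rho d x y)))))"
    proof (rule exI[of _ c], intro conjI c allI impI)
      fix L :: "real \<Rightarrow> real" and A :: "(nat \<Rightarrow> real) \<Rightarrow> complex" and n :: nat and x y :: "nat \<Rightarrow> real"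
      assume H: "(\<forall>t\<ge>0. L t \<ge> 1) \<and> mono_on {0..} L \<and> L 0 = 1 \<and>
            set_integrable lborel {0..} (\<lambda>t. 1 / ((t + 1) * L t)) \<and>
            M = 1 + (LINT t:{0..}|lborel. 1 / ((t + 1) * L t)) \<and>
            admissible_cutoff_second_kind d A \<and> A \<in> class_S d L \<gamma> (\<gamma>' * M)"
        and n: "n \<ge> 1" and xy: "\<forall>j<d. x j \<in> {-1..1} \<and> y j \<in> {-1..1}"
      have L: "admissible_growth M L" using H unfolding admissible_growth_def by blast
      have A: "admissible_cutoff_second_kind d A" "A \<in> class_S d L \<gamma> (\<gamma>' * M)" using H by blast+
      have M: "M \<ge> 1" by (rule admissible_growth_ge_one[OF L])
      have "rho d x y \<in> (\<lambda>j. \<bar>arccos (x j) - arccos (y j)\<bar>) ` {..<d}"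
        unfolding rho_def using * by (intro Max_in) (auto simp: lessThan_empty_iff)
      then obtain j where j: "j < d" "rho d x y = \<bar>arccos (x j) - arccos (y j)\<bar>" by auto
      define I where "I = {..<d} - {j}"
      define pt where "pt = (\<lambda>p i. if i \<in> I then real (p i :: nat) / real n else 0)"
      have supp: "A t = 0" if "t \<in> orthant d" "\<exists>i<d. t i > 2" for t
        using admissible_support[OF A(1) that(1)] that(2) by blast
      let ?ex = "exp (- (c' / (\<gamma>' * M) * (real n * rho d x y) / L (real n * rho d x y)))"
      let ?q = "\<lambda>i. real n / (?sw i n (x i) * ?sw i n (y i))"
      let ?inner = "\<lambda>p. \<Sum>k\<le>2*n. A ((pt p)(j := real k / real n)) * of_real (?J j k (x j) (y j))"
      \<comment> \<open>For fixed remaining indices the sum over the entry at \<open>j\<close> is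
        one-dimensional, with the restricted cutoff as its profile. It carries the full exponential
        because \<open>j\<close> attains the maximum in \<open>rho\<close>.\<close>
      have inner: "norm (?inner p) \<le> c1 j * ?q j * ?ex" for p
      proof -
        have "pt p \<in> orthant d" by (auto simp: pt_def orthant_def I_def)
        from profile_restriction[OF A j(1) this]
        have "profile \<gamma> (\<gamma>' * M) L (\<lambda>l \<tau>. (partial_deriv j ^^ l) A ((pt p)(j := \<tau>)))" .
        from c1(2)[OF j(1) M L this n, of "x j" "y j"] show ?thesis
          using xy j by simp
      qed
      have q: "?q i \<ge> 0" for i by (simp add: shifted_weight_nonneg)
      have fin: "finite I" by (simp add: I_def)
      have eq: "cutoff_kernel d \<alpha> \<beta> A n x y = (\<Sum>p\<in>PiE I (\<lambda>_. {..2*n}). ?inner p * of_real (\<Prod>i\<in>I. ?J i (p i) (x i) (y i)))"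
        unfolding I_def pt_def by (rule cutoff_kernel_slice[OF j(1) n supp])
      have "norm (\<Sum>p\<in>PiE I (\<lambda>_. {..2*n}). ?inner p * of_real (\<Prod>i\<in>I. ?J i (p i) (x i) (y i)))
          \<le> (\<Sum>p\<in>PiE I (\<lambda>_. {..2*n}). (c1 j * ?q j * ?ex) * (\<Prod>i\<in>I. \<bar>?J i (p i) (x i) (y i)\<bar>))"
      proof (rule sum_norm_le)
        fix p
        have "norm (?inner p * of_real (\<Prod>i\<in>I. ?J i (p i) (x i) (y i))) = norm (?inner p) * (\<Prod>i\<in>I. \<bar>?J i (p i) (x i) (y i)\<bar>)"
          by (simp only: norm_mult norm_of_real abs_prod)
        also have "\<dots> \<le> (c1 j * ?q j * ?ex) * (\<Prod>i\<in>I. \<bar>?J i (p i) (x i) (y i)\<bar>)"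
          by (intro mult_right_mono inner prod_nonneg) auto
        finally show "norm (?inner p * of_real (\<Prod>i\<in>I. ?J i (p i) (x i) (y i))) \<le> (c1 j * ?q j * ?ex) * (\<Prod>i\<in>I. \<bar>?J i (p i) (x i) (y i)\<bar>)" .
      qed
      \<comment> \<open>The bound for the inner sum is free of \<open>p\<close>, so the sum of
        products factors into one-dimensional sums.\<close>
      also have "\<dots> = (c1 j * ?q j * ?ex) * (\<Prod>i\<in>I. \<Sum>k\<le>2*n. \<bar>?J i k (x i) (y i)\<bar>)"
        unfolding sum_distrib_left[symmetric] by (subst prod_sum_PiE) (use fin in auto)
      also have "\<dots> \<le> (c1 j * ?q j * ?ex) * (\<Prod>i\<in>I. c2 i * ?q i)"
      proof (intro mult_left_mono prod_mono conjI)
        fix i assume "i \<in> I"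
        then have i: "i < d" by (simp add: I_def)
        show "0 \<le> (\<Sum>k\<le>2*n. \<bar>?J i k (x i) (y i)\<bar>)" by (intro sum_nonneg) auto
        show "(\<Sum>k\<le>2*n. \<bar>?J i k (x i) (y i)\<bar>) \<le> c2 i * ?q i"
          using c2(2)[OF i n, of "x i" "y i"] xy i by simp
      qed (use c1(1)[OF j(1)] q[of j] in \<open>intro mult_nonneg_nonneg, auto\<close>)
      also have "\<dots> = (c1 j * (\<Prod>i\<in>I. c2 i)) * (?q j * (\<Prod>i\<in>I. ?q i)) * ?ex"
        unfolding prod.distrib by (simp only: mult_ac)
      also have "?q j * (\<Prod>i\<in>I. ?q i) = (\<Prod>i<d. ?q i)"
        unfolding I_def using j(1) by (intro prod.remove[symmetric]) auto
      also have "(\<Prod>i<d. ?q i) = real n ^ d / (sqrt (W d \<alpha> \<beta> n x) * sqrt (W d \<alpha> \<beta> n y))"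
        unfolding sqrt_W_eq by (simp add: prod_dividef prod.distrib)
      also have "(c1 j * (\<Prod>i\<in>I. c2 i)) * (real n ^ d / (sqrt (W d \<alpha> \<beta> n x) * sqrt (W d \<alpha> \<beta> n y))) * ?ex
          \<le> c * (real n ^ d / (sqrt (W d \<alpha> \<beta> n x) * sqrt (W d \<alpha> \<beta> n y))) * ?ex"
        using cj[OF j(1)] unfolding I_def
        by (intro mult_right_mono) (auto intro!: divide_nonneg_nonneg mult_nonneg_nonneg prod_nonneg simp: W_def)
      finally show "norm (cutoff_kernel d \<alpha> \<beta> A n x y)
                    \<le> c * real n ^ d / (sqrt (W d \<alpha> \<beta> n x) * sqrt (W d \<alpha> \<beta> n y))
                       * exp (- (c' / (\<gamma>' * M) * real n * rho d x y / L (real n * rho d x y)))"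
        unfolding eq by (simp only: times_divide_eq_right mult.assoc)
    qed
  qed
qed

end
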